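(* Let $G$ be a countable directed graph which satisfies the uniform aperiodic path property and let $A\in\mathfrak{L}_G$. If $k\in\mathbb{N}$ and $\|A\|<1-\frac{1}{k}$, then $A$ is the average of $6k$ isometries in $\mathfrak{L}_G$, i.e. there are isometries $V_1,\dots,V_{6k}\in\mathfrak{L}_G$ with $A=\frac{1}{6k}\sum_{i=1}^{6k}V_i$.
   Context: $G$ is a countable directed graph with edge set $E(G)$ and vertex set $V(G)$; $s(e)$, $r(e)$ denote the source and range vertices of an edge $e$. The free semigroupoid $\mathbb{F}^+(G)$ is the set of all vertices and all finite paths $w=e_k\cdots e_1$ of $G$ (with $s(e_{i+1})=r(e_i)$, $s(w)=s(e_1)$, $r(w)=r(e_k)$, and $s(x)=r(x)=x$ for vertices), with concatenation. $\mathcal{H}_G$ is the Hilbert space with orthonormal basis $\{\xi_w : w\in\mathbb{F}^+(G)\}$. For $e\in E(G)$, $L_e\xi_w=\xi_{ew}$ if $r(w)=s(e)$ and $0$ otherwise; for $x\in V(G)$, $P_x$ is the projection onto $\overline{\mathrm{span}}\{\xi_w: r(w)=x\}$. The free semigroupoid algebra $\mathfrak{L}_G$ is the weak-operator-topology closed algebra generated by $\{L_e,P_x : e\in E(G),x\in V(G)\}$. Uniform aperiodic path property: the saturation of each vertex $x\in V(G)$ contains either two distinct loops or an infinite proper path. Here the saturation of $x$ is the subgraph consisting of all vertices and edges lying on paths $w\in\mathbb{F}^+(G)$ with $s(w)=x$; a loop is a path $w$ consisting of at least one edge with $s(w)=r(w)$; "two distinct loops" means two loops $u,v$ based at a common vertex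 which are not both powers of a single loop; and an infinite proper path is an infinite sequence of edges $e_1,e_2,\dots$ with $s(e_{i+1})=r(e_i)$ for all $i$ which visits no vertex more than once. *)

theory Defs
  imports "HOL-Analysis.Analysis" "Graph_Theory.Arc_Walk"
begin

section \<open>Complex Hilbert spaces\<close>

text \<open>The real Hilbert space structure underlying a complex one is the library's: the norm of
  \<open>real_inner\<close> and the completeness of \<open>banach\<close>. The complex inner product is linear in the first
  argument.\<close>

class chilbert_space = real_inner + banach +
  fixes scaleC :: "complex \<Rightarrow> 'a \<Rightarrow> 'a"  (infixr "*\<^sub>C" 75)
    and cinner :: "'a \<Rightarrow> 'a \<Rightarrow> complex"
  assumes scaleC_add_right: "c *\<^sub>C (x + y) = c *\<^sub>C x + c *\<^sub>C y"
    and scaleC_add_left: "(b + c) *\<^sub>C x = b *\<^sub>C x + c *\<^sub>C x"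
    and scaleC_scaleC: "b *\<^sub>C c *\<^sub>C x = (b * c) *\<^sub>C x"
    and scaleC_of_real: "complex_of_real r *\<^sub>C x = r *\<^sub>R x"
    and cinner_add_left: "cinner (x + y) z = cinner x z + cinner y z"
    and cinner_scaleC_left: "cinner (c *\<^sub>C x) y = c * cinner x y"
    and cinner_commute: "cinner x y = cnj (cinner y x)"
    and Re_cinner: "Re (cinner x y) = inner x y"

global_interpretation complex_vector: vector_space "scaleC :: complex \<Rightarrow> 'a \<Rightarrow> 'a::chilbert_space"
  defines cspan = complex_vector.span
proof unfold_locales
  fix x :: 'a
  show "1 *\<^sub>C x = x"
    using scaleC_of_real[of 1 x] by simp
qed (simp_all add: scaleC_add_right scaleC_add_left scaleC_scaleC)

abbreviation clinear :: "('a::chilbert_space \<Rightarrow> 'b::chilbert_space) \<Rightarrow> bool" where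
  "clinear \<equiv> Vector_Spaces.linear scaleC scaleC"

lemma norm_scaleC: "norm (c *\<^sub>C (x::'a::chilbert_space)) = cmod c * norm x"
proof -
  have real: "cinner x x = complex_of_real (inner x x)"
  proof (rule complex_eqI)
    have "Im (cinner x x) = - Im (cinner x x)"
      using arg_cong[OF cinner_commute[of x x], of Im] by simp
    then show "Im (cinner x x) = Im (complex_of_real (inner x x))"
      by simp
  qed (simp add: Re_cinner)
  have "cinner (c *\<^sub>C x) (c *\<^sub>C x) = c * (cnj c * cinner x x)"
    by (simp only: cinner_scaleC_left cinner_commute[of x "c *\<^sub>C x"] complex_cnj_mult
        cinner_commute[of x x, symmetric])
  also have "\<dots> = complex_of_real ((cmod c)\<^sup>2 * inner x x)"
    by (simp only: real of_real_mult complex_norm_square mult.assoc)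
  finally have "inner (c *\<^sub>C x) (c *\<^sub>C x) = (cmod c)\<^sup>2 * inner x x"
    by (simp only: Re_cinner[symmetric] Re_complex_of_real)
  then show ?thesis
    by (simp add: norm_eq_sqrt_inner real_sqrt_mult)
qed

definition orthonormal_basis :: "('i \<Rightarrow> 'h::chilbert_space) \<Rightarrow> 'i set \<Rightarrow> bool" where
  "orthonormal_basis \<xi> I \<longleftrightarrow>
     (\<forall>v\<in>I. \<forall>w\<in>I. cinner (\<xi> v) (\<xi> w) = (if v = w then 1 else 0)) \<and>
     closure (cspan (\<xi> ` I)) = UNIV"

section \<open>Bounded operators and the weak operator topology\<close>

text \<open>Elements of \<open>'h \<Rightarrow>\<^sub>L 'h\<close> are only real linear; B(H) consists of those that are
  complex linear. The norm of \<open>'h \<Rightarrow>\<^sub>L 'h\<close> is the operator norm.\<close>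

definition bounded_operators :: "('h::chilbert_space \<Rightarrow>\<^sub>L 'h) set" where
  "bounded_operators = {T. clinear (blinfun_apply T)}"

lift_definition scaleC_blinfun ::
    "complex \<Rightarrow> ('h::chilbert_space \<Rightarrow>\<^sub>L 'h) \<Rightarrow> ('h \<Rightarrow>\<^sub>L 'h)"
  is "\<lambda>c T h. c *\<^sub>C T h"
proof -
  fix c :: complex and T :: "'h \<Rightarrow> 'h"
  assume "bounded_linear T"
  moreover have "bounded_linear (\<lambda>x::'h. c *\<^sub>C x)"
  proof (rule bounded_linear_intro[where K = "cmod c"])
    fix r :: real and x :: 'h
    show "c *\<^sub>C r *\<^sub>R x = r *\<^sub>R c *\<^sub>C x"
      by (simp only: scaleC_scaleC mult.commute flip: scaleC_of_real)
  qed (simp_all add: scaleC_add_right norm_scaleC)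
  ultimately show "bounded_linear (\<lambda>h. c *\<^sub>C T h)"
    by (rule bounded_linear_compose[rotated])
qed

text \<open>\<open>euclidean\<close> is the product topology on functions into the complex numbers, so this is the
  coarsest topology on B(H) for which all maps sending T to the inner product of T x with y are
  continuous.\<close>

definition weak_operator_topology :: "('h::chilbert_space \<Rightarrow>\<^sub>L 'h) topology" where
  "weak_operator_topology =
     pullback_topology bounded_operators (\<lambda>T (x, y). cinner (blinfun_apply T x) y) euclidean"

definition operator_algebra :: "('h::chilbert_space \<Rightarrow>\<^sub>L 'h) set \<Rightarrow> bool" where
  "operator_algebra S \<longleftrightarrow> S \<subseteq> bounded_operators \<and> 0 \<in> S \<and>
     (\<forall>c. \<forall>T\<in>S. scaleC_blinfun c T \<in> S) \<and>
     (\<forall>T\<in>S. \<forall>U\<in>S. T + U \<in> S \<and> T o\<^sub>L U \<in> S)"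

definition is_orthogonal_projection ::
    "('h::chilbert_space \<Rightarrow>\<^sub>L 'h) \<Rightarrow> 'h set \<Rightarrow> bool" where
  "is_orthogonal_projection P M \<longleftrightarrow> P \<in> bounded_operators \<and>
     (\<forall>h. blinfun_apply P h \<in> M \<and> (\<forall>m\<in>M. cinner (h - blinfun_apply P h) m = 0))"

definition is_isometry :: "('h::chilbert_space \<Rightarrow>\<^sub>L 'h) \<Rightarrow> bool" where
  "is_isometry V \<longleftrightarrow> V \<in> bounded_operators \<and> (\<forall>h. norm (blinfun_apply V h) = norm h)"

section \<open>The free semigroupoid of a directed graph\<close>

text \<open>The path \<open>e\<^sub>k \<dots> e\<^sub>1\<close> with source \<open>x\<close> is the pair of \<open>x\<close> and the list \<open>[e\<^sub>1, \<dots>, e\<^sub>k]\<close>, in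
  order of traversal; the vertex \<open>x\<close> is the pair of \<open>x\<close> and \<open>[]\<close>. Left multiplication by an edge
  therefore appends it to the list.\<close>

type_synonym ('v, 'e) path = "'v \<times> 'e list"

definition free_semigroupoid :: "('v, 'e) pre_digraph \<Rightarrow> ('v, 'e) path set" where
  "free_semigroupoid G = {(x, p). \<exists>y. pre_digraph.awalk G x p y}"

definition path_range :: "('v, 'e) pre_digraph \<Rightarrow> ('v, 'e) path \<Rightarrow> 'v" where
  "path_range G w = pre_digraph.awlast G (fst w) (snd w)"

definition edge_mult :: "'e \<Rightarrow> ('v, 'e) path \<Rightarrow> ('v, 'e) path" where
  "edge_mult e w = (fst w, snd w @ [e])"

section \<open>Free semigroupoid algebras\<close>

text \<open>In this section \<open>\<xi>\<close> is meant to be an orthonormal basis of \<open>'h\<close> indexed by the free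
  semigroupoid of \<open>G\<close>, so that \<open>'h\<close> is the Fock space of \<open>G\<close>, and the two predicates below
  determine the operators \<open>L\<^sub>e\<close> and \<open>P\<^sub>x\<close> uniquely.\<close>

definition is_edge_operator ::
    "('v, 'e) pre_digraph \<Rightarrow> (('v, 'e) path \<Rightarrow> 'h::chilbert_space) \<Rightarrow> 'e \<Rightarrow> ('h \<Rightarrow>\<^sub>L 'h) \<Rightarrow> bool" where
  "is_edge_operator G \<xi> e T \<longleftrightarrow> T \<in> bounded_operators \<and>
     (\<forall>w\<in>free_semigroupoid G.
        blinfun_apply T (\<xi> w) = (if path_range G w = tail G e then \<xi> (edge_mult e w) else 0))"

definition is_vertex_projection ::
    "('v, 'e) pre_digraph \<Rightarrow> (('v, 'e) path \<Rightarrow> 'h::chilbert_space) \<Rightarrow> 'v \<Rightarrow> ('h \<Rightarrow>\<^sub>L 'h) \<Rightarrow> bool" where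
  "is_vertex_projection G \<xi> x T \<longleftrightarrow>
     is_orthogonal_projection T
       (closure (cspan (\<xi> ` {w \<in> free_semigroupoid G. path_range G w = x})))"

definition free_semigroupoid_algebra ::
    "('v, 'e) pre_digraph \<Rightarrow> (('v, 'e) path \<Rightarrow> 'h::chilbert_space) \<Rightarrow> ('h \<Rightarrow>\<^sub>L 'h) set" where
  "free_semigroupoid_algebra G \<xi> =
     (\<lambda>S. operator_algebra S \<and> closedin weak_operator_topology S) hull
       ({T. \<exists>e\<in>arcs G. is_edge_operator G \<xi> e T} \<union>
        {T. \<exists>x\<in>verts G. is_vertex_projection G \<xi> x T})"

section \<open>The uniform aperiodic path property\<close>

definition saturation :: "('v, 'e) pre_digraph \<Rightarrow> 'v \<Rightarrow> ('v, 'e) pre_digraph" where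
  "saturation G x =
     \<lparr>verts = (\<Union>p\<in>{p. (x, p) \<in> free_semigroupoid G}. set (pre_digraph.awalk_verts G x p)),
      arcs = (\<Union>p\<in>{p. (x, p) \<in> free_semigroupoid G}. set p),
      tail = tail G, head = head G\<rparr>"

definition loop_at :: "('v, 'e) pre_digraph \<Rightarrow> 'v \<Rightarrow> 'e list \<Rightarrow> bool" where
  "loop_at H y p \<longleftrightarrow> pre_digraph.awalk H y p y \<and> p \<noteq> []"

definition has_two_distinct_loops :: "('v, 'e) pre_digraph \<Rightarrow> bool" where
  "has_two_distinct_loops H \<longleftrightarrow>
     (\<exists>y u v. loop_at H y u \<and> loop_at H y v \<and>
        \<not> (\<exists>z c m n. loop_at H z c \<and>
              u = concat (replicate m c) \<and> v = concat (replicate n c)))"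

text \<open>Since \<open>head (e i) = tail (e (i + 1))\<close>, the vertices visited by an infinite path are the
  tails of its edges.\<close>

definition has_infinite_proper_path :: "('v, 'e) pre_digraph \<Rightarrow> bool" where
  "has_infinite_proper_path H \<longleftrightarrow>
     (\<exists>e :: nat \<Rightarrow> 'e. (\<forall>i. e i \<in> arcs H \<and> tail H (e (Suc i)) = head H (e i)) \<and>
        inj (\<lambda>i. tail H (e i)))"

definition uniform_aperiodic_path_property :: "('v, 'e) pre_digraph \<Rightarrow> bool" where
  "uniform_aperiodic_path_property G \<longleftrightarrow>
     (\<forall>x\<in>verts G. has_two_distinct_loops (saturation G x) \<or>
                   has_infinite_proper_path (saturation G x))"

end

theory Submission
  imports Defs
begin

text \<open>The hypothesis on \<open>G\<close> enters only through two isometries \<open>X\<^sub>0\<close>, \<open>X\<^sub>1\<close> of the algebra with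
  orthogonal ranges (\<open>orthogonal_isometries_exist\<close>). They map \<open>\<xi> w\<close> to \<open>\<xi> (u w)\<close>, where the path \<open>u\<close>
  depends on the range of \<open>w\<close> and the chosen paths form a suffix code. The remaining argument takes
  place in the algebra itself.

  Let \<open>\<parallel>A\<parallel> < 1\<close>. The algebra contains an operator \<open>D\<close> with \<open>A\<^sup>* A + D\<^sup>* D = 1\<close>
  (\<open>outer_factor_exists\<close>). If \<open>P\<close>, \<open>Q\<close> and \<open>J\<close> are isometries of the algebra and \<open>P\<close>, \<open>Q\<close> have
  orthogonal ranges, then \<open>P A + Q J D\<close> is an isometry, and for three \<open>J\<close> with sum zero the average of
  these isometries is \<open>P A\<close>. Averaging over several \<open>P\<close>, it remains to write a scalar as an average of
  isometries \<open>P\<close> that are proper in the sense that such a \<open>Q\<close> exists.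

  For scalars the argument of Kadison and Pedersen works: if \<open>U\<close> is proper and \<open>0 \<le> c < 1\<close>, then
  \<open>U + c\<close> is a sum of two proper isometries (\<open>proper_translate\<close>). Iterating this from \<open>X\<^sub>0\<close> and from
  \<open>- X\<^sub>0\<close>, the scalar \<open>2 (k - 1) c\<close> is a sum of \<open>2 k\<close> proper isometries. An operator of norm less than
  \<open>1 - 1/k\<close> has the form \<open>(1 - 1/k) c B\<close> with \<open>c < 1\<close> and \<open>\<parallel>B\<parallel> < 1\<close>, so it is the average of
  \<open>3 \<cdot> 2 k\<close> isometries.

  Membership in the algebra is checked through \<open>algebra_eq_commutant\<close>: the algebra consists of the
  bounded operators that commute with the right creation operators and with the projections onto the
  paths of given source. One inclusion holds because this commutant is closed in the weak operator
  topology. For the other, an operator in the commutant is recovered from its Fourier series over the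
  paths by Fejer means. The commutant description also produces \<open>D\<close>: the form
  \<open>\<langle>h, k\<rangle> - \<langle>A h, A k\<rangle>\<close> has the same invariance under right creation operators as the inner
  product, so it has an orthonormal basis made of the translates of its vacuum vectors, and \<open>D\<close> is the
  change of basis.\<close>

section \<open>Complex inner products and bounded operators\<close>

lemma cinner_add_right: "cinner x (y + z) = cinner x y + cinner x (z::'a::chilbert_space)"
  by (metis cinner_commute cinner_add_left complex_cnj_add)

lemma cinner_scaleC_right: "cinner x (c *\<^sub>C y) = cnj c * cinner x (y::'a::chilbert_space)"
  by (metis cinner_commute cinner_scaleC_left complex_cnj_mult)

lemma cinner_scaleR_left: "cinner (r *\<^sub>R x) y = r * cinner x (y::'a::chilbert_space)"
  by (metis cinner_scaleC_left scaleC_of_real)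

lemma cinner_scaleR_right: "cinner x (r *\<^sub>R y) = r * cinner x (y::'a::chilbert_space)"
  by (metis cinner_scaleC_right complex_cnj_complex_of_real scaleC_of_real)

lemma cinner_zero_left [simp]: "cinner 0 (x::'a::chilbert_space) = 0"
  using cinner_scaleR_left[of 0 x x] by simp

lemma cinner_zero_right [simp]: "cinner (x::'a::chilbert_space) 0 = 0"
  using cinner_scaleR_right[of x 0 x] by simp

lemma cinner_minus_left: "cinner (- x) y = - cinner x (y::'a::chilbert_space)"
  using cinner_scaleR_left[of "-1" x y] by simp

lemma cinner_minus_right: "cinner x (- y) = - cinner x (y::'a::chilbert_space)"
  using cinner_scaleR_right[of x "-1" y] by simp

lemma cinner_diff_left: "cinner (x - y) z = cinner x z - cinner y (z::'a::chilbert_space)"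
  using cinner_add_left[of x "- y" z] by (simp add: cinner_minus_left)

lemma cinner_diff_right: "cinner x (y - z) = cinner x y - cinner x (z::'a::chilbert_space)"
  using cinner_add_right[of x y "- z"] by (simp add: cinner_minus_right)

lemma cinner_sum_left: "cinner (sum f F) y = (\<Sum>i\<in>F. cinner (f i) (y::'a::chilbert_space))"
  by (induction F rule: infinite_finite_induct) (simp_all add: cinner_add_left)

lemma cinner_sum_right: "cinner y (sum f F) = (\<Sum>i\<in>F. cinner (y::'a::chilbert_space) (f i))"
  by (induction F rule: infinite_finite_induct) (simp_all add: cinner_add_right)

lemmas cinner_simps = cinner_add_left cinner_add_right cinner_diff_left cinner_diff_right
  cinner_scaleC_left cinner_scaleC_right cinner_scaleR_left cinner_scaleR_right

lemma cinner_self: "cinner x x = complex_of_real ((norm (x::'a::chilbert_space))\<^sup>2)"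
proof (rule complex_eqI)
  have "Im (cinner x x) = - Im (cinner x x)"
    using arg_cong[OF cinner_commute[of x x], of Im] by simp
  then show "Im (cinner x x) = Im (complex_of_real ((norm x)\<^sup>2))"
    by simp
qed (simp add: Re_cinner power2_norm_eq_inner)

lemma cmod_cinner_le: "cmod (cinner x y) \<le> norm x * norm (y::'a::chilbert_space)"
proof -
  define c where "c = (if cinner x y = 0 then 1 else cnj (cinner x y) / cmod (cinner x y))"
  have c: "cmod c = 1" "c * cinner x y = cmod (cinner x y)"
    using complex_norm_square[of "cinner x y"]
    by (auto simp: c_def norm_divide power2_eq_square divide_simps mult.commute)
  have "cmod (cinner x y) = inner (c *\<^sub>C x) y"
    by (metis Re_cinner Re_complex_of_real c(2) cinner_scaleC_left)
  also have "\<dots> \<le> norm (c *\<^sub>C x) * norm y"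
    by (rule norm_cauchy_schwarz)
  finally show ?thesis
    by (simp add: norm_scaleC c)
qed

lemma bounded_linear_cinner_left: "bounded_linear (\<lambda>x. cinner x (y::'a::chilbert_space))"
  by (rule bounded_linear_intro[where K = "norm y"])
     (simp_all add: cinner_simps cmod_cinner_le scaleR_conv_of_real)

lemma bounded_linear_cinner_right: "bounded_linear (\<lambda>y. cinner (x::'a::chilbert_space) y)"
  by (rule bounded_linear_intro[where K = "norm x"])
     (simp_all add: cinner_simps scaleR_conv_of_real, metis cmod_cinner_le mult.commute)

lemmas tendsto_cinner_left [tendsto_intros] = bounded_linear.tendsto[OF bounded_linear_cinner_left]
  and tendsto_cinner_right [tendsto_intros] = bounded_linear.tendsto[OF bounded_linear_cinner_right]

lemma scaleC_scaleR_commute: "c *\<^sub>C (r *\<^sub>R (x::'a::chilbert_space)) = r *\<^sub>R c *\<^sub>C x"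
  by (simp only: scaleC_scaleC mult.commute flip: scaleC_of_real)

lemma bounded_linear_scaleC: "bounded_linear (\<lambda>x::'a::chilbert_space. c *\<^sub>C x)"
  by (rule bounded_linear_intro[where K = "cmod c"])
     (simp_all add: norm_scaleC scaleC_add_right scaleC_scaleR_commute)

lemma bounded_operators_iff:
  "T \<in> bounded_operators \<longleftrightarrow> (\<forall>c x. blinfun_apply T (c *\<^sub>C x) = c *\<^sub>C blinfun_apply T x)"
proof
  assume "T \<in> bounded_operators"
  then show "\<forall>c x. T (c *\<^sub>C x) = c *\<^sub>C T x"
    by (simp add: bounded_operators_def Vector_Spaces.linear_iff)
next
  assume "\<forall>c x. T (c *\<^sub>C x) = c *\<^sub>C T x"
  then show "T \<in> bounded_operators"
    by (simp add: bounded_operators_def Vector_Spaces.linear_iff blinfun.add_right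
        complex_vector.vector_space_axioms)
qed

lemma bounded_operators_scaleC:
  "T \<in> bounded_operators \<Longrightarrow> blinfun_apply T (c *\<^sub>C x) = c *\<^sub>C blinfun_apply T x"
  by (simp add: bounded_operators_iff)

lemma scaleC_diff_right: "c *\<^sub>C (x - y) = c *\<^sub>C x - c *\<^sub>C (y::'a::chilbert_space)"
  using bounded_linear_scaleC[of c, THEN bounded_linear.linear] by (rule linear_diff)

lemma bounded_operators_0 [simp]: "0 \<in> bounded_operators"
  by (simp add: bounded_operators_iff)

lemma bounded_operators_id [simp]: "id_blinfun \<in> bounded_operators"
  by (simp add: bounded_operators_iff)

lemma bounded_operators_add: "S \<in> bounded_operators \<Longrightarrow> T \<in> bounded_operators \<Longrightarrow> S + T \<in> bounded_operators"
  by (simp add: bounded_operators_iff blinfun.add_left scaleC_add_right)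

lemma bounded_operators_diff: "S \<in> bounded_operators \<Longrightarrow> T \<in> bounded_operators \<Longrightarrow> S - T \<in> bounded_operators"
  by (simp add: bounded_operators_iff blinfun.diff_left scaleC_diff_right)

lemma bounded_operators_scaleR: "T \<in> bounded_operators \<Longrightarrow> r *\<^sub>R T \<in> bounded_operators"
  by (simp add: bounded_operators_iff blinfun.scaleR_left scaleC_scaleR_commute)

lemma bounded_operators_compose:
  "S \<in> bounded_operators \<Longrightarrow> T \<in> bounded_operators \<Longrightarrow> S o\<^sub>L T \<in> bounded_operators"
  by (simp add: bounded_operators_iff)

lemma bounded_operators_scaleC_blinfun:
  "T \<in> bounded_operators \<Longrightarrow> scaleC_blinfun c T \<in> bounded_operators"
  by (simp add: bounded_operators_iff scaleC_blinfun.rep_eq scaleC_scaleC mult.commute)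

lemma bounded_operators_sum:
  "(\<And>i. i \<in> F \<Longrightarrow> T i \<in> bounded_operators) \<Longrightarrow> sum T F \<in> bounded_operators"
  by (induction F rule: infinite_finite_induct) (simp_all add: bounded_operators_add)

lemma scaleC_blinfun_of_real: "scaleC_blinfun (complex_of_real r) T = r *\<^sub>R T"
  by (rule blinfun_eqI) (simp add: scaleC_blinfun.rep_eq blinfun.scaleR_left scaleC_of_real)

lemma bounded_operators_closed_limit:
  assumes "F \<noteq> bot" "\<forall>\<^sub>F i in F. T i \<in> bounded_operators" "(T \<longlongrightarrow> S) F"
  shows "S \<in> (bounded_operators :: ('h::chilbert_space \<Rightarrow>\<^sub>L 'h) set)"
  unfolding bounded_operators_iff
proof (intro allI)
  fix c and x :: 'h
  have "((\<lambda>i. T i (c *\<^sub>C x)) \<longlongrightarrow> S (c *\<^sub>C x)) F"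
    by (intro tendsto_intros assms)
  moreover have "((\<lambda>i. c *\<^sub>C T i x) \<longlongrightarrow> c *\<^sub>C S x) F"
    by (intro bounded_linear.tendsto[OF bounded_linear_scaleC] tendsto_intros assms)
  then have "((\<lambda>i. T i (c *\<^sub>C x)) \<longlongrightarrow> c *\<^sub>C S x) F"
    by (rule Lim_transform_eventually)
       (use assms(2) in eventually_elim, simp add: bounded_operators_scaleC)
  ultimately show "S (c *\<^sub>C x) = c *\<^sub>C S x"
    using assms(1) tendsto_unique by blast
qed

text \<open>By polarization: the norm determines the real inner product, and
  \<open>Im \<langle>x, y\<rangle>\<close> is the real inner product of \<open>x\<close> and \<open>\<i> y\<close>.\<close>

lemma isometry_cinner:
  assumes "is_isometry V"
  shows "cinner (blinfun_apply V x) (blinfun_apply V y) = cinner x y"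
proof -
  have V: "V \<in> bounded_operators" and n: "\<And>h. norm (V h) = norm h"
    using assms by (auto simp: is_isometry_def)
  have re: "inner (V x) (V y) = inner x y" for x y
    using n[of "x + y"] n[of x] n[of y]
    by (simp add: blinfun.add_right norm_eq_sqrt_inner inner_add_left inner_add_right inner_commute)
  have im: "Im (cinner x y) = inner x (\<i> *\<^sub>C y)" for x y :: 'a
    by (simp add: cinner_scaleC_right flip: Re_cinner)
  show ?thesis
  proof (rule complex_eqI)
    show "Re (cinner (V x) (V y)) = Re (cinner x y)"
      by (simp add: Re_cinner re)
    show "Im (cinner (V x) (V y)) = Im (cinner x y)"
      by (simp add: im re flip: bounded_operators_scaleC[OF V])
  qed
qed

lemma norm_add_square:
  "(norm (x + y))\<^sup>2 = (norm x)\<^sup>2 + (norm y)\<^sup>2 + 2 * Re (cinner x (y::'a::chilbert_space))"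
  by (simp add: power2_norm_eq_inner inner_add_left inner_add_right inner_commute Re_cinner)

section \<open>Orthonormal bases\<close>

text \<open>The convergence criterion for orthogonal series: two finite partial sums that both contain a large
  finite set differ by at most the root of a tail of the convergent series of the \<open>a i\<close>.\<close>

lemma summable_on_if_square_bounded:
  fixes x :: "'i \<Rightarrow> 'a::banach"
  assumes a: "a summable_on I" "\<And>i. i \<in> I \<Longrightarrow> 0 \<le> a i"
    and le: "\<And>F. finite F \<Longrightarrow> F \<subseteq> I \<Longrightarrow> (norm (sum x F))\<^sup>2 \<le> (sum a F :: real)"
  shows "x summable_on I"
proof -
  have "cauchy_filter (filtermap (sum x) (finite_subsets_at_top I))"
    unfolding cauchy_filter_metric_filtermap
  proof (intro allI impI)
    fix e :: real
    assume e: "e > 0"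
    obtain L where "(a has_sum L) I"
      using a(1) by (auto simp: summable_on_def)
    then have "\<forall>\<^sub>F F in finite_subsets_at_top I. dist (sum a F) L < (e/2)\<^sup>2"
      unfolding has_sum_def using e tendstoD by (metis half_gt_zero zero_less_power)
    then obtain F0 where F0: "finite F0" "F0 \<subseteq> I"
      "\<And>F. finite F \<Longrightarrow> F0 \<subseteq> F \<Longrightarrow> F \<subseteq> I \<Longrightarrow> dist (sum a F) L < (e/2)\<^sup>2"
      unfolding eventually_finite_subsets_at_top by auto
    have L: "L \<ge> sum a F" if "finite F" "F \<subseteq> I" for F
      using finite_sum_le_has_sum[OF \<open>(a has_sum L) I\<close> that] a(2) by auto
    have near: "dist (sum x F) (sum x F0) < e/2" if F: "finite F" "F0 \<subseteq> F" "F \<subseteq> I" for F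
    proof -
      have "(norm (sum x (F - F0)))\<^sup>2 \<le> sum a (F - F0)"
        using F by (intro le) auto
      also have "\<dots> = sum a F - sum a F0"
        using F by (simp add: sum_diff)
      also have "\<dots> < (e/2)\<^sup>2"
        using F0(3)[of F0] F0(1,2) L[OF F(1,3)] by (auto simp: dist_real_def)
      finally have "norm (sum x (F - F0)) < e/2"
        by (rule power_less_imp_less_base) (use e in simp)
      then show ?thesis
        using F by (simp add: dist_norm sum_diff)
    qed
    show "\<exists>P. eventually P (finite_subsets_at_top I) \<and>
        (\<forall>F G. P F \<and> P G \<longrightarrow> dist (sum x F) (sum x G) < e)"
    proof (intro exI conjI allI impI)
      show "\<forall>\<^sub>F F in finite_subsets_at_top I. finite F \<and> F0 \<subseteq> F \<and> F \<subseteq> I"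
        unfolding eventually_finite_subsets_at_top using F0 by blast
      fix F G assume "(finite F \<and> F0 \<subseteq> F \<and> F \<subseteq> I) \<and> (finite G \<and> F0 \<subseteq> G \<and> G \<subseteq> I)"
      then show "dist (sum x F) (sum x G) < e"
        using near[of F] near[of G] dist_triangle_half_l by blast
    qed
  qed
  moreover have "complete (UNIV::'a set)"
    by (meson Cauchy_convergent UNIV_I complete_def convergent_def)
  ultimately obtain L where "(sum x \<longlongrightarrow> L) (finite_subsets_at_top I)"
    using complete_uniform[where S=UNIV] by (force simp add: filterlim_def)
  then show ?thesis
    using summable_on_def has_sum_def by blast
qed

locale orthonormal =
  fixes \<xi> :: "'i \<Rightarrow> 'h::chilbert_space" and I :: "'i set"
  assumes onb: "orthonormal_basis \<xi> I"
begin

lemma cinner_basis: "v \<in> I \<Longrightarrow> w \<in> I \<Longrightarrow> cinner (\<xi> v) (\<xi> w) = (if v = w then 1 else 0)"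
  using onb by (simp add: orthonormal_basis_def)

text \<open>The span of the basis is dense, so linear and closed properties need only be checked on the basis.\<close>

lemma basis_induct [consumes 0, case_names zero basis add scale limit]:
  assumes zero: "P 0"
    and basis: "\<And>w. w \<in> I \<Longrightarrow> P (\<xi> w)"
    and add: "\<And>x y. P x \<Longrightarrow> P y \<Longrightarrow> P (x + y)"
    and scale: "\<And>c x. P x \<Longrightarrow> P (c *\<^sub>C x)"
    and limit: "closed {x. P x}"
  shows "P h"
proof -
  have "P x" if "x \<in> cspan (\<xi> ` I)" for x
    using that
  proof (induction rule: complex_vector.span_induct_alt)
    case base
    show ?case by (rule zero)
  next
    case (step c x y)
    then show ?case
      using add scale basis by blast
  qed
  then have "closure (cspan (\<xi> ` I)) \<subseteq> {x. P x}"
    by (intro closure_minimal limit) auto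
  then show ?thesis
    using onb by (auto simp: orthonormal_basis_def)
qed

lemma vector_eqI:
  assumes "\<And>w. w \<in> I \<Longrightarrow> cinner h (\<xi> w) = cinner k (\<xi> w)"
  shows "h = k"
proof -
  have "cinner (h - k) x = 0" for x
  proof (induction x rule: basis_induct)
    case limit
    show ?case
      by (intro closed_Collect_eq continuous_intros
          linear_continuous_on[OF bounded_linear_cinner_right])
  qed (auto simp: cinner_simps assms)
  from this[of "h - k"] show ?thesis
    by (simp add: cinner_self)
qed

lemma operator_eqI:
  assumes "S \<in> bounded_operators" "T \<in> bounded_operators"
    and "\<And>w. w \<in> I \<Longrightarrow> blinfun_apply S (\<xi> w) = blinfun_apply T (\<xi> w)"
  shows "S = T"
proof (rule blinfun_eqI)
  fix x
  show "S x = T x"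
  proof (induction x rule: basis_induct)
    case limit
    show ?case
      by (intro closed_Collect_eq continuous_intros)
  qed (simp_all add: assms blinfun.add_right bounded_operators_scaleC)
qed

lemma orthogonal_operatorsI:
  assumes "S \<in> bounded_operators" "T \<in> bounded_operators"
    and "\<And>v w. v \<in> I \<Longrightarrow> w \<in> I \<Longrightarrow> cinner (blinfun_apply S (\<xi> v)) (blinfun_apply T (\<xi> w)) = 0"
  shows "cinner (blinfun_apply S x) (blinfun_apply T y) = 0"
proof (induction y rule: basis_induct)
  case (basis w)
  show ?case
  proof (induction x rule: basis_induct)
    case limit
    show ?case
      by (intro closed_Collect_eq continuous_intros
          bounded_linear.continuous_on[OF bounded_linear_cinner_left])
  qed (simp_all add: assms basis blinfun.add_right bounded_operators_scaleC cinner_simps)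
next
  case limit
  show ?case
    by (intro closed_Collect_eq continuous_intros
        bounded_linear.continuous_on[OF bounded_linear_cinner_right])
qed (simp_all add: assms blinfun.add_right bounded_operators_scaleC cinner_simps)

lemma norm_basis: "w \<in> I \<Longrightarrow> norm (\<xi> w) = 1"
proof -
  assume w: "w \<in> I"
  have "complex_of_real ((norm (\<xi> w))\<^sup>2) = complex_of_real 1"
    using cinner_basis[OF w w] by (simp only: cinner_self) simp
  then show ?thesis
    by (simp only: of_real_eq_iff power2_eq_1_iff) (use norm_ge_zero[of "\<xi> w"] in linarith)
qed

lemma norm_basis_sum:
  assumes "finite F" "F \<subseteq> I"
  shows "(norm (\<Sum>w\<in>F. c w *\<^sub>C \<xi> w))\<^sup>2 = (\<Sum>w\<in>F. (cmod (c w))\<^sup>2)"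
proof -
  have "(norm (\<Sum>w\<in>F. c w *\<^sub>C \<xi> w))\<^sup>2 = (\<Sum>w\<in>F. (norm (c w *\<^sub>C \<xi> w))\<^sup>2)"
    using assms cinner_basis
    by (intro norm_sum_Pythagorean)
       (auto simp: pairwise_def orthogonal_def subset_iff cinner_simps simp flip: Re_cinner)
  also have "\<dots> = (\<Sum>w\<in>F. (cmod (c w))\<^sup>2)"
    using assms by (intro sum.cong) (auto simp: norm_scaleC norm_basis)
  finally show ?thesis .
qed

lemma bessel:
  assumes "finite F" "F \<subseteq> I"
  shows "(\<Sum>w\<in>F. (cmod (cinner h (\<xi> w)))\<^sup>2) \<le> (norm h)\<^sup>2"
proof -
  define p where "p = (\<Sum>w\<in>F. cinner h (\<xi> w) *\<^sub>C \<xi> w)"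
  define q where "q = (\<Sum>w\<in>F. (cmod (cinner h (\<xi> w)))\<^sup>2)"
  have pp: "(norm p)\<^sup>2 = q"
    unfolding p_def q_def by (rule norm_basis_sum[OF assms])
  have "cinner h p = complex_of_real q"
    unfolding p_def q_def of_real_sum complex_norm_square
    by (simp add: cinner_sum_right cinner_simps mult.commute)
  then have "Re (cinner h (- p)) = - q"
    by (simp add: cinner_minus_right)
  moreover have "0 \<le> (norm (h + - p))\<^sup>2"
    by simp
  ultimately show ?thesis
    unfolding norm_add_square using pp by (simp add: q_def)
qed

lemma coefficients_square_summable: "(\<lambda>w. (cmod (cinner h (\<xi> w)))\<^sup>2) summable_on I"
  by (rule nonneg_bdd_above_summable_on) (auto intro!: bdd_aboveI2 bessel)

text \<open>A family of vectors extends to a bounded operator as soon as its finite linear combinations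
  obey an \<open>\<ell>\<^sup>2\<close> bound: the series \<open>\<Sum>w. \<langle>h, \<xi> w\<rangle> \<eta> w\<close> then converges by Bessel's inequality.\<close>

lemma operator_exists:
  fixes \<eta> :: "'i \<Rightarrow> 'h"
  assumes K: "K \<ge> 0"
    and le: "\<And>F c. finite F \<Longrightarrow> F \<subseteq> I \<Longrightarrow>
      (norm (\<Sum>w\<in>F. c w *\<^sub>C \<eta> w))\<^sup>2 \<le> K\<^sup>2 * (\<Sum>w\<in>F. (cmod (c w))\<^sup>2)"
  obtains T where "T \<in> bounded_operators" "norm T \<le> K"
    "\<And>w. w \<in> I \<Longrightarrow> blinfun_apply T (\<xi> w) = \<eta> w"
proof -
  define f where "f = (\<lambda>h w. cinner h (\<xi> w) *\<^sub>C \<eta> w)"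
  define t where "t = (\<lambda>h. infsum (f h) I)"
  have summable: "f h summable_on I" for h
    unfolding f_def
    by (rule summable_on_if_square_bounded
        [where a = "\<lambda>w. K\<^sup>2 * (cmod (cinner h (\<xi> w)))\<^sup>2"])
       (auto intro!: summable_on_cmult_right coefficients_square_summable le
          simp flip: sum_distrib_left)
  have add: "t (x + y) = t x + t y" for x y
  proof -
    have "t x + t y = infsum (\<lambda>w. f x w + f y w) I"
      unfolding t_def by (rule infsum_add[symmetric]) (rule summable)+
    also have "\<dots> = t (x + y)"
      by (simp add: t_def f_def cinner_add_left scaleC_add_left)
    finally show ?thesis by simp
  qed
  have scale: "t (c *\<^sub>C x) = c *\<^sub>C t x" for c x
  proof -
    have "infsum (\<lambda>w. c *\<^sub>C f x w) I = c *\<^sub>C t x"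
      unfolding t_def
      by (rule infsumI[OF has_sum_bounded_linear[OF bounded_linear_scaleC has_sum_infsum[OF summable]]])
    then show ?thesis
      by (simp add: t_def f_def cinner_scaleC_left scaleC_scaleC)
  qed
  have bound: "norm (t h) \<le> K * norm h" for h
  proof -
    have lim: "(sum (f h) \<longlongrightarrow> t h) (finite_subsets_at_top I)"
      using summable[of h] unfolding t_def by (rule infsum_tendsto)
    have "\<forall>\<^sub>F F in finite_subsets_at_top I. norm (sum (f h) F) \<le> K * norm h"
    proof (rule eventually_finite_subsets_at_top_weakI)
      fix F assume F: "finite F" "F \<subseteq> I"
      have "(norm (sum (f h) F))\<^sup>2 \<le> K\<^sup>2 * (\<Sum>w\<in>F. (cmod (cinner h (\<xi> w)))\<^sup>2)"
        unfolding f_def by (rule le[OF F])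
      also have "\<dots> \<le> (K * norm h)\<^sup>2"
        using bessel[OF F, of h] by (simp add: power_mult_distrib mult_left_mono)
      finally show "norm (sum (f h) F) \<le> K * norm h"
        by (rule power2_le_imp_le) (simp add: K)
    qed
    then show ?thesis
      by (rule tendsto_upperbound[OF tendsto_norm[OF lim]]) simp
  qed
  have scaleR: "t (r *\<^sub>R x) = r *\<^sub>R t x" for r x
    by (simp add: scale flip: scaleC_of_real)
  have bl: "bounded_linear t"
    by (rule bounded_linear_intro[where K = K]) (simp_all add: add scaleR bound mult.commute)
  have app: "blinfun_apply (Blinfun t) = t"
    by (rule bounded_linear_Blinfun_apply[OF bl])
  show ?thesis
  proof
    show "Blinfun t \<in> bounded_operators"
      by (simp add: bounded_operators_iff app scale)
    show "norm (Blinfun t) \<le> K"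
      by (rule norm_blinfun_bound[OF K]) (simp add: app bound)
    fix w assume w: "w \<in> I"
    have "t (\<xi> w) = infsum (f (\<xi> w)) {w}"
      unfolding t_def by (rule infsum_cong_neutral) (use w in \<open>auto simp: f_def cinner_basis\<close>)
    also have "\<dots> = \<eta> w"
      using w by (simp add: f_def cinner_basis)
    finally show "Blinfun t (\<xi> w) = \<eta> w"
      by (simp add: app)
  qed
qed

lemma orthogonal_operator_exists:
  fixes \<eta> :: "'i \<Rightarrow> 'h"
  assumes K: "K \<ge> 0"
    and orth: "\<And>v w. v \<in> I \<Longrightarrow> w \<in> I \<Longrightarrow> v \<noteq> w \<Longrightarrow> cinner (\<eta> v) (\<eta> w) = 0"
    and norm: "\<And>w. w \<in> I \<Longrightarrow> norm (\<eta> w) \<le> K"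
  obtains T where "T \<in> bounded_operators" "norm T \<le> K"
    "\<And>w. w \<in> I \<Longrightarrow> blinfun_apply T (\<xi> w) = \<eta> w"
proof -
  have le: "(norm (\<Sum>w\<in>F. c w *\<^sub>C \<eta> w))\<^sup>2 \<le> K\<^sup>2 * (\<Sum>w\<in>F. (cmod (c w))\<^sup>2)"
    if F: "finite F" "F \<subseteq> I" for F and c :: "'i \<Rightarrow> complex"
  proof -
  have "(norm (\<Sum>w\<in>F. c w *\<^sub>C \<eta> w))\<^sup>2 = (\<Sum>w\<in>F. (norm (c w *\<^sub>C \<eta> w))\<^sup>2)"
    using F orth
    by (intro norm_sum_Pythagorean)
       (auto simp: pairwise_def orthogonal_def subset_iff cinner_simps simp flip: Re_cinner)
  also have "\<dots> \<le> (\<Sum>w\<in>F. (cmod (c w))\<^sup>2 * K\<^sup>2)"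
    unfolding norm_scaleC power_mult_distrib
    using F norm by (intro sum_mono mult_left_mono power_mono) auto
  finally show ?thesis
    by (simp add: sum_distrib_left mult.commute)
  qed
  obtain T where "T \<in> bounded_operators" "norm T \<le> K"
      "\<And>w. w \<in> I \<Longrightarrow> blinfun_apply T (\<xi> w) = \<eta> w"
    using operator_exists[OF K le] by blast
  then show ?thesis by (rule that)
qed

text \<open>The representing vector is \<open>\<Sum>w. cnj (f (\<xi> w)) \<xi> w\<close>; evaluating \<open>f\<close> at the finite partial sums
  shows that its coefficients are square summable.\<close>

lemma riesz:
  assumes add: "\<And>x y. f (x + y) = f x + f y" and scale: "\<And>c x. f (c *\<^sub>C x) = c * f x"
    and bound: "\<And>x::'h. cmod (f x) \<le> K * norm x" and K: "K \<ge> 0"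
  obtains v where "\<And>x. f x = cinner x v"
proof -
  define c where "c = (\<lambda>w. cnj (f (\<xi> w)))"
  have f_sum: "f (\<Sum>w\<in>F. d w *\<^sub>C \<xi> w) = (\<Sum>w\<in>F. d w * f (\<xi> w))" for F d
    using scale[of 0 0]
    by (induction F rule: infinite_finite_induct) (simp_all add: add scale)
  have le: "(\<Sum>w\<in>F. (cmod (c w))\<^sup>2) \<le> K\<^sup>2" if F: "finite F" "F \<subseteq> I" for F
  proof -
    define q where "q = (\<Sum>w\<in>F. (cmod (c w))\<^sup>2)"
    have q: "q \<ge> 0"
      by (simp add: q_def sum_nonneg)
    have "f (\<Sum>w\<in>F. c w *\<^sub>C \<xi> w) = complex_of_real q"
      unfolding q_def of_real_sum complex_norm_square by (simp add: f_sum c_def)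
    then have "q \<le> K * norm (\<Sum>w\<in>F. c w *\<^sub>C \<xi> w)"
      using bound[of "\<Sum>w\<in>F. c w *\<^sub>C \<xi> w"] q by simp
    also have "norm (\<Sum>w\<in>F. c w *\<^sub>C \<xi> w) = sqrt q"
      using norm_basis_sum[OF F, of c] by (simp add: q_def real_sqrt_unique)
    finally have qK: "sqrt q * sqrt q \<le> K * sqrt q"
      using q by simp
    have "sqrt q \<le> K"
    proof (cases "q = 0")
      case False
      then show ?thesis
        using mult_right_le_imp_le[OF qK] q by simp
    qed (simp add: K)
    then have "q \<le> K\<^sup>2"
      using q by (simp add: real_sqrt_le_iff' sqrt_le_D)
    then show ?thesis
      by (simp only: q_def)
  qed
  have summable: "(\<lambda>w. c w *\<^sub>C \<xi> w) summable_on I"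
    by (rule summable_on_if_square_bounded[where a = "\<lambda>w. (cmod (c w))\<^sup>2"])
       (auto intro!: nonneg_bdd_above_summable_on bdd_aboveI2 le simp: norm_basis_sum)
  define v where "v = infsum (\<lambda>w. c w *\<^sub>C \<xi> w) I"
  have basis: "cinner (\<xi> w) v = f (\<xi> w)" if w: "w \<in> I" for w
  proof -
    have "cinner (\<xi> w) v = infsum (\<lambda>u. cinner (\<xi> w) (c u *\<^sub>C \<xi> u)) I"
      unfolding v_def
      by (rule infsumI[symmetric,
            OF has_sum_bounded_linear[OF bounded_linear_cinner_right has_sum_infsum[OF summable]]])
    also have "\<dots> = infsum (\<lambda>u. cinner (\<xi> w) (c u *\<^sub>C \<xi> u)) {w}"
      by (rule infsum_cong_neutral) (use w in \<open>auto simp: cinner_basis cinner_simps\<close>)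
    also have "\<dots> = f (\<xi> w)"
      using w by (simp add: cinner_basis cinner_simps c_def)
    finally show ?thesis .
  qed
  have bl: "bounded_linear f"
    by (rule bounded_linear_intro[where K = K])
       (use bound in \<open>simp_all add: add scale mult.commute[of _ K] scaleR_conv_of_real flip: scaleC_of_real\<close>)
  show ?thesis
  proof
    fix x
    show "f x = cinner x v"
    proof (induction x rule: basis_induct)
      case limit
      show ?case
        by (intro closed_Collect_eq bounded_linear.continuous_on[OF bl]
            bounded_linear.continuous_on[OF bounded_linear_cinner_left] continuous_on_id)
    qed (use scale[of 0 0] in \<open>simp_all add: basis add scale cinner_simps\<close>)
  qed
qed

lemma adjoint_exists:
  fixes T :: "'h \<Rightarrow>\<^sub>L 'h"
  assumes T: "T \<in> bounded_operators"
  shows "\<exists>S\<in>bounded_operators. \<forall>x y. cinner (blinfun_apply T x) y = cinner x (blinfun_apply S y)"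
proof -
  have "\<exists>v. \<forall>x. cinner (T x) y = cinner x v" for y
  proof -
    have b: "cmod (cinner (T x) y) \<le> (norm T * norm y) * norm x" for x
    proof -
      have "cmod (cinner (T x) y) \<le> norm (T x) * norm y"
        by (rule cmod_cinner_le)
      also have "\<dots> \<le> (norm T * norm x) * norm y"
        by (intro mult_right_mono norm_blinfun norm_ge_zero)
      finally show ?thesis by (simp add: mult_ac)
    qed
    have add: "cinner (T (a + c)) y = cinner (T a) y + cinner (T c) y" for a c
      by (simp add: blinfun.add_right cinner_add_left)
    have scale: "cinner (T (c *\<^sub>C x)) y = c * cinner (T x) y" for c x
      by (simp add: bounded_operators_scaleC[OF T] cinner_scaleC_left)
    obtain v where "\<And>x. cinner (T x) y = cinner x v"
      using riesz[where f = "\<lambda>x. cinner (T x) y", OF add scale b] by auto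
    then show ?thesis by auto
  qed
  then obtain s where s: "\<And>x y. cinner (T x) y = cinner x (s y)"
    by metis
  have eqI: "a = b" if "\<And>x. cinner x a = cinner x b" for a b :: 'h
  proof -
    have "cinner (a - b) (a - b) = 0"
      using that[of "a - b"] by (simp add: cinner_diff_right)
    then show ?thesis
      by (simp add: cinner_self)
  qed
  have add: "s (x + y) = s x + s y" for x y
    by (rule eqI) (simp add: cinner_add_right flip: s)
  have scale: "s (c *\<^sub>C x) = c *\<^sub>C s x" for c x
    by (rule eqI) (simp add: cinner_scaleC_right flip: s)
  have bound: "norm (s x) \<le> norm x * norm T" for x
  proof (cases "s x = 0")
    case False
    have "norm (s x) * norm (s x) = cmod (cinner (T (s x)) x)"
      by (simp add: s cinner_self norm_mult power2_eq_square)
    also have "\<dots> \<le> norm (T (s x)) * norm x"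
      by (rule cmod_cinner_le)
    also have "\<dots> \<le> (norm T * norm (s x)) * norm x"
      by (intro mult_right_mono norm_blinfun norm_ge_zero)
    finally show ?thesis
      using False by (simp add: mult_ac)
  qed simp
  have "bounded_linear s"
    by (rule bounded_linear_intro[where K = "norm T"])
       (simp_all add: add scale bound flip: scaleC_of_real)
  then have app: "blinfun_apply (Blinfun s) = s"
    by (rule bounded_linear_Blinfun_apply)
  show ?thesis
    by (rule bexI[of _ "Blinfun s"]) (simp_all add: app s bounded_operators_iff scale)
qed

definition adjoint :: "('h \<Rightarrow>\<^sub>L 'h) \<Rightarrow> 'h \<Rightarrow>\<^sub>L 'h" where
  "adjoint T = (SOME S. S \<in> bounded_operators \<and>
     (\<forall>x y. cinner (blinfun_apply T x) y = cinner x (blinfun_apply S y)))"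

lemma
  assumes "T \<in> bounded_operators"
  shows adjoint_bounded: "adjoint T \<in> bounded_operators"
    and cinner_adjoint: "cinner (blinfun_apply T x) y = cinner x (blinfun_apply (adjoint T) y)"
proof -
  have "\<exists>S. S \<in> bounded_operators \<and> (\<forall>x y. cinner (T x) y = cinner x (blinfun_apply S y))"
    using adjoint_exists[OF assms] by blast
  then have "adjoint T \<in> bounded_operators \<and>
      (\<forall>x y. cinner (T x) y = cinner x (blinfun_apply (adjoint T) y))"
    unfolding adjoint_def by (rule someI_ex)
  then show "adjoint T \<in> bounded_operators"
    and "cinner (T x) y = cinner x (blinfun_apply (adjoint T) y)" by auto
qed

lemma cinner_adjoint':
  assumes "T \<in> bounded_operators"
  shows "cinner (blinfun_apply (adjoint T) x) y = cinner x (blinfun_apply T y)"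
  by (metis assms cinner_adjoint cinner_commute)

text \<open>Adjointness is visible in the matrix entries.\<close>

lemma adjoint_eqI:
  assumes "S \<in> bounded_operators" "T \<in> bounded_operators"
    and "\<And>v w. v \<in> I \<Longrightarrow> w \<in> I \<Longrightarrow>
      cinner (blinfun_apply S (\<xi> v)) (\<xi> w) = cinner (\<xi> v) (blinfun_apply T (\<xi> w))"
  shows "cinner (blinfun_apply S x) y = cinner x (blinfun_apply T y)"
proof -
  have "adjoint S = T"
  proof (rule operator_eqI)
    fix w assume w: "w \<in> I"
    show "adjoint S (\<xi> w) = T (\<xi> w)"
    proof (rule vector_eqI)
      fix v assume "v \<in> I"
      then show "cinner (adjoint S (\<xi> w)) (\<xi> v) = cinner (T (\<xi> w)) (\<xi> v)"
        by (metis assms(1,3) cinner_adjoint cinner_commute w)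
    qed
  qed (use assms adjoint_bounded in auto)
  then show ?thesis
    using cinner_adjoint[OF assms(1)] by simp
qed

subsection \<open>Operators permuting the basis\<close>

text \<open>\<open>None\<close> marks the basis vectors that are sent to \<open>0\<close>. The choice is unique by \<open>operator_eqI\<close>, and
  possible for the functions that satisfy \<open>partial_injection\<close> below.\<close>

definition basis_map :: "('i \<Rightarrow> 'i option) \<Rightarrow> 'h \<Rightarrow>\<^sub>L 'h" where
  "basis_map f = (SOME T. T \<in> bounded_operators \<and> norm T \<le> 1 \<and>
     (\<forall>w\<in>I. blinfun_apply T (\<xi> w) = (case f w of None \<Rightarrow> 0 | Some v \<Rightarrow> \<xi> v)))"

definition partial_injection :: "('i \<Rightarrow> 'i option) \<Rightarrow> bool" where
  "partial_injection f \<longleftrightarrow>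
     (\<forall>w\<in>I. \<forall>u. f w = Some u \<longrightarrow> u \<in> I) \<and>
     (\<forall>v\<in>I. \<forall>w\<in>I. \<forall>u. f v = Some u \<longrightarrow> f w = Some u \<longrightarrow> v = w)"

lemma partial_injection_in:
  assumes "partial_injection f" "w \<in> I" "f w = Some u"
  shows "u \<in> I"
  using assms unfolding partial_injection_def by blast

lemma partial_injection_eq:
  assumes "partial_injection f" "v \<in> I" "w \<in> I" "f v = Some u" "f w = Some u"
  shows "v = w"
  using assms unfolding partial_injection_def by blast

lemma
  assumes f: "partial_injection f"
  shows basis_map_bounded: "basis_map f \<in> bounded_operators"
    and norm_basis_map: "norm (basis_map f) \<le> 1"
    and basis_map_apply: "w \<in> I \<Longrightarrow>
      blinfun_apply (basis_map f) (\<xi> w) = (case f w of None \<Rightarrow> 0 | Some v \<Rightarrow> \<xi> v)"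
proof -
  define \<eta> where "\<eta> = (\<lambda>w. case f w of None \<Rightarrow> 0 | Some v \<Rightarrow> \<xi> v)"
  have orth: "cinner (\<eta> v) (\<eta> w) = 0" if vw: "v \<in> I" "w \<in> I" "v \<noteq> w" for v w
  proof (cases "f v = None \<or> f w = None")
    case False
    then obtain a b where ab: "f v = Some a" "f w = Some b" by auto
    have "a \<in> I" "b \<in> I"
      using partial_injection_in[OF f] vw ab by simp_all
    moreover have "a \<noteq> b"
      using partial_injection_eq[OF f vw(1,2) ab(1)] vw(3) ab(2) by metis
    ultimately show ?thesis
      using ab by (simp add: \<eta>_def cinner_basis)
  qed (auto simp: \<eta>_def)
  have norm: "norm (\<eta> w) \<le> 1" if "w \<in> I" for w
    using partial_injection_in[OF f that] by (simp add: \<eta>_def norm_basis split: option.split)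
  have "\<exists>T. T \<in> bounded_operators \<and> norm T \<le> 1 \<and> (\<forall>w\<in>I. blinfun_apply T (\<xi> w) = \<eta> w)"
  proof (rule orthogonal_operator_exists[of 1 \<eta>])
    fix T :: "'h \<Rightarrow>\<^sub>L 'h"
    assume "T \<in> bounded_operators" "norm T \<le> 1" "\<And>w. w \<in> I \<Longrightarrow> blinfun_apply T (\<xi> w) = \<eta> w"
    then show ?thesis by blast
  qed (simp_all add: orth norm)
  then have "basis_map f \<in> bounded_operators \<and> norm (basis_map f) \<le> 1 \<and>
     (\<forall>w\<in>I. blinfun_apply (basis_map f) (\<xi> w) = \<eta> w)"
    unfolding basis_map_def \<eta>_def by (rule someI_ex)
  note * = conjunct1[OF this] conjunct2[OF this]
  show "basis_map f \<in> bounded_operators" "norm (basis_map f) \<le> 1"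
    using * by simp_all
  show "w \<in> I \<Longrightarrow> basis_map f (\<xi> w) = (case f w of None \<Rightarrow> 0 | Some v \<Rightarrow> \<xi> v)"
    using * by (simp add: \<eta>_def)
qed

lemma basis_map_isometry:
  assumes f: "partial_injection f" and total: "\<And>w. w \<in> I \<Longrightarrow> f w \<noteq> None"
  shows "is_isometry (basis_map f)"
proof -
  let ?T = "basis_map f"
  have T: "?T \<in> bounded_operators"
    by (rule basis_map_bounded[OF f])
  have "adjoint ?T o\<^sub>L ?T = id_blinfun"
  proof (rule operator_eqI)
    fix w assume w: "w \<in> I"
    show "(adjoint ?T o\<^sub>L ?T) (\<xi> w) = id_blinfun (\<xi> w)"
    proof (rule vector_eqI)
      fix v assume v: "v \<in> I"
      obtain a b where ab: "f v = Some a" "f w = Some b"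
        using total[OF v] total[OF w] by auto
      have "a \<in> I" "b \<in> I" "a = b \<longleftrightarrow> v = w"
        using partial_injection_in[OF f] partial_injection_eq[OF f v w] v w ab by auto
      then show "cinner ((adjoint ?T o\<^sub>L ?T) (\<xi> w)) (\<xi> v) = cinner (id_blinfun (\<xi> w)) (\<xi> v)"
        using ab v w by (auto simp: cinner_adjoint'[OF T] basis_map_apply[OF f] cinner_basis)
    qed
  qed (simp_all add: T adjoint_bounded bounded_operators_compose)
  then have "adjoint ?T (?T h) = h" for h
    by (metis blinfun_apply_blinfun_compose id_blinfun.rep_eq id_apply)
  then have "complex_of_real ((norm (?T h))\<^sup>2) = complex_of_real ((norm h)\<^sup>2)" for h
    by (simp only: cinner_self[symmetric] cinner_adjoint[OF T])
  then have "norm (?T h) = norm h" for h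
    by (simp only: of_real_eq_iff) simp
  then show ?thesis
    using T by (simp add: is_isometry_def)
qed

text \<open>Projection onto the closed span of a set of basis vectors.\<close>

definition coord_proj :: "'i set \<Rightarrow> 'h \<Rightarrow>\<^sub>L 'h" where
  "coord_proj J = basis_map (\<lambda>w. if w \<in> J then Some w else None)"

lemma coord_proj_injection: "partial_injection (\<lambda>w. if w \<in> J then Some w else None)"
  by (auto simp: partial_injection_def)

lemma coord_proj_bounded [simp]: "coord_proj J \<in> bounded_operators"
  unfolding coord_proj_def by (rule basis_map_bounded[OF coord_proj_injection])

lemma norm_coord_proj: "norm (coord_proj J) \<le> 1"
  unfolding coord_proj_def by (rule norm_basis_map[OF coord_proj_injection])

lemma coord_proj_basis: "w \<in> I \<Longrightarrow> blinfun_apply (coord_proj J) (\<xi> w) = (if w \<in> J then \<xi> w else 0)"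
  unfolding coord_proj_def by (simp add: basis_map_apply[OF coord_proj_injection])

lemma coord_proj_self_adjoint: "cinner (blinfun_apply (coord_proj J) x) y = cinner x (blinfun_apply (coord_proj J) y)"
  by (rule adjoint_eqI) (auto simp: coord_proj_basis cinner_basis)

lemma cinner_coord_proj: "w \<in> I \<Longrightarrow>
    cinner (blinfun_apply (coord_proj J) h) (\<xi> w) = (if w \<in> J then cinner h (\<xi> w) else 0)"
  by (simp add: coord_proj_self_adjoint coord_proj_basis)

lemma coord_proj_id:
  assumes "\<And>w. w \<in> I \<Longrightarrow> w \<notin> J \<Longrightarrow> cinner h (\<xi> w) = 0"
  shows "blinfun_apply (coord_proj J) h = h"
  by (rule vector_eqI) (simp add: cinner_coord_proj assms)

lemma coord_proj_compose: "blinfun_apply (coord_proj J) (blinfun_apply (coord_proj K) h) = blinfun_apply (coord_proj (J \<inter> K)) h"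
  by (rule vector_eqI) (simp add: cinner_coord_proj)

text \<open>A vector is fixed by the projection onto the basis vectors at which its coefficients do not vanish.\<close>

lemma operator_vanishes:
  assumes Z: "Z \<in> bounded_operators"
    and "\<And>w. w \<in> I \<Longrightarrow> cinner k (\<xi> w) \<noteq> 0 \<Longrightarrow> blinfun_apply Z (\<xi> w) = 0"
  shows "blinfun_apply Z k = 0"
proof -
  let ?P = "coord_proj {w. cinner k (\<xi> w) \<noteq> 0}"
  have "Z o\<^sub>L ?P = 0"
    by (rule operator_eqI) (auto simp: bounded_operators_compose Z coord_proj_basis assms)
  moreover have "?P k = k"
    by (rule coord_proj_id) simp
  ultimately show ?thesis
    by (metis blinfun_apply_blinfun_compose blinfun.zero_left)
qed

text \<open>This identifies the projections in the definition of the free semigroupoid algebra.\<close>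

lemma coord_proj_is_projection:
  assumes "J \<subseteq> I"
  shows "is_orthogonal_projection T (closure (cspan (\<xi> ` J))) \<longleftrightarrow> T = coord_proj J"
proof -
  let ?M = "closure (cspan (\<xi> ` J))"
  have in_span: "coord_proj J h \<in> ?M" for h
  proof (induction h rule: basis_induct)
    case zero
    then show ?case
      using closure_subset complex_vector.span_zero by fastforce
  next
    case (basis w)
    then show ?case
      using closure_subset complex_vector.span_zero complex_vector.span_base[of "\<xi> w" "\<xi> ` J"]
      by (auto simp: coord_proj_basis subset_iff)
  next
    case (add x y)
    obtain f g where "\<And>n. f n \<in> cspan (\<xi> ` J)" "f \<longlonglongrightarrow> coord_proj J x"
        "\<And>n. g n \<in> cspan (\<xi> ` J)" "g \<longlonglongrightarrow> coord_proj J y"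
      using add by (auto simp: closure_sequential)
    then have "(\<forall>n. f n + g n \<in> cspan (\<xi> ` J)) \<and> (\<lambda>n. f n + g n) \<longlonglongrightarrow> coord_proj J (x + y)"
      by (auto simp: blinfun.add_right complex_vector.span_add intro: tendsto_add)
    then show ?case
      unfolding closure_sequential by (intro exI[of _ "\<lambda>n. f n + g n"])
  next
    case (scale c x)
    obtain f where "\<And>n. f n \<in> cspan (\<xi> ` J)" "f \<longlonglongrightarrow> coord_proj J x"
      using scale by (auto simp: closure_sequential)
    then have "(\<forall>n. c *\<^sub>C f n \<in> cspan (\<xi> ` J)) \<and> (\<lambda>n. c *\<^sub>C f n) \<longlonglongrightarrow> coord_proj J (c *\<^sub>C x)"
      by (auto simp: bounded_operators_scaleC complex_vector.span_scale
          intro: bounded_linear.tendsto[OF bounded_linear_scaleC])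
    then show ?case
      unfolding closure_sequential by (intro exI[of _ "\<lambda>n. c *\<^sub>C f n"])
  next
    case limit
    have "closed (blinfun_apply (coord_proj J) -` ?M)"
      by (intro closed_vimage closed_closure continuous_intros)
    then show ?case
      by (simp add: vimage_def)
  qed
  have fixed: "coord_proj J m = m" if "m \<in> ?M" for m
  proof -
    have "?M \<subseteq> {m. coord_proj J m = m}"
    proof (intro closure_minimal subsetI CollectI)
      fix m assume "m \<in> cspan (\<xi> ` J)"
      then show "coord_proj J m = m"
      proof (induction rule: complex_vector.span_induct_alt)
        case (step c x y)
        then show ?case
          using assms by (auto simp: blinfun.add_right bounded_operators_scaleC coord_proj_basis subset_iff)
      qed simp
    next
      show "closed {m. coord_proj J m = m}"
        by (intro closed_Collect_eq continuous_intros)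
    qed
    then show ?thesis using that by auto
  qed
  have orth: "cinner (h - coord_proj J h) m = 0" if "m \<in> ?M" for h m
    using fixed[OF that] coord_proj_self_adjoint[of J h m] by (simp add: cinner_diff_left)
  show ?thesis
  proof
    assume "T = coord_proj J"
    then show "is_orthogonal_projection T ?M"
      using in_span orth by (simp add: is_orthogonal_projection_def)
  next
    assume T: "is_orthogonal_projection T ?M"
    show "T = coord_proj J"
    proof (rule blinfun_eqI)
      fix h
      have TM: "T h \<in> ?M" and oT: "\<And>m. m \<in> ?M \<Longrightarrow> cinner (h - T h) m = 0"
        using T by (auto simp: is_orthogonal_projection_def)
      have z: "cinner (coord_proj J h - T h) m = 0" if "m \<in> ?M" for m
        using oT[OF that] orth[OF that, of h] by (simp add: cinner_diff_left)
      have "cinner (coord_proj J h - T h) (coord_proj J h - T h) = 0"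
        using z[OF TM] z[OF in_span[of h]] by (simp add: cinner_diff_right)
      then show "T h = coord_proj J h"
        by (simp add: cinner_self)
    qed
  qed
qed

end

section \<open>The weak operator topology\<close>

lemma topspace_wot: "topspace weak_operator_topology = bounded_operators"
  unfolding weak_operator_topology_def by (simp add: topspace_pullback_topology)

text \<open>The topology is pulled back from a product topology along the matrix coefficients, so convergence of
  all matrix coefficients is convergence in it.\<close>

lemma wot_closed_limit:
  fixes T0 :: "'h::chilbert_space \<Rightarrow>\<^sub>L 'h"
  assumes S: "closedin weak_operator_topology S" and F: "F \<noteq> bot"
    and ev: "\<forall>\<^sub>F i in F. T i \<in> S" and T0: "T0 \<in> bounded_operators"
    and lim: "\<And>x y. ((\<lambda>i. cinner (blinfun_apply (T i) x) y) \<longlongrightarrow> cinner (blinfun_apply T0 x) y) F"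
  shows "T0 \<in> S"
proof (rule ccontr)
  assume "T0 \<notin> S"
  define \<phi> where "\<phi> = (\<lambda>(T::'h \<Rightarrow>\<^sub>L 'h) (x, y). cinner (T x) y)"
  have "openin weak_operator_topology (bounded_operators - S)"
    using S by (simp add: closedin_def topspace_wot)
  then obtain U where U: "open U" "bounded_operators - S = \<phi> -` U \<inter> bounded_operators"
    unfolding weak_operator_topology_def openin_pullback_topology \<phi>_def
    by (metis (no_types, lifting) open_openin)
  have "\<phi> T0 \<in> U"
    using U(2) \<open>T0 \<notin> S\<close> T0 by blast
  moreover have "((\<lambda>i. \<phi> (T i)) \<longlongrightarrow> \<phi> T0) F"
  proof -
    have "limitin (product_topology (\<lambda>_. euclidean) UNIV) (\<lambda>i. \<phi> (T i)) (\<phi> T0) F"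
      unfolding limitin_componentwise using lim by (auto simp: \<phi>_def)
    then show ?thesis
      by (simp add: euclidean_product_topology)
  qed
  ultimately have "\<forall>\<^sub>F i in F. \<phi> (T i) \<in> U"
    using U(1) topological_tendstoD by blast
  with ev have "\<forall>\<^sub>F i in F. False"
  proof eventually_elim
    case (elim i)
    have "S \<subseteq> bounded_operators"
      using closedin_subset[OF S] by (simp add: topspace_wot)
    then show False
      using elim U(2) by blast
  qed
  then show False
    using F by (simp add: eventually_False)
qed

text \<open>The form in which commutation relations are seen to be closed conditions.\<close>

lemma wot_closed_equalities:
  "closedin weak_operator_topology
     {T \<in> bounded_operators. \<forall>(x, y, x', y')\<in>D. cinner (blinfun_apply T x) y = cinner (blinfun_apply T x') (y'::'h::chilbert_space)}"
  (is "closedin _ ?S")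
proof -
  define \<phi> where "\<phi> = (\<lambda>(T::'h \<Rightarrow>\<^sub>L 'h) (x, y). cinner (T x) y)"
  define U :: "('h \<times> 'h \<Rightarrow> complex) set" where
    "U = (\<Union>(x, y, x', y')\<in>D. {f. f (x, y) \<noteq> f (x', y')})"
  have "open U"
    unfolding U_def by (auto intro!: open_UN open_Collect_neq)
  moreover have "bounded_operators - ?S = \<phi> -` U \<inter> bounded_operators"
    by (auto simp: U_def \<phi>_def)
  ultimately have "openin weak_operator_topology (bounded_operators - ?S)"
    unfolding weak_operator_topology_def openin_pullback_topology \<phi>_def by auto
  then show ?thesis
    by (auto simp: closedin_def topspace_wot)
qed

lemma wot_closed_norm_limit:
  fixes T0 :: "'h::chilbert_space \<Rightarrow>\<^sub>L 'h"
  assumes S: "closedin weak_operator_topology S" and F: "F \<noteq> bot"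
    and ev: "\<forall>\<^sub>F i in F. T i \<in> S" and lim: "(T \<longlongrightarrow> T0) F"
  shows "T0 \<in> S"
proof (rule wot_closed_limit[OF S F ev])
  have "S \<subseteq> bounded_operators"
    using closedin_subset[OF S] by (simp add: topspace_wot)
  then have "\<forall>\<^sub>F i in F. T i \<in> bounded_operators"
    using ev by (auto elim: eventually_mono)
  then show "T0 \<in> bounded_operators"
    by (rule bounded_operators_closed_limit[OF F _ lim])
  show "((\<lambda>i. cinner (T i x) y) \<longlongrightarrow> cinner (T0 x) y) F" for x y
    by (intro tendsto_intros lim)
qed

context orthonormal begin

text \<open>The bound makes the set of vectors on which convergence holds closed. Homogeneity is required only for
  the modulus, so that the lemma covers both arguments of the inner product.\<close>

lemma functionals_tendsto_zero:
  fixes \<phi> :: "'j \<Rightarrow> 'h \<Rightarrow> complex"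
  assumes add: "\<And>i x y. \<phi> i (x + y) = \<phi> i x + \<phi> i y"
    and scale: "\<And>i c x. cmod (\<phi> i (c *\<^sub>C x)) = cmod c * cmod (\<phi> i x)"
    and bound: "\<And>i x. cmod (\<phi> i x) \<le> M * norm x"
    and basis: "\<And>w. w \<in> I \<Longrightarrow> ((\<lambda>i. \<phi> i (\<xi> w)) \<longlongrightarrow> 0) F"
  shows "((\<lambda>i. \<phi> i x) \<longlongrightarrow> 0) F"
proof (induction x rule: basis_induct)
  case zero
  have "\<phi> i 0 = 0" for i
    using add[of i 0 0] by simp
  then show ?case by simp
next
  case (scale c x)
  then have "((\<lambda>i. cmod c * cmod (\<phi> i x)) \<longlongrightarrow> cmod c * 0) F"
    by (intro tendsto_mult tendsto_const tendsto_norm_zero)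
  then have "((\<lambda>i. norm (\<phi> i (c *\<^sub>C x))) \<longlongrightarrow> 0) F"
    by (simp only: assms(2) mult_zero_right)
  then show ?case
    by (rule tendsto_norm_zero_cancel)
next
  case (add x y)
  then have "((\<lambda>i. \<phi> i x + \<phi> i y) \<longlongrightarrow> 0 + 0) F"
    by (rule tendsto_add)
  then show ?case
    by (simp only: assms(1) add_0)
next
  case limit
  show ?case
    unfolding closed_sequential_limits
  proof (intro allI impI, elim conjE)
    fix X x
    assume X: "\<forall>n. X n \<in> {x. ((\<lambda>i. \<phi> i x) \<longlongrightarrow> 0) F}" and lim: "X \<longlonglongrightarrow> x"
    have "((\<lambda>i. \<phi> i x) \<longlongrightarrow> 0) F"
    proof (rule tendstoI)
      fix e :: real assume e: "e > 0"
      have "(\<lambda>n. M * norm (x - X n)) \<longlonglongrightarrow> M * norm (x - x)"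
        by (intro tendsto_intros lim)
      then have "\<forall>\<^sub>F n in sequentially. M * norm (x - X n) < e/2"
        using e by (intro order_tendstoD) auto
      then obtain n where n: "M * norm (x - X n) < e/2"
        using eventually_happens by fastforce
      have "\<forall>\<^sub>F i in F. dist (\<phi> i (X n)) 0 < e/2"
        using X e by (intro tendstoD) auto
      then show "\<forall>\<^sub>F i in F. dist (\<phi> i x) 0 < e"
      proof eventually_elim
        case (elim i)
        have "\<phi> i x = \<phi> i (X n) + \<phi> i (x - X n)"
          using assms(1)[of i "X n" "x - X n"] by simp
        then have "cmod (\<phi> i x) \<le> cmod (\<phi> i (X n)) + M * norm (x - X n)"
          using norm_triangle_ineq[of "\<phi> i (X n)" "\<phi> i (x - X n)"] bound[of i "x - X n"] by simp
        then show ?case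
          using elim n by simp
      qed
    qed
    then show "x \<in> {x. ((\<lambda>i. \<phi> i x) \<longlongrightarrow> 0) F}" by simp
  qed
qed (rule basis)

text \<open>On bounded sets the weak operator topology is determined by matrix entries.\<close>

lemma wot_limit_of_entries:
  assumes T: "\<And>i. T i \<in> bounded_operators" and bound: "\<And>i. norm (T i) \<le> M"
    and T0: "T0 \<in> bounded_operators"
    and entries: "\<And>v w. v \<in> I \<Longrightarrow> w \<in> I \<Longrightarrow>
      ((\<lambda>i. cinner (blinfun_apply (T i) (\<xi> v)) (\<xi> w)) \<longlongrightarrow> cinner (blinfun_apply T0 (\<xi> v)) (\<xi> w)) F"
  shows "((\<lambda>i. cinner (blinfun_apply (T i) x) y) \<longlongrightarrow> cinner (blinfun_apply T0 x) y) F"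
proof -
  define D where "D = (\<lambda>i. T i - T0)"
  define N where "N = M + norm T0"
  have D: "D i \<in> bounded_operators" for i
    by (simp add: D_def T T0 bounded_operators_diff)
  have ND: "norm (D i) \<le> N" for i
    using norm_triangle_ineq4[of "T i" T0] bound[of i] by (simp add: D_def N_def)
  have le: "cmod (cinner (D i x) y) \<le> N * norm x * norm y" for i x y
  proof -
    have "cmod (cinner (D i x) y) \<le> norm (D i x) * norm y"
      by (rule cmod_cinner_le)
    also have "\<dots> \<le> (norm (D i) * norm x) * norm y"
      by (intro mult_right_mono norm_blinfun norm_ge_zero)
    also have "\<dots> \<le> N * norm x * norm y"
      by (intro mult_right_mono ND norm_ge_zero)
    finally show ?thesis .
  qed
  have 1: "((\<lambda>i. cinner (D i (\<xi> v)) y) \<longlongrightarrow> 0) F" if v: "v \<in> I" for v y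
  proof (rule functionals_tendsto_zero[where M = "N * norm (\<xi> v)" and \<phi> = "\<lambda>i y. cinner (D i (\<xi> v)) y"])
    fix w assume w: "w \<in> I"
    show "((\<lambda>i. cinner (D i (\<xi> v)) (\<xi> w)) \<longlongrightarrow> 0) F"
      using LIM_zero[OF entries[OF v w]] by (simp add: D_def blinfun.diff_left cinner_diff_left)
  qed (simp_all add: cinner_simps norm_mult le)
  have "((\<lambda>i. cinner (D i x) y) \<longlongrightarrow> 0) F"
  proof (rule functionals_tendsto_zero[where M = "N * norm y" and \<phi> = "\<lambda>i x. cinner (D i x) y"])
    show "((\<lambda>i. cinner (D i (\<xi> w)) y) \<longlongrightarrow> 0) F" if "w \<in> I" for w
      by (rule 1[OF that])
    show "cmod (cinner (D i x) y) \<le> N * norm y * norm x" for i x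
      using le[of i x y] by (simp add: mult_ac)
  qed (simp_all add: blinfun.add_right cinner_simps bounded_operators_scaleC[OF D] norm_mult)
  then have "((\<lambda>i. cinner (T i x) y - cinner (T0 x) y) \<longlongrightarrow> 0) F"
    by (simp add: D_def blinfun.diff_left cinner_diff_left)
  then show ?thesis
    by (rule LIM_zero_cancel)
qed

end

section \<open>The Fock space of a graph\<close>

locale fock = wf_digraph G + orthonormal \<xi> "free_semigroupoid G"
  for G :: "('v, 'e) pre_digraph" and \<xi> :: "('v, 'e) path \<Rightarrow> 'h::chilbert_space"
begin

abbreviation "paths \<equiv> free_semigroupoid G"

lemma path_iff: "(x, p) \<in> paths \<longleftrightarrow> awalk x p (path_range G (x, p))"
  unfolding free_semigroupoid_def path_range_def by auto

lemma path_awalk: "(x, p) \<in> paths \<Longrightarrow> awalk x p (path_range G (x, p))"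
  by (simp only: path_iff)

lemma awalk_path: "awalk x p y \<Longrightarrow> (x, p) \<in> paths" "awalk x p y \<Longrightarrow> path_range G (x, p) = y"
  unfolding free_semigroupoid_def path_range_def by auto

lemma path_Nil [simp]: "(x, []) \<in> paths \<longleftrightarrow> x \<in> verts G"
  by (auto simp: free_semigroupoid_def awalk_Nil_iff)

lemma range_Nil [simp]: "path_range G (x, []) = x"
  by (simp add: path_range_def)

lemma path_Cons [simp]: "(x, e # p) \<in> paths \<longleftrightarrow> e \<in> arcs G \<and> x = tail G e \<and> (head G e, p) \<in> paths"
  by (auto simp: free_semigroupoid_def awalk_Cons_iff)

lemma range_Cons: "(head G e, p) \<in> paths \<Longrightarrow> e \<in> arcs G \<Longrightarrow>
    path_range G (tail G e, e # p) = path_range G (head G e, p)"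
  by (rule awalk_path(2)) (simp add: awalk_Cons_iff path_awalk)

lemma path_append: "(x, p @ q) \<in> paths \<longleftrightarrow> (x, p) \<in> paths \<and> (path_range G (x, p), q) \<in> paths"
proof
  assume "(x, p @ q) \<in> paths"
  then obtain y where "awalk x (p @ q) y"
    by (auto simp: free_semigroupoid_def)
  then obtain z where "awalk x p z" "awalk z q y"
    by auto
  then show "(x, p) \<in> paths \<and> (path_range G (x, p), q) \<in> paths"
    using awalk_path by simp
next
  assume *: "(x, p) \<in> paths \<and> (path_range G (x, p), q) \<in> paths"
  then have "awalk x p (path_range G (x, p))"
    by (simp add: path_awalk)
  moreover obtain y where "awalk (path_range G (x, p)) q y"
    using * by (auto simp: free_semigroupoid_def)
  ultimately show "(x, p @ q) \<in> paths"
    by (rule awalk_path(1)[OF awalk_appendI])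
qed

lemma range_append: "(x, p) \<in> paths \<Longrightarrow> (path_range G (x, p), q) \<in> paths \<Longrightarrow>
    path_range G (x, p @ q) = path_range G (path_range G (x, p), q)"
  by (rule awalk_path(2)[OF awalk_appendI[OF path_awalk path_awalk]])

lemma range_in_verts: "(x, p) \<in> paths \<Longrightarrow> path_range G (x, p) \<in> verts G"
  by (rule awalk_last_in_verts[OF path_awalk])

text \<open>The operator \<open>path_op w\<close> is the left creation operator of \<open>w\<close>, which appends \<open>w\<close> at the range of
  a path; \<open>right_op e\<close> is the right creation operator of \<open>e\<close>, which prepends \<open>e\<close> at the source, and
  \<open>right_adj e\<close>, which strips \<open>e\<close>, is its adjoint.\<close>

definition path_op :: "('v, 'e) path \<Rightarrow> 'h \<Rightarrow>\<^sub>L 'h" where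
  "path_op w = basis_map (\<lambda>v. if path_range G v = fst w then Some (fst v, snd v @ snd w) else None)"

definition right_op :: "'e \<Rightarrow> 'h \<Rightarrow>\<^sub>L 'h" where
  "right_op e = basis_map (\<lambda>v. if fst v = head G e then Some (tail G e, e # snd v) else None)"

definition right_adj :: "'e \<Rightarrow> 'h \<Rightarrow>\<^sub>L 'h" where
  "right_adj e = basis_map (\<lambda>v. case snd v of [] \<Rightarrow> None
     | f # q \<Rightarrow> if f = e then Some (head G e, q) else None)"

definition source_proj :: "'v \<Rightarrow> 'h \<Rightarrow>\<^sub>L 'h" where
  "source_proj x = coord_proj {v. fst v = x}"

definition range_proj :: "'v \<Rightarrow> 'h \<Rightarrow>\<^sub>L 'h" where
  "range_proj x = coord_proj {v. path_range G v = x}"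

lemma path_op_injection:
  assumes "w \<in> paths"
  shows "partial_injection (\<lambda>v. if path_range G v = fst w then Some (fst v, snd v @ snd w) else None)"
  using assms unfolding partial_injection_def
  by (auto simp: path_append prod_eq_iff split: if_splits)

lemma right_op_injection:
  assumes "e \<in> arcs G"
  shows "partial_injection (\<lambda>v. if fst v = head G e then Some (tail G e, e # snd v) else None)"
  using assms unfolding partial_injection_def
  by (auto simp: prod_eq_iff split: if_splits)

lemma right_adj_injection:
  assumes "e \<in> arcs G"
  shows "partial_injection (\<lambda>v. case snd v of [] \<Rightarrow> None
     | f # q \<Rightarrow> if f = e then Some (head G e, q) else None)"
  using assms unfolding partial_injection_def
  by (auto split: list.splits if_splits)

lemma path_op_bounded [simp]: "w \<in> paths \<Longrightarrow> path_op w \<in> bounded_operators"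
  unfolding path_op_def by (intro basis_map_bounded path_op_injection)

lemma right_op_bounded [simp]: "e \<in> arcs G \<Longrightarrow> right_op e \<in> bounded_operators"
  unfolding right_op_def by (intro basis_map_bounded right_op_injection)

lemma right_adj_bounded [simp]: "e \<in> arcs G \<Longrightarrow> right_adj e \<in> bounded_operators"
  unfolding right_adj_def by (intro basis_map_bounded right_adj_injection)

lemma source_proj_bounded [simp]: "source_proj x \<in> bounded_operators"
  by (simp add: source_proj_def)

lemma range_proj_bounded [simp]: "range_proj x \<in> bounded_operators"
  by (simp add: range_proj_def)

lemma norm_path_op: "w \<in> paths \<Longrightarrow> norm (path_op w) \<le> 1"
  unfolding path_op_def by (intro norm_basis_map path_op_injection)

lemma path_op_basis: "w \<in> paths \<Longrightarrow> (y, p) \<in> paths \<Longrightarrow>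
    blinfun_apply (path_op w) (\<xi> (y, p)) = (if path_range G (y, p) = fst w then \<xi> (y, p @ snd w) else 0)"
  unfolding path_op_def by (simp add: basis_map_apply[OF path_op_injection])

lemma right_op_basis: "e \<in> arcs G \<Longrightarrow> (y, p) \<in> paths \<Longrightarrow>
    blinfun_apply (right_op e) (\<xi> (y, p)) = (if y = head G e then \<xi> (tail G e, e # p) else 0)"
  unfolding right_op_def by (simp add: basis_map_apply[OF right_op_injection])

lemma right_adj_basis: "e \<in> arcs G \<Longrightarrow> (y, p) \<in> paths \<Longrightarrow>
    blinfun_apply (right_adj e) (\<xi> (y, p)) =
      (case p of [] \<Rightarrow> 0 | f # q \<Rightarrow> if f = e then \<xi> (head G e, q) else 0)"
  unfolding right_adj_def by (simp add: basis_map_apply[OF right_adj_injection] split: list.split)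

lemma source_proj_basis: "(y, p) \<in> paths \<Longrightarrow>
    blinfun_apply (source_proj x) (\<xi> (y, p)) = (if y = x then \<xi> (y, p) else 0)"
  by (simp add: source_proj_def coord_proj_basis)

lemma range_proj_basis: "(y, p) \<in> paths \<Longrightarrow>
    blinfun_apply (range_proj x) (\<xi> (y, p)) = (if path_range G (y, p) = x then \<xi> (y, p) else 0)"
  by (simp add: range_proj_def coord_proj_basis)

lemma cinner_right_op:
  assumes e: "e \<in> arcs G"
  shows "cinner (blinfun_apply (right_op e) h) k = cinner h (blinfun_apply (right_adj e) k)"
proof (rule adjoint_eqI)
  fix v w assume "v \<in> paths" "w \<in> paths"
  then obtain x p y q where "v = (x, p)" "w = (y, q)" "(x, p) \<in> paths" "(y, q) \<in> paths"
    by (metis prod.exhaust)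
  then show "cinner (right_op e (\<xi> v)) (\<xi> w) = cinner (\<xi> v) (right_adj e (\<xi> w))"
    using e by (cases q) (auto simp: right_op_basis right_adj_basis cinner_basis)
qed (use e in simp_all)

lemma cinner_right_op': "e \<in> arcs G \<Longrightarrow>
    cinner (blinfun_apply (right_adj e) h) k = cinner h (blinfun_apply (right_op e) k)"
  by (metis cinner_commute cinner_right_op)

lemma cinner_source_proj: "cinner (blinfun_apply (source_proj x) h) k = cinner h (blinfun_apply (source_proj x) k)"
  by (simp add: source_proj_def coord_proj_self_adjoint)

lemma operators_eqI:
  assumes "S \<in> bounded_operators" "T \<in> bounded_operators"
    "\<And>x p. (x, p) \<in> paths \<Longrightarrow> blinfun_apply S (\<xi> (x, p)) = blinfun_apply T (\<xi> (x, p))"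
  shows "S = T"
  using assms by (intro operator_eqI) auto

lemma right_adj_right_op:
  assumes "e \<in> arcs G" "f \<in> arcs G"
  shows "right_adj e o\<^sub>L right_op f = (if e = f then source_proj (head G e) else 0)"
  using assms
  by (intro operators_eqI)
     (auto simp: bounded_operators_compose right_op_basis right_adj_basis source_proj_basis)

lemma right_op_source: "e \<in> arcs G \<Longrightarrow> right_op e o\<^sub>L source_proj (head G e) = right_op e"
  by (intro operators_eqI) (auto simp: bounded_operators_compose right_op_basis source_proj_basis)

lemma source_right_op: "e \<in> arcs G \<Longrightarrow>
    source_proj x o\<^sub>L right_op e = (if x = tail G e then right_op e else 0)"
  by (intro operators_eqI) (auto simp: bounded_operators_compose right_op_basis source_proj_basis)

subsection \<open>The commutant of the right creation operators\<close>

definition right_commutant :: "('h \<Rightarrow>\<^sub>L 'h) set" where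
  "right_commutant = {T \<in> bounded_operators.
     (\<forall>e\<in>arcs G. T o\<^sub>L right_op e = right_op e o\<^sub>L T) \<and>
     (\<forall>x\<in>verts G. T o\<^sub>L source_proj x = source_proj x o\<^sub>L T)}"

lemma right_commutant_bounded: "T \<in> right_commutant \<Longrightarrow> T \<in> bounded_operators"
  by (simp add: right_commutant_def)

lemma compose_eqD:
  "S o\<^sub>L T = U o\<^sub>L V \<Longrightarrow> blinfun_apply S (blinfun_apply T h) = blinfun_apply U (blinfun_apply V h)"
  by (metis blinfun_apply_blinfun_compose)

lemma right_commutant_right:
  "T \<in> right_commutant \<Longrightarrow> e \<in> arcs G \<Longrightarrow>
    blinfun_apply T (blinfun_apply (right_op e) h) = blinfun_apply (right_op e) (blinfun_apply T h)"
  unfolding right_commutant_def by (blast intro: compose_eqD)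

lemma right_commutant_source:
  "T \<in> right_commutant \<Longrightarrow> x \<in> verts G \<Longrightarrow>
    blinfun_apply T (blinfun_apply (source_proj x) h) = blinfun_apply (source_proj x) (blinfun_apply T h)"
  unfolding right_commutant_def by (blast intro: compose_eqD)

lemma right_commutantI:
  assumes "T \<in> bounded_operators"
    "\<And>e h. e \<in> arcs G \<Longrightarrow>
      blinfun_apply T (blinfun_apply (right_op e) h) = blinfun_apply (right_op e) (blinfun_apply T h)"
    "\<And>x h. x \<in> verts G \<Longrightarrow>
      blinfun_apply T (blinfun_apply (source_proj x) h) = blinfun_apply (source_proj x) (blinfun_apply T h)"
  shows "T \<in> right_commutant"
  using assms by (auto simp: right_commutant_def intro!: blinfun_eqI)

lemma right_commutantI_basis:
  assumes T: "T \<in> bounded_operators"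
    and r: "\<And>e y p. e \<in> arcs G \<Longrightarrow> (y, p) \<in> paths \<Longrightarrow>
      blinfun_apply T (blinfun_apply (right_op e) (\<xi> (y, p))) = blinfun_apply (right_op e) (blinfun_apply T (\<xi> (y, p)))"
    and s: "\<And>x y p. x \<in> verts G \<Longrightarrow> (y, p) \<in> paths \<Longrightarrow>
      blinfun_apply T (blinfun_apply (source_proj x) (\<xi> (y, p))) = blinfun_apply (source_proj x) (blinfun_apply T (\<xi> (y, p)))"
  shows "T \<in> right_commutant"
  unfolding right_commutant_def
  by (auto intro!: operators_eqI bounded_operators_compose T simp: r s)

lemma right_commutant_operator_algebra: "operator_algebra right_commutant"
  unfolding operator_algebra_def
proof (intro conjI allI ballI)
  show "right_commutant \<subseteq> bounded_operators" "0 \<in> right_commutant"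
    by (auto simp: right_commutant_def intro: blinfun_eqI)
  show "scaleC_blinfun c T \<in> right_commutant" if T: "T \<in> right_commutant" for c T
    by (rule right_commutantI)
       (simp_all add: bounded_operators_scaleC_blinfun right_commutant_bounded[OF T]
         scaleC_blinfun.rep_eq right_commutant_right[OF T] right_commutant_source[OF T]
         bounded_operators_scaleC)
  fix T U assume T: "T \<in> right_commutant" and U: "U \<in> right_commutant"
  show "T + U \<in> right_commutant"
    by (rule right_commutantI)
       (simp_all add: bounded_operators_add right_commutant_bounded T U blinfun.add_left blinfun.add_right
         right_commutant_right right_commutant_source)
  show "T o\<^sub>L U \<in> right_commutant"
    by (rule right_commutantI)
       (simp_all add: bounded_operators_compose right_commutant_bounded T U
         right_commutant_right right_commutant_source)
qed

text \<open>With the adjoint of the right creation operator moved to the other side, \<open>T R = R T\<close> reads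
  \<open>\<langle>T (R h), k\<rangle> = \<langle>T h, R\<^sup>* k\<rangle>\<close>, an equality of matrix coefficients of \<open>T\<close>.\<close>

lemma right_commutant_wot_closed: "closedin weak_operator_topology right_commutant"
proof -
  define D where "D = {(right_op e h, k, h, right_adj e k) |e h k. e \<in> arcs G} \<union>
     {(source_proj x h, k, h, source_proj x k) |x h k. x \<in> verts G}"
  have eqI: "a = b" if "\<And>k. cinner a k = cinner b k" for a b :: 'h
    by (rule vector_eqI) (rule that)
  have "right_commutant =
    {T \<in> bounded_operators. \<forall>(x, y, x', y')\<in>D. cinner (blinfun_apply T x) y = cinner (blinfun_apply T x') y'}"
  proof (intro equalityI subsetI)
    fix T assume T: "T \<in> right_commutant"
    then show "T \<in> {T \<in> bounded_operators. \<forall>(x, y, x', y')\<in>D. cinner (T x) y = cinner (T x') y'}"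
      by (auto simp: D_def right_commutant_bounded right_commutant_right[OF T]
          right_commutant_source[OF T] cinner_right_op cinner_source_proj)
  next
    fix T assume T: "T \<in> {T \<in> bounded_operators. \<forall>(x, y, x', y')\<in>D. cinner (T x) y = cinner (T x') y'}"
    show "T \<in> right_commutant"
    proof (rule right_commutantI)
      show "T \<in> bounded_operators" using T by simp
      show "T (right_op e h) = right_op e (T h)" if e: "e \<in> arcs G" for e h
      proof (rule eqI)
        fix k
        have "(right_op e h, k, h, right_adj e k) \<in> D"
          using e by (auto simp: D_def)
        then have "cinner (T (right_op e h)) k = cinner (T h) (right_adj e k)"
          using T by blast
        then show "cinner (T (right_op e h)) k = cinner (right_op e (T h)) k"
          by (simp add: cinner_right_op e)
      qed
      show "T (source_proj x h) = source_proj x (T h)" if x: "x \<in> verts G" for x h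
      proof (rule eqI)
        fix k
        have "(source_proj x h, k, h, source_proj x k) \<in> D"
          using x by (auto simp: D_def)
        then have "cinner (T (source_proj x h)) k = cinner (T h) (source_proj x k)"
          using T by blast
        then show "cinner (T (source_proj x h)) k = cinner (source_proj x (T h)) k"
          by (simp add: cinner_source_proj)
      qed
    qed
  qed
  then show ?thesis
    by (simp only: wot_closed_equalities)
qed

lemma path_op_commutes:
  assumes w: "w \<in> paths"
  shows "path_op w \<in> right_commutant"
proof -
  obtain x q where xq: "w = (x, q)" by fastforce
  show ?thesis
    by (rule right_commutantI_basis)
       (use w in \<open>auto simp: xq right_op_basis path_op_basis source_proj_basis range_Cons path_append\<close>)
qed

lemma path_op_Nil: "x \<in> verts G \<Longrightarrow> path_op (x, []) = range_proj x"
  by (intro operators_eqI) (auto simp: path_op_basis range_proj_basis)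

lemma path_op_snoc:
  assumes "(x, q @ [e]) \<in> paths"
  shows "path_op (x, q @ [e]) = path_op (tail G e, [e]) o\<^sub>L path_op (x, q)"
proof -
  have q: "(x, q) \<in> paths" "e \<in> arcs G" "path_range G (x, q) = tail G e" "(tail G e, [e]) \<in> paths"
    using assms by (auto simp: path_append)
  show ?thesis
    using q assms
    by (intro operators_eqI)
       (auto simp: path_op_basis bounded_operators_compose range_append path_append)
qed

lemma edge_operator_iff: "e \<in> arcs G \<Longrightarrow> is_edge_operator G \<xi> e T \<longleftrightarrow> T = path_op (tail G e, [e])"
proof
  assume e: "e \<in> arcs G" and T: "is_edge_operator G \<xi> e T"
  show "T = path_op (tail G e, [e])"
    using T e by (intro operators_eqI) (auto simp: is_edge_operator_def path_op_basis edge_mult_def)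
next
  assume e: "e \<in> arcs G" and T: "T = path_op (tail G e, [e])"
  then show "is_edge_operator G \<xi> e T"
    by (auto simp: is_edge_operator_def path_op_basis edge_mult_def)
qed

lemma vertex_projection_iff: "is_vertex_projection G \<xi> x T \<longleftrightarrow> T = range_proj x"
proof -
  have "coord_proj {w \<in> paths. path_range G w = x} = range_proj x"
    by (intro operators_eqI) (auto simp: coord_proj_basis range_proj_basis)
  then show ?thesis
    unfolding is_vertex_projection_def by (subst coord_proj_is_projection) auto
qed

lemma algebra_in_commutant: "free_semigroupoid_algebra G \<xi> \<subseteq> right_commutant"
  unfolding free_semigroupoid_algebra_def
proof (rule hull_minimal)
  have "path_op (tail G e, [e]) \<in> right_commutant" if "e \<in> arcs G" for e
    using that by (intro path_op_commutes) simp
  moreover have "range_proj x \<in> right_commutant" if "x \<in> verts G" for x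
    using path_op_commutes[of "(x, [])"] that by (simp add: path_op_Nil)
  ultimately show "{T. \<exists>e\<in>arcs G. is_edge_operator G \<xi> e T} \<union>
      {T. \<exists>x\<in>verts G. is_vertex_projection G \<xi> x T} \<subseteq> right_commutant"
    by (auto simp: edge_operator_iff vertex_projection_iff)
qed (simp add: right_commutant_operator_algebra right_commutant_wot_closed)

end

section \<open>The algebra as a commutant\<close>

lemma sum_if_card: "(\<Sum>j<M::nat. if Q j then a else 0) = of_nat (card {j. j < M \<and> Q j}) * (a :: 'a::semiring_1)"
proof -
  have "{..<M} \<inter> {j. Q j} = {j. j < M \<and> Q j}" by auto
  then show ?thesis by (subst sum.If_cases) simp_all
qed

context orthonormal begin

lemma norm_operator_le:
  assumes "M \<ge> 0" "\<And>h k. cmod (cinner (blinfun_apply T h) k) \<le> M * norm h * norm (k::'h)"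
  shows "norm (T :: 'h \<Rightarrow>\<^sub>L 'h) \<le> M"
proof (rule norm_blinfun_bound[OF assms(1)])
  fix h
  show "norm (T h) \<le> M * norm h"
  proof (cases "T h = 0")
    case False
    have "norm (T h) * norm (T h) \<le> M * norm h * norm (T h)"
      using assms(2)[of h "T h"] by (simp add: cinner_self norm_mult power2_eq_square)
    then show ?thesis
      using False by simp
  qed (use assms in simp)
qed

text \<open>The sum of the projections is diagonal, and its entry at \<open>\<xi> w\<close> is the number of sets \<open>J j\<close> that
  contain \<open>w\<close>.\<close>

lemma coord_proj_square_sum:
  fixes J :: "nat \<Rightarrow> 'i set"
  assumes count: "\<And>w. w \<in> I \<Longrightarrow> card {j. j < M \<and> w \<in> J j} \<le> n"
  shows "(\<Sum>j<M. (norm (blinfun_apply (coord_proj (J j)) h))\<^sup>2) \<le> real n * (norm h)\<^sup>2"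
proof -
  obtain D where D: "D \<in> bounded_operators" "norm D \<le> real n"
    "\<And>w. w \<in> I \<Longrightarrow> blinfun_apply D (\<xi> w) = real (card {j. j < M \<and> w \<in> J j}) *\<^sub>R \<xi> w"
  proof (rule orthogonal_operator_exists[of "real n" "\<lambda>w. real (card {j. j < M \<and> w \<in> J j}) *\<^sub>R \<xi> w"])
  qed (auto simp: cinner_simps cinner_basis norm_basis count)
  have "D = (\<Sum>j<M. coord_proj (J j))"
  proof (rule operator_eqI)
    fix w assume w: "w \<in> I"
    have "(\<Sum>j<M. coord_proj (J j)) (\<xi> w) = (\<Sum>j<M. (if w \<in> J j then 1 else 0) *\<^sub>R \<xi> w)"
      using w by (auto simp: blinfun.sum_left coord_proj_basis intro!: sum.cong)
    also have "\<dots> = real (card {j. j < M \<and> w \<in> J j}) *\<^sub>R \<xi> w"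
      using sum_if_card[where M = M and Q = "\<lambda>j. w \<in> J j" and a = "1::real"] by (simp flip: scaleR_sum_left)
    finally show "D (\<xi> w) = (\<Sum>j<M. coord_proj (J j)) (\<xi> w)"
      using D(3)[OF w] by simp
  qed (auto intro: bounded_operators_sum D)
  then have "cinner (D h) h = (\<Sum>j<M. cinner (coord_proj (J j) h) h)"
    by (simp add: blinfun.sum_left cinner_sum_left)
  also have "\<dots> = (\<Sum>j<M. complex_of_real ((norm (coord_proj (J j) h))\<^sup>2))"
  proof (rule sum.cong[OF refl])
    fix j
    have "cinner (coord_proj (J j) h) (coord_proj (J j) h) = cinner (coord_proj (J j) (coord_proj (J j) h)) h"
      by (simp add: coord_proj_self_adjoint)
    also have "\<dots> = cinner (coord_proj (J j) h) h"
      by (simp add: coord_proj_compose)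
    finally show "cinner (coord_proj (J j) h) h = complex_of_real ((norm (coord_proj (J j) h))\<^sup>2)"
      by (simp add: cinner_self)
  qed
  finally have "cinner (D h) h = complex_of_real (\<Sum>j<M. (norm (coord_proj (J j) h))\<^sup>2)"
    by (simp only: of_real_sum)
  then have "(\<Sum>j<M. (norm (coord_proj (J j) h))\<^sup>2) = Re (cinner (D h) h)"
    by simp
  also have "\<dots> \<le> norm (D h) * norm h"
    using complex_Re_le_cmod cmod_cinner_le order_trans by blast
  also have "\<dots> \<le> (real n * norm h) * norm h"
    by (intro mult_right_mono order_trans[OF norm_blinfun] D(2) norm_ge_zero)
  finally show ?thesis
    by (simp add: power2_eq_square mult.assoc)
qed

text \<open>The triangular kernel is positive definite: up to the factor \<open>n\<close> it counts the windows of
  length \<open>n\<close> containing both degrees. Multiplying the matrix of \<open>T\<close> by it therefore averages the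
  compressions of \<open>T\<close> to these windows, which does not increase the norm.\<close>

lemma fejer_multiplier_bound:
  fixes d :: "'i \<Rightarrow> nat"
  assumes T: "T \<in> bounded_operators" and K: "K \<in> bounded_operators" and n: "n \<ge> 1"
    and entries: "\<And>v w. v \<in> I \<Longrightarrow> w \<in> I \<Longrightarrow> cinner (blinfun_apply K (\<xi> v)) (\<xi> w) =
      complex_of_real (real (min (d v) (d w) + n - max (d v) (d w)) / real n) *
        cinner (blinfun_apply T (\<xi> v)) (\<xi> w)"
  shows "norm K \<le> norm T"
proof -
  define J where "J = (\<lambda>j. {w. d w \<le> j \<and> j < d w + n})"
  define L where "L = (\<lambda>M. (1 / real n) *\<^sub>R (\<Sum>j<M. coord_proj (J j) o\<^sub>L T o\<^sub>L coord_proj (J j)))"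
  have L: "L M \<in> bounded_operators" for M
    unfolding L_def
    by (intro bounded_operators_scaleR bounded_operators_sum bounded_operators_compose T coord_proj_bounded)
  have count: "card {j. j < M \<and> w \<in> J j} \<le> n" for M w
  proof -
    have "card {j. j < M \<and> w \<in> J j} \<le> card {d w..<d w + n}"
      by (rule card_mono) (auto simp: J_def)
    then show ?thesis by simp
  qed
  have L_inner: "cinner (L M h) k = complex_of_real (1 / real n) * (\<Sum>j<M. cinner (T (coord_proj (J j) h)) (coord_proj (J j) k))" for M h k
    by (simp add: L_def blinfun.scaleR_left blinfun.sum_left cinner_sum_left cinner_simps coord_proj_self_adjoint)
  have L_le: "cmod (cinner (L M h) k) \<le> norm T * norm h * norm k" for M h k
  proof -
    let ?a = "\<lambda>j. norm (coord_proj (J j) h)" and ?b = "\<lambda>j. norm (coord_proj (J j) k)"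
    have "(\<Sum>j<M. ?a j * ?b j)\<^sup>2 \<le> (\<Sum>j<M. (?a j)\<^sup>2) * (\<Sum>j<M. (?b j)\<^sup>2)"
      by (rule Cauchy_Schwarz_ineq_sum)
    also have "\<dots> \<le> (real n * (norm h)\<^sup>2) * (real n * (norm k)\<^sup>2)"
      by (intro mult_mono coord_proj_square_sum count) (auto intro: sum_nonneg)
    also have "\<dots> = (real n * norm h * norm k)\<^sup>2"
      by (simp add: power2_eq_square mult_ac)
    finally have sum_le: "(\<Sum>j<M. ?a j * ?b j) \<le> real n * norm h * norm k"
      by (rule power2_le_imp_le) simp
    have "cmod (\<Sum>j<M. cinner (T (coord_proj (J j) h)) (coord_proj (J j) k))
        \<le> (\<Sum>j<M. norm T * (?a j * ?b j))"
    proof (rule order_trans[OF norm_sum sum_mono])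
      fix j
      have "cmod (cinner (T (coord_proj (J j) h)) (coord_proj (J j) k)) \<le> norm (T (coord_proj (J j) h)) * ?b j"
        by (rule cmod_cinner_le)
      also have "\<dots> \<le> (norm T * ?a j) * ?b j"
        by (intro mult_right_mono norm_blinfun norm_ge_zero)
      finally show "cmod (cinner (T (coord_proj (J j) h)) (coord_proj (J j) k)) \<le> norm T * (?a j * ?b j)"
        by (simp add: mult_ac)
    qed
    also have "\<dots> = norm T * (\<Sum>j<M. ?a j * ?b j)"
      by (simp add: sum_distrib_left)
    also have "\<dots> \<le> norm T * (real n * norm h * norm k)"
      by (intro mult_left_mono sum_le) simp
    finally show ?thesis
      using n by (simp add: L_inner norm_mult norm_divide divide_simps mult_ac)
  qed
  have L_norm: "norm (L M) \<le> norm T" for M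
    by (rule norm_operator_le[OF norm_ge_zero L_le])
  have lim: "(\<lambda>M. cinner (L M h) k) \<longlonglongrightarrow> cinner (K h) k" for h k
  proof (rule wot_limit_of_entries[OF L L_norm K])
    fix v w assume v: "v \<in> I" and w: "w \<in> I"
    have "cinner (L M (\<xi> v)) (\<xi> w) = cinner (K (\<xi> v)) (\<xi> w)" if M: "M \<ge> d v + d w + n" for M
    proof -
      have "{j. j < M \<and> v \<in> J j \<and> w \<in> J j} = {max (d v) (d w)..<min (d v) (d w) + n}"
        using M by (auto simp: J_def)
      then have c: "card {j. j < M \<and> v \<in> J j \<and> w \<in> J j} = min (d v) (d w) + n - max (d v) (d w)"
        by simp
      have "(\<Sum>j<M. cinner (T (coord_proj (J j) (\<xi> v))) (coord_proj (J j) (\<xi> w)))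
          = (\<Sum>j<M. if v \<in> J j \<and> w \<in> J j then cinner (T (\<xi> v)) (\<xi> w) else 0)"
        using v w by (intro sum.cong) (auto simp: coord_proj_basis)
      also have "\<dots> = of_nat (card {j. j < M \<and> v \<in> J j \<and> w \<in> J j}) * cinner (T (\<xi> v)) (\<xi> w)"
        by (simp add: sum_if_card)
      finally show ?thesis
        using entries[OF v w] by (simp add: L_inner c)
    qed
    then show "(\<lambda>M. cinner (L M (\<xi> v)) (\<xi> w)) \<longlonglongrightarrow> cinner (K (\<xi> v)) (\<xi> w)"
      by (intro tendsto_eventually eventually_sequentiallyI)
  qed
  show ?thesis
  proof (rule norm_operator_le[OF norm_ge_zero])
    fix h k
    show "cmod (cinner (K h) k) \<le> norm T * norm h * norm k"
      by (rule tendsto_upperbound[OF tendsto_norm[OF lim]]) (simp_all add: L_le)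
  qed
qed

end

context fock begin

text \<open>The matrix of an operator in the commutant is that of a left convolution: its entry at \<open>(w, v)\<close>
  depends only on the path by which \<open>v\<close> extends \<open>w\<close>, and vanishes if \<open>v\<close> does not extend \<open>w\<close>.\<close>

lemma entry_append:
  assumes T: "T \<in> right_commutant"
  shows "(y, p @ s) \<in> paths \<Longrightarrow> cinner (blinfun_apply T (\<xi> (y, p))) (\<xi> (y, p @ s)) =
    cinner (blinfun_apply T (\<xi> (path_range G (y, p), []))) (\<xi> (path_range G (y, p), s))"
proof (induction p arbitrary: y)
  case (Cons e p)
  then have e: "e \<in> arcs G" "y = tail G e" "(head G e, p @ s) \<in> paths" "(head G e, p) \<in> paths"
    by (auto simp: path_append)
  have "\<xi> (y, e # p) = right_op e (\<xi> (head G e, p))"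
    using e by (simp add: right_op_basis)
  then have "cinner (T (\<xi> (y, e # p))) (\<xi> (y, (e # p) @ s)) =
      cinner (T (\<xi> (head G e, p))) (right_adj e (\<xi> (y, (e # p) @ s)))"
    using e by (simp add: right_commutant_right[OF T] cinner_right_op)
  also have "right_adj e (\<xi> (y, (e # p) @ s)) = \<xi> (head G e, p @ s)"
    using e Cons.prems by (simp add: right_adj_basis)
  finally show ?case
    using Cons.IH[of "head G e"] e by (simp add: range_Cons)
qed simp

lemma entry_zero:
  assumes T: "T \<in> right_commutant"
  shows "(y, p) \<in> paths \<Longrightarrow> (z, q) \<in> paths \<Longrightarrow> \<not> (z = y \<and> (\<exists>s. q = p @ s)) \<Longrightarrow>
    cinner (blinfun_apply T (\<xi> (y, p))) (\<xi> (z, q)) = 0"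
proof (induction p arbitrary: y z q)
  case Nil
  then have zy: "z \<noteq> y" by simp
  have "cinner (T (\<xi> (y, []))) (\<xi> (z, q)) = cinner (T (source_proj y (\<xi> (y, [])))) (\<xi> (z, q))"
    using Nil by (simp add: source_proj_basis)
  also have "\<dots> = cinner (T (\<xi> (y, []))) (source_proj y (\<xi> (z, q)))"
    using Nil by (simp add: right_commutant_source[OF T] cinner_source_proj)
  also have "\<dots> = 0"
    using Nil zy by (simp add: source_proj_basis)
  finally show ?case .
next
  case (Cons e p)
  then have e: "e \<in> arcs G" "y = tail G e" "(head G e, p) \<in> paths"
    by auto
  have "\<xi> (y, e # p) = right_op e (\<xi> (head G e, p))"
    using e by (simp add: right_op_basis)
  then have *: "cinner (T (\<xi> (y, e # p))) (\<xi> (z, q)) =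
      cinner (T (\<xi> (head G e, p))) (right_adj e (\<xi> (z, q)))"
    using e by (simp add: right_commutant_right[OF T] cinner_right_op)
  show ?case
  proof (cases "\<exists>q'. q = e # q'")
    case True
    then obtain q' where q': "q = e # q'" by auto
    then have "right_adj e (\<xi> (z, q)) = \<xi> (head G e, q')" "(head G e, q') \<in> paths"
      using Cons.prems e by (auto simp: right_adj_basis)
    then show ?thesis
      using * Cons.IH[OF e(3), of "head G e" q'] Cons.prems q' e by auto
  next
    case False
    then have "right_adj e (\<xi> (z, q)) = 0"
      using Cons.prems e by (auto simp: right_adj_basis split: list.split)
    then show ?thesis
      by (simp add: *)
  qed
qed

text \<open>Left creation operators of distinct paths of equal length have orthogonal ranges, so that a
  homogeneous series \<open>\<Sum>w. t w L\<^sub>w\<close> with common source converges in norm when \<open>t\<close> is square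
  summable.\<close>

lemma norm_homogeneous_sum:
  assumes F: "finite F" "F \<subseteq> {w \<in> paths. length (snd w) = m}"
  shows "(norm (\<Sum>w\<in>F. scaleC_blinfun (t w) (path_op w)))\<^sup>2 \<le> (\<Sum>w\<in>F. (cmod (t w))\<^sup>2)"
proof -
  let ?q = "\<Sum>w\<in>F. (cmod (t w))\<^sup>2"
  have orth: "cinner (path_op v x) (path_op w y) = 0" if "v \<in> F" "w \<in> F" "v \<noteq> w" for v w x y
  proof (rule orthogonal_operatorsI)
    obtain a p b q where vw: "v = (a, p)" "w = (b, q)" by fastforce
    have vw': "(a, p) \<in> paths" "(b, q) \<in> paths" "length p = length q"
      using subsetD[OF F(2) that(1)] subsetD[OF F(2) that(2)] by (simp_all add: vw)
    fix v' w' assume "v' \<in> paths" "w' \<in> paths"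
    then obtain c r d s where *: "v' = (c, r)" "w' = (d, s)" "(c, r) \<in> paths" "(d, s) \<in> paths"
      by (metis prod.exhaust)
    show "cinner (path_op v (\<xi> v')) (path_op w (\<xi> w')) = 0"
    proof (cases "path_range G (c, r) = a \<and> path_range G (d, s) = b")
      case True
      then have "(c, r @ p) \<in> paths" "(d, s @ q) \<in> paths"
        using * vw' by (auto simp: path_append)
      moreover have "(c, r @ p) \<noteq> (d, s @ q)"
        using True vw vw'(3) \<open>v \<noteq> w\<close> by auto
      ultimately show ?thesis
        using True * vw vw' by (simp add: path_op_basis cinner_basis)
    next
      case False
      then show ?thesis
        using * vw vw' by (auto simp: path_op_basis)
    qed
  qed (use that F in auto)
  have "norm (\<Sum>w\<in>F. scaleC_blinfun (t w) (path_op w)) \<le> sqrt ?q"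
  proof (rule norm_blinfun_bound)
    fix h
    have "(norm ((\<Sum>w\<in>F. scaleC_blinfun (t w) (path_op w)) h))\<^sup>2 = (norm (\<Sum>w\<in>F. t w *\<^sub>C path_op w h))\<^sup>2"
      by (simp add: blinfun.sum_left scaleC_blinfun.rep_eq)
    also have "\<dots> = (\<Sum>w\<in>F. (norm (t w *\<^sub>C path_op w h))\<^sup>2)"
      using F orth
      by (intro norm_sum_Pythagorean)
         (auto simp: pairwise_def orthogonal_def cinner_simps simp flip: Re_cinner)
    also have "\<dots> \<le> (\<Sum>w\<in>F. (cmod (t w))\<^sup>2 * (norm h)\<^sup>2)"
    proof (rule sum_mono)
      fix w assume "w \<in> F"
      then have "norm (path_op w) \<le> 1"
        using F by (intro norm_path_op) auto
      then have "norm (path_op w h) \<le> norm h"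
        using norm_blinfun[of "path_op w" h] mult_right_mono[of _ 1 "norm h"] by fastforce
      then show "(norm (t w *\<^sub>C path_op w h))\<^sup>2 \<le> (cmod (t w))\<^sup>2 * (norm h)\<^sup>2"
        by (simp add: norm_scaleC power_mult_distrib mult_left_mono)
    qed
    also have "\<dots> = (sqrt ?q * norm h)\<^sup>2"
      by (simp add: power_mult_distrib sum_nonneg sum_distrib_right)
    finally show "norm ((\<Sum>w\<in>F. scaleC_blinfun (t w) (path_op w)) h) \<le> sqrt ?q * norm h"
      by (rule power2_le_imp_le) (simp add: sum_nonneg)
  qed (simp add: sum_nonneg)
  then have "(norm (\<Sum>w\<in>F. scaleC_blinfun (t w) (path_op w)))\<^sup>2 \<le> (sqrt ?q)\<^sup>2"
    by (rule power_mono) simp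
  then show ?thesis
    by (simp add: sum_nonneg)
qed

text \<open>The algebra is the intersection of all sets \<open>S\<close> as follows.\<close>

context
  fixes S :: "('h \<Rightarrow>\<^sub>L 'h) set"
  assumes alg: "operator_algebra S" and closed: "closedin weak_operator_topology S"
    and edges: "\<And>e. e \<in> arcs G \<Longrightarrow> path_op (tail G e, [e]) \<in> S"
    and vertices: "\<And>x. x \<in> verts G \<Longrightarrow> path_op (x, []) \<in> S"
begin

lemma path_op_in: "(x, p) \<in> paths \<Longrightarrow> path_op (x, p) \<in> S"
proof (induction p rule: rev_induct)
  case (snoc e p)
  then have "(x, p) \<in> paths" "e \<in> arcs G"
    by (auto simp: path_append)
  then show ?case
    using snoc edges alg unfolding operator_algebra_def by (simp add: path_op_snoc)
qed (simp add: vertices)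

lemma sum_in: "(\<And>i. i \<in> F \<Longrightarrow> f i \<in> S) \<Longrightarrow> sum f F \<in> S"
  using alg unfolding operator_algebra_def
  by (induction F rule: infinite_finite_induct) auto

lemma scaleR_in: "T \<in> S \<Longrightarrow> r *\<^sub>R T \<in> S"
  using alg unfolding operator_algebra_def by (metis scaleC_blinfun_of_real)

text \<open>The part of \<open>T P\<^sub>x\<close> that raises the length of paths by \<open>m\<close> is the norm convergent series of the
  \<open>t w L\<^sub>w\<close> over the paths \<open>w\<close> of length \<open>m\<close> with source \<open>x\<close>, where \<open>t w\<close> is the coefficient of
  \<open>T (\<xi> x)\<close> at \<open>w\<close>.\<close>

lemma homogeneous_part:
  assumes T: "T \<in> right_commutant" and x: "x \<in> verts G"
  obtains Tm where "Tm \<in> S" "\<And>y p z q. (y, p) \<in> paths \<Longrightarrow> (z, q) \<in> paths \<Longrightarrow>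
    cinner (blinfun_apply Tm (\<xi> (y, p))) (\<xi> (z, q)) =
      (if path_range G (y, p) = x \<and> length q = length p + m
       then cinner (blinfun_apply T (\<xi> (y, p))) (\<xi> (z, q)) else 0)"
proof -
  define t where "t = (\<lambda>w. cinner (T (\<xi> (x, []))) (\<xi> w))"
  define J where "J = {w \<in> paths. fst w = x \<and> length (snd w) = m}"
  define X where "X = (\<lambda>w. scaleC_blinfun (t w) (path_op w))"
  have summable: "X summable_on J"
  proof (rule summable_on_if_square_bounded)
    show "(\<lambda>w. (cmod (t w))\<^sup>2) summable_on J"
      by (rule summable_on_subset_banach[of _ paths])
         (auto simp: t_def J_def coefficients_square_summable)
    show "(norm (sum X F))\<^sup>2 \<le> (\<Sum>w\<in>F. (cmod (t w))\<^sup>2)" if "finite F" "F \<subseteq> J" for F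
      unfolding X_def using that by (intro norm_homogeneous_sum[where m = m]) (auto simp: J_def)
  qed simp
  define Tm where "Tm = infsum X J"
  have lim: "(sum X \<longlongrightarrow> Tm) (finite_subsets_at_top J)"
    unfolding Tm_def by (rule infsum_tendsto[OF summable])
  show ?thesis
  proof
    have "X w \<in> S" if "w \<in> J" for w
      using that path_op_in[of x "snd w"] alg unfolding operator_algebra_def
      by (auto simp: X_def J_def)
    then have "\<forall>\<^sub>F F in finite_subsets_at_top J. sum X F \<in> S"
      by (intro eventually_finite_subsets_at_top_weakI sum_in) auto
    then show "Tm \<in> S"
      using wot_closed_norm_limit[OF closed _ _ lim] by simp
    fix y p z q
    assume yp: "(y, p) \<in> paths" and zq: "(z, q) \<in> paths"
    have bl: "bounded_linear (\<lambda>X. cinner (blinfun_apply X (\<xi> (y, p))) (\<xi> (z, q)))"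
      by (rule bounded_linear_compose[OF bounded_linear_cinner_left blinfun.bounded_linear_left])
    let ?f = "\<lambda>w. cinner (X w (\<xi> (y, p))) (\<xi> (z, q))"
    have sum: "cinner (Tm (\<xi> (y, p))) (\<xi> (z, q)) = infsum ?f J"
      unfolding Tm_def
      by (rule infsumI[symmetric, OF has_sum_bounded_linear[OF bl has_sum_infsum[OF summable]]])
    have entry: "?f w = (if path_range G (y, p) = x \<and> z = y \<and> q = p @ snd w then t w else 0)" if "w \<in> J" for w
      using that yp zq
      by (auto simp: J_def X_def scaleC_blinfun.rep_eq path_op_basis cinner_simps cinner_basis path_append)
    show "cinner (Tm (\<xi> (y, p))) (\<xi> (z, q)) =
      (if path_range G (y, p) = x \<and> length q = length p + m
       then cinner (T (\<xi> (y, p))) (\<xi> (z, q)) else 0)"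
    proof (cases "path_range G (y, p) = x \<and> length q = length p + m \<and> z = y \<and> (\<exists>s. q = p @ s)")
      case True
      then obtain s where s: "q = p @ s" "length s = m" by auto
      have xs: "(x, s) \<in> J"
        using True s zq by (auto simp: J_def path_append)
      have "?f w = 0" if "w \<in> J - {(x, s)}" for w
        using entry[of w] that s by (cases w) (auto simp: J_def)
      then have "infsum ?f J = infsum ?f {(x, s)}"
        by (intro infsum_cong_neutral) (use xs in auto)
      also have "\<dots> = t (x, s)"
        using entry[OF xs] True s by simp
      also have "\<dots> = cinner (T (\<xi> (y, p))) (\<xi> (z, q))"
        using entry_append[OF T, of y p s] True s zq by (simp add: t_def)
      finally show ?thesis
        using True sum by simp
    next
      case False
      then have "?f w = 0" if "w \<in> J" for w
        using entry[OF that] that by (auto simp: J_def)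
      then have "infsum ?f J = 0"
        by (rule infsum_0)
      then show ?thesis
        using False sum entry_zero[OF T yp zq] by auto
    qed
  qed
qed

text \<open>The Cesaro means \<open>K n\<close> of the homogeneous parts have entries converging to those of \<open>T P\<^sub>x\<close>, and are
  bounded by \<open>fejer_multiplier_bound\<close>.\<close>

lemma commutant_vertex_in:
  assumes T: "T \<in> right_commutant" and x: "x \<in> verts G"
  shows "T o\<^sub>L range_proj x \<in> S"
proof -
  have TB: "T \<in> bounded_operators"
    by (rule right_commutant_bounded[OF T])
  have SB: "S \<subseteq> bounded_operators"
    using alg by (simp add: operator_algebra_def)
  let ?U = "T o\<^sub>L range_proj x"
  have U: "?U \<in> bounded_operators"
    by (simp add: bounded_operators_compose TB)
  obtain Tm where Tm: "\<And>m. Tm m \<in> S" and entries: "\<And>m y p z q. (y, p) \<in> paths \<Longrightarrow> (z, q) \<in> paths \<Longrightarrow>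
    cinner (blinfun_apply (Tm m) (\<xi> (y, p))) (\<xi> (z, q)) =
      (if path_range G (y, p) = x \<and> length q = length p + m
       then cinner (T (\<xi> (y, p))) (\<xi> (z, q)) else 0)"
  proof -
    have "\<forall>m. \<exists>U\<in>S. \<forall>y p z q. (y, p) \<in> paths \<longrightarrow> (z, q) \<in> paths \<longrightarrow>
      cinner (blinfun_apply U (\<xi> (y, p))) (\<xi> (z, q)) =
      (if path_range G (y, p) = x \<and> length q = length p + m
       then cinner (T (\<xi> (y, p))) (\<xi> (z, q)) else 0)"
    proof
      fix m
      show "\<exists>U\<in>S. \<forall>y p z q. (y, p) \<in> paths \<longrightarrow> (z, q) \<in> paths \<longrightarrow>
        cinner (blinfun_apply U (\<xi> (y, p))) (\<xi> (z, q)) =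
        (if path_range G (y, p) = x \<and> length q = length p + m
         then cinner (T (\<xi> (y, p))) (\<xi> (z, q)) else 0)"
        by (rule homogeneous_part[OF T x, of m]) blast
    qed
    then show ?thesis
      using that by metis
  qed
  define c where "c = (\<lambda>n (v::('v, 'e) path) (w::('v, 'e) path). real (min (length (snd v)) (length (snd w)) + Suc n
      - max (length (snd v)) (length (snd w))) / real (Suc n))"
  define K where "K = (\<lambda>n. \<Sum>m<Suc n. (1 - real m / real (Suc n)) *\<^sub>R Tm m)"
  have KS: "K n \<in> S" for n
    unfolding K_def by (intro sum_in scaleR_in Tm)
  have U_entry: "cinner (?U (\<xi> (y, p))) (\<xi> (z, q)) =
      (if path_range G (y, p) = x then cinner (T (\<xi> (y, p))) (\<xi> (z, q)) else 0)"
    if "(y, p) \<in> paths" for y p z q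
    using that by (simp add: range_proj_basis)
  have K_entry: "cinner (K n (\<xi> v)) (\<xi> w) = complex_of_real (c n v w) * cinner (?U (\<xi> v)) (\<xi> w)"
    if v: "v \<in> paths" and w: "w \<in> paths" for n v w
  proof -
    obtain y p z q where yz: "v = (y, p)" "w = (z, q)" "(y, p) \<in> paths" "(z, q) \<in> paths"
      using v w by (metis prod.exhaust)
    let ?a = "cinner (T (\<xi> (y, p))) (\<xi> (z, q))"
    let ?r = "\<lambda>m. complex_of_real (1 - real m / real (Suc n))"
    have "cinner (K n (\<xi> (y, p))) (\<xi> (z, q)) =
        (\<Sum>m<Suc n. ?r m * (if path_range G (y, p) = x \<and> length q = length p + m then ?a else 0))"
      unfolding K_def blinfun.sum_left cinner_sum_left
      by (intro sum.cong refl) (simp only: blinfun.scaleR_left cinner_scaleR_left entries[OF yz(3,4)])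
    also have "\<dots> = complex_of_real (c n v w) * cinner (?U (\<xi> (y, p))) (\<xi> (z, q))"
    proof (cases "path_range G (y, p) = x \<and> length p \<le> length q")
      case True
      let ?m = "length q - length p"
      have c: "c n v w = (if ?m < Suc n then 1 - real ?m / real (Suc n) else 0)"
        using True by (auto simp: c_def yz(1,2) of_nat_diff divide_simps)
      have "(\<Sum>m<Suc n. ?r m * (if path_range G (y, p) = x \<and> length q = length p + m then ?a else 0)) =
        (\<Sum>m<Suc n. if m = ?m then ?r m * ?a else 0)"
        using True by (intro sum.cong) auto
      also have "\<dots> = (if ?m < Suc n then ?r ?m * ?a else 0)"
        by (simp only: sum.delta finite_lessThan lessThan_iff)
      also have "\<dots> = complex_of_real (c n v w) * ?a"
        unfolding c by (simp only: if_distrib[of complex_of_real] if_distribR of_real_0 mult_zero_left split: if_split) simp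
      finally show ?thesis
        using True U_entry[OF yz(3)] by simp
    next
      case False
      have z: "(if path_range G (y, p) = x then ?a else 0) = 0"
      proof (cases "path_range G (y, p) = x")
        case True
        then have "\<not> (z = y \<and> (\<exists>s. q = p @ s))"
          using False by auto
        then show ?thesis
          using entry_zero[OF T yz(3,4)] by simp
      qed simp
      have "(\<Sum>m<Suc n. ?r m * (if path_range G (y, p) = x \<and> length q = length p + m then ?a else 0)) = 0"
        using z by (intro sum.neutral) (auto split: if_splits)
      then show ?thesis
        using U_entry[OF yz(3)] z by simp
    qed
    finally show ?thesis
      by (simp only: yz(1,2))
  qed
  have K_norm: "norm (K n) \<le> norm ?U" for n
    by (rule fejer_multiplier_bound[OF U, where n = "Suc n" and d = "\<lambda>w. length (snd w)"])
       (use KS SB K_entry in \<open>auto simp: c_def\<close>)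
  have lim: "(\<lambda>n. cinner (K n h) k) \<longlonglongrightarrow> cinner (?U h) k" for h k
  proof (rule wot_limit_of_entries[OF _ K_norm U])
    show "K n \<in> bounded_operators" for n
      using KS SB by auto
    fix v w assume v: "v \<in> paths" and w: "w \<in> paths"
    define a where "a = min (length (snd v)) (length (snd w))"
    define b where "b = max (length (snd v)) (length (snd w))"
    have "\<forall>\<^sub>F n in sequentially. c n v w = 1 - (real b - real a) / real (Suc n)"
      unfolding eventually_sequentially
    proof (intro exI allI impI)
      fix n assume "b \<le> n"
      then show "c n v w = 1 - (real b - real a) / real (Suc n)"
        by (simp add: c_def of_nat_diff divide_simps flip: a_def b_def)
    qed
    moreover have "(\<lambda>n. 1 - (real b - real a) / real (Suc n)) \<longlonglongrightarrow> 1 - 0"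
      by (intro tendsto_intros LIMSEQ_Suc lim_const_over_n)
    ultimately have "(\<lambda>n. c n v w) \<longlonglongrightarrow> 1"
      by (simp add: filterlim_cong)
    then have "(\<lambda>n. complex_of_real (c n v w) * cinner (?U (\<xi> v)) (\<xi> w)) \<longlonglongrightarrow>
        complex_of_real 1 * cinner (?U (\<xi> v)) (\<xi> w)"
      by (intro tendsto_intros)
    then show "(\<lambda>n. cinner (K n (\<xi> v)) (\<xi> w)) \<longlonglongrightarrow> cinner (?U (\<xi> v)) (\<xi> w)"
      using K_entry[OF v w] by simp
  qed
  show ?thesis
    by (rule wot_closed_limit[OF closed _ _ U lim]) (simp_all add: KS)
qed

text \<open>\<open>T\<close> is the limit of \<open>T P\<^sub>X\<close> along the finite sets \<open>X\<close> of vertices.\<close>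

lemma commutant_in:
  assumes T: "T \<in> right_commutant"
  shows "T \<in> S"
proof -
  have TB: "T \<in> bounded_operators"
    by (rule right_commutant_bounded[OF T])
  define P where "P = (\<lambda>X. coord_proj {v. path_range G v \<in> X})"
  have sum: "T o\<^sub>L P X = (\<Sum>x\<in>X. T o\<^sub>L range_proj x)" if "finite X" for X
    using that
    by (intro operators_eqI)
       (auto simp: P_def blinfun.sum_left range_proj_basis coord_proj_basis if_distrib
         intro!: bounded_operators_compose bounded_operators_sum TB cong: if_cong)
  have norm: "norm (T o\<^sub>L P X) \<le> norm T" for X
  proof -
    have "norm (T o\<^sub>L P X) \<le> norm T * norm (P X)"
      by (rule norm_blinfun_compose)
    also have "\<dots> \<le> norm T * 1"
      unfolding P_def by (intro mult_left_mono norm_coord_proj norm_ge_zero)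
    finally show ?thesis by simp
  qed
  have B: "T o\<^sub>L P X \<in> bounded_operators" for X
    by (simp add: P_def bounded_operators_compose TB)
  have lim: "((\<lambda>X. cinner ((T o\<^sub>L P X) h) k) \<longlongrightarrow> cinner (T h) k) (finite_subsets_at_top (verts G))" for h k
  proof (rule wot_limit_of_entries[OF B norm TB])
    fix v w assume v: "v \<in> paths" and w: "w \<in> paths"
    have "path_range G v \<in> verts G"
      using v range_in_verts by (cases v) auto
    then have "\<forall>\<^sub>F X in finite_subsets_at_top (verts G). path_range G v \<in> X"
      unfolding eventually_finite_subsets_at_top by (intro exI[of _ "{path_range G v}"]) auto
    then have "\<forall>\<^sub>F X in finite_subsets_at_top (verts G).
        cinner ((T o\<^sub>L P X) (\<xi> v)) (\<xi> w) = cinner (T (\<xi> v)) (\<xi> w)"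
      by (rule eventually_mono) (use v in \<open>simp add: P_def coord_proj_basis\<close>)
    then show "((\<lambda>X. cinner ((T o\<^sub>L P X) (\<xi> v)) (\<xi> w)) \<longlongrightarrow> cinner (T (\<xi> v)) (\<xi> w))
        (finite_subsets_at_top (verts G))"
      by (rule tendsto_eventually)
  qed
  have "\<forall>\<^sub>F X in finite_subsets_at_top (verts G). T o\<^sub>L P X \<in> S"
    by (rule eventually_finite_subsets_at_top_weakI)
       (auto simp: sum intro!: sum_in commutant_vertex_in T)
  then show ?thesis
    by (rule wot_closed_limit[OF closed _ _ TB lim, rotated]) simp
qed

end

theorem algebra_eq_commutant: "free_semigroupoid_algebra G \<xi> = right_commutant"
proof
  show "right_commutant \<subseteq> free_semigroupoid_algebra G \<xi>"
    unfolding free_semigroupoid_algebra_def hull_def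
  proof (intro subsetI InterI, elim CollectE conjE)
    fix T S
    assume T: "T \<in> right_commutant" and S: "operator_algebra S" "closedin weak_operator_topology S"
      and gen: "{T. \<exists>e\<in>arcs G. is_edge_operator G \<xi> e T} \<union>
        {T. \<exists>x\<in>verts G. is_vertex_projection G \<xi> x T} \<subseteq> S"
    show "T \<in> S"
    proof (rule commutant_in[OF S _ _ T])
      show "path_op (tail G e, [e]) \<in> S" if "e \<in> arcs G" for e
        using gen that edge_operator_iff[OF that] by blast
      show "path_op (x, []) \<in> S" if "x \<in> verts G" for x
        using gen that vertex_projection_iff[of x] path_op_Nil[OF that] by blast
    qed
  qed
qed (rule algebra_in_commutant)

end

section \<open>Outer factors\<close>

context fock begin

definition right_path :: "'e list \<Rightarrow> 'h \<Rightarrow> 'h" where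
  "right_path p h = foldr (\<lambda>e. blinfun_apply (right_op e)) p h"

lemma right_path_simps [simp]:
  "right_path [] h = h" "right_path (e # p) h = right_op e (right_path p h)"
  by (simp_all add: right_path_def)

lemma source_proj_source_proj:
  "source_proj x (source_proj y h) = (if x = y then source_proj y h else 0)"
  by (rule vector_eqI) (auto simp: source_proj_def coord_proj_compose cinner_coord_proj)

lemma right_op_source_apply: "e \<in> arcs G \<Longrightarrow> right_op e (source_proj (head G e) h) = right_op e h"
  using right_op_source[of e] by (metis blinfun_apply_blinfun_compose)

lemma source_right_op_apply: "e \<in> arcs G \<Longrightarrow>
    source_proj x (right_op e h) = (if x = tail G e then right_op e h else 0)"
  using source_right_op[of e x] by (metis blinfun_apply_blinfun_compose blinfun.zero_left)

lemma right_adj_right_op_apply: "e \<in> arcs G \<Longrightarrow> f \<in> arcs G \<Longrightarrow>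
    right_adj e (right_op f h) = (if e = f then source_proj (head G e) h else 0)"
  using right_adj_right_op[of e f] by (metis blinfun_apply_blinfun_compose blinfun.zero_left)

context
  fixes A :: "'h \<Rightarrow>\<^sub>L 'h"
  assumes A: "A \<in> right_commutant" and A1: "norm A < 1"
begin

text \<open>The inner product that the operator \<open>1 - A\<^sup>* A\<close> defines. The right creation operators are partial
  isometries with orthogonal ranges for it as well, because they commute with \<open>A\<close>.\<close>

definition defect_form :: "'h \<Rightarrow> 'h \<Rightarrow> complex" where
  "defect_form h k = cinner h k - cinner (blinfun_apply A h) (blinfun_apply A k)"

definition defect :: "'h \<Rightarrow>\<^sub>L 'h" where
  "defect = id_blinfun - (adjoint A o\<^sub>L A)"

lemma A_bounded: "A \<in> bounded_operators"
  by (rule right_commutant_bounded[OF A])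

lemma defect_bounded: "defect \<in> bounded_operators"
  by (simp add: defect_def bounded_operators_diff bounded_operators_compose A_bounded adjoint_bounded)

lemma cinner_defect: "cinner (blinfun_apply defect h) k = defect_form h k"
  by (simp add: defect_def defect_form_def blinfun.diff_left cinner_diff_left cinner_adjoint'[OF A_bounded])

lemma defect_form_cnj: "defect_form k h = cnj (defect_form h k)"
  by (simp add: defect_form_def flip: cinner_commute)

lemma defect_form_self: "defect_form h h = complex_of_real ((norm h)\<^sup>2 - (norm (blinfun_apply A h))\<^sup>2)"
  by (simp add: defect_form_def cinner_self)

lemma defect_form_self_ge: "(1 - (norm A)\<^sup>2) * (norm h)\<^sup>2 \<le> (norm h)\<^sup>2 - (norm (blinfun_apply A h))\<^sup>2"
proof -
  have "(norm (A h))\<^sup>2 \<le> (norm A * norm h)\<^sup>2"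
    by (intro power_mono norm_blinfun norm_ge_zero)
  then show ?thesis
    by (simp add: power_mult_distrib algebra_simps)
qed

lemma defect_form_right_op:
  assumes "e \<in> arcs G" "f \<in> arcs G"
  shows "defect_form (right_op e h) (right_op f k) = (if e = f then defect_form (source_proj (head G e) h) k else 0)"
proof -
  have h: "head G e \<in> verts G"
    using assms by simp
  have "defect_form (right_op e h) (right_op f k)
      = cinner (right_op e h) (right_op f k) - cinner (right_op e (A h)) (right_op f (A k))"
    using assms by (simp add: defect_form_def right_commutant_right[OF A])
  also have "\<dots> = cinner (right_adj f (right_op e h)) k - cinner (right_adj f (right_op e (A h))) (A k)"
    using assms by (simp add: cinner_right_op')
  also have "\<dots> = (if e = f then defect_form (source_proj (head G e) h) k else 0)"
    using assms h by (simp add: right_adj_right_op_apply defect_form_def right_commutant_source[OF A])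
  finally show ?thesis .
qed

text \<open>The vector \<open>(1 - A\<^sup>* A)\<^sup>-\<^sup>1 \<xi> x\<close>, obtained as the fixed point of \<open>g \<mapsto> \<xi> x + A\<^sup>* A g\<close>. For the
  form it is orthogonal to the ranges of all right creation operators, because \<open>\<xi> x\<close> is so for the
  inner product.\<close>

lemma vacuum_solution_exists:
  assumes x: "x \<in> verts G"
  shows "\<exists>g. blinfun_apply defect g = \<xi> (x, []) \<and> blinfun_apply (source_proj x) g = g"
proof -
  let ?M = "adjoint A o\<^sub>L A"
  have "norm ?M \<le> norm A * norm A"
  proof (rule norm_operator_le)
    fix h k
    have "cmod (cinner (?M h) k) \<le> norm (A h) * norm (A k)"
      by (simp add: cinner_adjoint'[OF A_bounded] cmod_cinner_le)
    also have "\<dots> \<le> (norm A * norm h) * (norm A * norm k)"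
      by (intro mult_mono norm_blinfun) auto
    finally show "cmod (cinner (?M h) k) \<le> norm A * norm A * norm h * norm k"
      by (simp add: mult_ac)
  qed simp
  moreover have "norm A * norm A < 1"
    using mult_left_le[of "norm A" "norm A"] A1 norm_ge_zero[of A] by linarith
  ultimately have M1: "norm ?M < 1" by simp
  have uniq: "\<exists>!g. \<xi> (x, []) + ?M g = g"
  proof (rule banach_fix_type[OF norm_ge_zero M1], intro allI)
    fix h k
    show "dist (\<xi> (x, []) + ?M h) (\<xi> (x, []) + ?M k) \<le> norm ?M * dist h k"
      using norm_blinfun[of ?M "h - k"] by (simp add: dist_norm blinfun.diff_right)
  qed
  then obtain g where g: "\<xi> (x, []) + ?M g = g" by auto
  have comm: "?M (source_proj x h) = source_proj x (?M h)" for h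
  proof (rule vector_eqI)
    fix w
    show "cinner (?M (source_proj x h)) (\<xi> w) = cinner (source_proj x (?M h)) (\<xi> w)"
      by (simp add: cinner_adjoint'[OF A_bounded] cinner_source_proj right_commutant_source[OF A x])
  qed
  have "\<xi> (x, []) + ?M (source_proj x g) = source_proj x (\<xi> (x, []) + ?M g)"
    using x comm[of g] by (simp add: blinfun.add_right source_proj_basis)
  then have "\<xi> (x, []) + ?M (source_proj x g) = source_proj x g"
    by (simp only: g)
  then have "source_proj x g = g"
    using uniq g by blast
  moreover have "defect g = \<xi> (x, [])"
    using g by (simp add: defect_def blinfun.diff_left algebra_simps)
  ultimately show ?thesis by auto
qed

definition vacuum_solution :: "'v \<Rightarrow> 'h" where
  "vacuum_solution x = (SOME g. blinfun_apply defect g = \<xi> (x, []) \<and> blinfun_apply (source_proj x) g = g)"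

lemma
  assumes "x \<in> verts G"
  shows defect_vacuum: "blinfun_apply defect (vacuum_solution x) = \<xi> (x, [])"
    and source_vacuum: "blinfun_apply (source_proj x) (vacuum_solution x) = vacuum_solution x"
  using someI_ex[OF vacuum_solution_exists[OF assms]] by (auto simp: vacuum_solution_def)

lemma defect_form_vacuum_left: "x \<in> verts G \<Longrightarrow> defect_form (vacuum_solution x) h = cinner (\<xi> (x, [])) h"
  by (simp add: defect_vacuum flip: cinner_defect)

lemma defect_form_vacuum_right: "x \<in> verts G \<Longrightarrow> defect_form h (vacuum_solution x) = cinner h (\<xi> (x, []))"
  by (metis defect_form_cnj defect_form_vacuum_left cinner_commute)

definition vacuum_norm :: "'v \<Rightarrow> real" where
  "vacuum_norm x = sqrt ((norm (vacuum_solution x))\<^sup>2 - (norm (blinfun_apply A (vacuum_solution x)))\<^sup>2)"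

lemma defect_form_coercive: "0 < 1 - (norm A)\<^sup>2"
  using A1 by (simp add: power_less_one_iff)

lemma vacuum_norm:
  assumes x: "x \<in> verts G"
  shows "vacuum_norm x > 0"
    and "defect_form (vacuum_solution x) (vacuum_solution x) = complex_of_real ((vacuum_norm x)\<^sup>2)"
proof -
  let ?g = "vacuum_solution x"
  have "?g \<noteq> 0"
    using defect_vacuum[OF x] norm_basis[of "(x, [])"] x by auto
  then have "0 < (1 - (norm A)\<^sup>2) * (norm ?g)\<^sup>2"
    using defect_form_coercive by simp
  then have pos: "0 < (norm ?g)\<^sup>2 - (norm (A ?g))\<^sup>2"
    using defect_form_self_ge[of ?g] by linarith
  then show "vacuum_norm x > 0"
    by (simp add: vacuum_norm_def)
  have "(vacuum_norm x)\<^sup>2 = (norm ?g)\<^sup>2 - (norm (A ?g))\<^sup>2"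
    unfolding vacuum_norm_def by (rule real_sqrt_pow2[OF less_imp_le[OF pos]])
  then show "defect_form ?g ?g = complex_of_real ((vacuum_norm x)\<^sup>2)"
    by (simp only: defect_form_self)
qed

lemma source_right_path:
  assumes "(x, p) \<in> paths"
  shows "blinfun_apply (source_proj x) (right_path p (vacuum_solution (path_range G (x, p)))) =
    right_path p (vacuum_solution (path_range G (x, p)))"
  using assms by (cases p) (simp_all add: source_vacuum source_right_op_apply)

text \<open>Common right creation operators cancel by \<open>defect_form_right_op\<close>; what remains is the orthogonality
  of vacuum vectors to each other and to the ranges of the right creation operators.\<close>

lemma defect_form_right_path:
  "(x, p) \<in> paths \<Longrightarrow> (z, q) \<in> paths \<Longrightarrow>
    defect_form (right_path p (vacuum_solution (path_range G (x, p))))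
         (right_path q (vacuum_solution (path_range G (z, q)))) =
      (if x = z \<and> p = q then complex_of_real ((vacuum_norm (path_range G (x, p)))\<^sup>2) else 0)"
proof (induction p arbitrary: x z q)
  case Nil
  then have x: "x \<in> verts G" by simp
  show ?case
  proof (cases q)
    case q: Nil
    then have z: "z \<in> verts G"
      using Nil by simp
    show ?thesis
    proof (cases "x = z")
      case True
      then show ?thesis
        using q vacuum_norm(2)[OF x] by simp
    next
      case False
      have "cinner (vacuum_solution x) (\<xi> (z, [])) = cinner (source_proj x (vacuum_solution x)) (\<xi> (z, []))"
        by (simp add: source_vacuum[OF x])
      also have "\<dots> = 0"
        using False z by (simp only: cinner_source_proj) (simp add: source_proj_basis)
      finally show ?thesis
        using False q z by (simp add: defect_form_vacuum_right)
    qed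
  next
    case (Cons f q')
    then show ?thesis
      using Nil by (simp add: defect_form_vacuum_left cinner_right_op'[symmetric] right_adj_basis)
  qed
next
  case (Cons e p)
  then have e: "e \<in> arcs G" "x = tail G e" "(head G e, p) \<in> paths"
    by auto
  show ?case
  proof (cases q)
    case Nil
    then show ?thesis
      using Cons.prems e by (simp add: defect_form_vacuum_right cinner_right_op right_adj_basis)
  next
    case q: (Cons f q')
    then have f: "f \<in> arcs G" "z = tail G f" "(head G f, q') \<in> paths"
      using Cons.prems by auto
    show ?thesis
    proof (cases "e = f")
      case True
      then show ?thesis
        using e f q Cons.IH[OF e(3) f(3)] source_right_path[OF e(3)]
        by (simp add: range_Cons defect_form_right_op)
    next
      case False
      then show ?thesis
        using e f q by (simp add: defect_form_right_op)
    qed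
  qed
qed

definition defect_basis :: "('v, 'e) path \<Rightarrow> 'h" where
  "defect_basis w = (1 / vacuum_norm (path_range G w)) *\<^sub>R
     right_path (snd w) (vacuum_solution (path_range G w))"

lemma form_scaleR: "defect_form (a *\<^sub>R h) (b *\<^sub>R k) = complex_of_real (a * b) * defect_form h k"
  by (simp add: defect_form_def blinfun.scaleR_right cinner_simps right_diff_distrib mult.assoc)

lemma defect_basis_orthonormal:
  assumes v: "v \<in> paths" and w: "w \<in> paths"
  shows "defect_form (defect_basis v) (defect_basis w) = (if v = w then 1 else 0)"
proof -
  obtain x p z q where *: "v = (x, p)" "w = (z, q)" by fastforce
  have "vacuum_norm (path_range G v) > 0"
    using v * vacuum_norm(1) range_in_verts by simp
  then show ?thesis
    using defect_form_right_path[of x p z q] v w *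
    by (auto simp: defect_basis_def form_scaleR power2_eq_square)
qed

lemma source_defect_basis:
  assumes "(y, p) \<in> paths"
  shows "blinfun_apply (source_proj x) (defect_basis (y, p)) = (if x = y then defect_basis (y, p) else 0)"
proof -
  have *: "source_proj y (defect_basis (y, p)) = defect_basis (y, p)"
    using source_right_path[OF assms] by (simp add: defect_basis_def blinfun.scaleR_right)
  show ?thesis
    using source_proj_source_proj[of x y "defect_basis (y, p)"] by (simp add: *)
qed

lemma right_op_defect_basis:
  assumes "e \<in> arcs G" "(y, p) \<in> paths"
  shows "blinfun_apply (right_op e) (defect_basis (y, p)) =
    (if y = head G e then defect_basis (tail G e, e # p) else 0)"
proof (cases "y = head G e")
  case True
  then show ?thesis
    using assms by (simp add: defect_basis_def range_Cons blinfun.scaleR_right)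
next
  case False
  then have "right_op e (source_proj (head G e) (defect_basis (y, p))) = 0"
    using assms by (simp add: source_defect_basis)
  then show ?thesis
    using False by (simp only: right_op_source_apply[OF assms(1)]) simp
qed

text \<open>The form is coercive, so a system that is orthonormal for it obeys an \<open>\<ell>\<^sup>2\<close> bound for the norm.\<close>

lemma defect_basis_operator_exists:
  obtains E where "E \<in> bounded_operators" "\<And>w. w \<in> paths \<Longrightarrow> blinfun_apply E (\<xi> w) = defect_basis w"
proof -
  define \<delta> where "\<delta> = 1 - (norm A)\<^sup>2"
  have \<delta>: "\<delta> > 0"
    using defect_form_coercive by (simp add: \<delta>_def)
  have le: "(norm (\<Sum>w\<in>F. c w *\<^sub>C defect_basis w))\<^sup>2 \<le> (sqrt (1/\<delta>))\<^sup>2 * (\<Sum>w\<in>F. (cmod (c w))\<^sup>2)"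
    if F: "finite F" "F \<subseteq> paths" for F c
  proof -
    let ?h = "\<Sum>w\<in>F. c w *\<^sub>C defect_basis w"
    have "defect_form ?h ?h = (\<Sum>v\<in>F. \<Sum>w\<in>F. c v * (cnj (c w) * defect_form (defect_basis v) (defect_basis w)))"
      by (simp add: blinfun.sum_right bounded_operators_scaleC[OF defect_bounded] cinner_sum_left
          cinner_sum_right cinner_simps sum_distrib_left flip: cinner_defect)
        (subst sum.swap, simp add: mult.left_commute)
    also have "\<dots> = (\<Sum>v\<in>F. \<Sum>w\<in>F. if v = w then c v * cnj (c v) else 0)"
    proof (intro sum.cong refl)
      fix v w assume "v \<in> F" "w \<in> F"
      then have "v \<in> paths" "w \<in> paths"
        using F by auto
      then show "c v * (cnj (c w) * defect_form (defect_basis v) (defect_basis w)) = (if v = w then c v * cnj (c v) else 0)"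
        by (simp add: defect_basis_orthonormal)
    qed
    also have "\<dots> = (\<Sum>v\<in>F. c v * cnj (c v))"
      using F by simp
    also have "\<dots> = complex_of_real (\<Sum>w\<in>F. (cmod (c w))\<^sup>2)"
      unfolding of_real_sum complex_norm_square ..
    finally have "(norm ?h)\<^sup>2 - (norm (A ?h))\<^sup>2 = (\<Sum>w\<in>F. (cmod (c w))\<^sup>2)"
      unfolding defect_form_self of_real_eq_iff .
    then have "\<delta> * (norm ?h)\<^sup>2 \<le> (\<Sum>w\<in>F. (cmod (c w))\<^sup>2)"
      using defect_form_self_ge[of ?h] by (simp add: \<delta>_def)
    then show ?thesis
      using \<delta> by (simp add: field_simps)
  qed
  show ?thesis
  proof (rule operator_exists[of "sqrt (1/\<delta>)" defect_basis])
    fix T :: "'h \<Rightarrow>\<^sub>L 'h"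
    assume "T \<in> bounded_operators" "\<And>w. w \<in> paths \<Longrightarrow> blinfun_apply T (\<xi> w) = defect_basis w"
    then show thesis by (rule that)
  qed (use \<delta> in \<open>simp_all only: le real_sqrt_ge_zero zero_le_divide_1_iff less_imp_le\<close>)
qed

text \<open>The translates of the vacuum vectors are complete. A vector \<open>k\<close> that is orthogonal to all of them for
  the form has no components at vertices, and therefore stripping an edge from \<open>k\<close> gives a vector with
  the same property. So all coefficients of \<open>k\<close> vanish, by induction on the length of the path.\<close>

lemma defect_form_right_path_complete:
  "(x, p) \<in> paths \<Longrightarrow>
    (\<And>z q. (z, q) \<in> paths \<Longrightarrow> defect_form k (right_path q (vacuum_solution (path_range G (z, q)))) = 0) \<Longrightarrow>
    cinner k (\<xi> (x, p)) = 0"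
proof (induction p arbitrary: x k)
  case Nil
  then show ?case
    using Nil.prems(2)[of x "[]"] by (simp add: defect_form_vacuum_right)
next
  case (Cons e p)
  then have e: "e \<in> arcs G" "x = tail G e" "(head G e, p) \<in> paths"
    by auto
  have vacuum: "cinner k (\<xi> (z, [])) = 0" if "z \<in> verts G" for z
    using Cons.prems(2)[of z "[]"] that by (simp add: defect_form_vacuum_right)
  \<comment> \<open>The adjoint of a right creation operator commutes with \<open>A\<close> away from the vertex vectors.\<close>
  have "((right_adj e o\<^sub>L A) - (A o\<^sub>L right_adj e)) k = 0"
  proof (rule operator_vanishes)
    show "(right_adj e o\<^sub>L A) - (A o\<^sub>L right_adj e) \<in> bounded_operators"
      using e by (simp add: bounded_operators_diff bounded_operators_compose A_bounded)
    fix w assume w: "w \<in> paths" "cinner k (\<xi> w) \<noteq> 0"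
    obtain z q where zq: "w = (z, q)" by fastforce
    with w vacuum have "q \<noteq> []" by auto
    then obtain f q' where q: "q = f # q'" by (cases q) auto
    have f: "f \<in> arcs G" "z = tail G f" "(head G f, q') \<in> paths"
      using w zq q by auto
    have "\<xi> w = right_op f (\<xi> (head G f, q'))"
      using f by (simp add: right_op_basis zq q)
    then have "right_adj e (A (\<xi> w)) = (if e = f then source_proj (head G e) (A (\<xi> (head G f, q'))) else 0)"
      using e f by (simp add: right_commutant_right[OF A] right_adj_right_op_apply)
    also have "\<dots> = (if e = f then A (\<xi> (head G f, q')) else 0)"
      using e f by (simp add: source_proj_basis flip: right_commutant_source[OF A])
    also have "\<dots> = A (right_adj e (\<xi> w))"
      using w e by (auto simp: right_adj_basis zq q)
    finally show "((right_adj e o\<^sub>L A) - (A o\<^sub>L right_adj e)) (\<xi> w) = 0"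
      by (simp add: blinfun.diff_left)
  qed
  then have "right_adj e (A k) = A (right_adj e k)"
    by (simp add: blinfun.diff_left)
  note comm = this[symmetric]
  have shift: "defect_form (right_adj e k) h = defect_form k (right_op e h)" for h
    using e by (simp add: defect_form_def comm cinner_right_op' right_commutant_right[OF A])
  have "cinner (right_adj e k) (\<xi> (head G e, p)) = 0"
  proof (rule Cons.IH[OF e(3)])
    fix z q assume zq: "(z, q) \<in> paths"
    let ?h = "right_path q (vacuum_solution (path_range G (z, q)))"
    show "defect_form (right_adj e k) ?h = 0"
    proof (cases "z = head G e")
      case True
      then show ?thesis
        using Cons.prems(2)[of "tail G e" "e # q"] e zq by (simp add: shift range_Cons)
    next
      case False
      have "right_op e ?h = right_op e (source_proj (head G e) (source_proj z ?h))"
        using e by (simp add: right_op_source_apply source_right_path[OF zq])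
      also have "\<dots> = 0"
        using False by (simp add: source_proj_source_proj)
      finally show ?thesis
        by (simp only: shift) (simp add: defect_form_def)
    qed
  qed
  then show ?case
    using e by (simp add: cinner_right_op' right_op_basis)
qed

text \<open>The operator \<open>E\<close> carries the basis \<open>\<xi>\<close> to the basis of the form, and \<open>D = E\<^sup>* (1 - A\<^sup>* A)\<close> is its
  inverse: \<open>D E = 1\<close> by orthonormality, \<open>E D = 1\<close> by completeness.\<close>

lemma outer_factor_exists:
  "\<exists>D\<in>right_commutant. \<forall>h. (norm (blinfun_apply D h))\<^sup>2 = (norm h)\<^sup>2 - (norm (blinfun_apply A h))\<^sup>2"
proof -
  obtain E where E: "E \<in> bounded_operators" "\<And>w. w \<in> paths \<Longrightarrow> blinfun_apply E (\<xi> w) = defect_basis w"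
    using defect_basis_operator_exists by auto
  have EC: "E \<in> right_commutant"
    by (rule right_commutantI_basis)
       (auto simp: E right_op_basis source_proj_basis right_op_defect_basis source_defect_basis)
  define D where "D = adjoint E o\<^sub>L defect"
  have DB: "D \<in> bounded_operators"
    by (simp add: D_def bounded_operators_compose adjoint_bounded E defect_bounded)
  have D_inner: "cinner (D h) k = defect_form h (E k)" for h k
    by (simp add: D_def cinner_adjoint'[OF E(1)] cinner_defect)
  have "D o\<^sub>L E = id_blinfun"
  proof (rule operator_eqI)
    fix v assume v: "v \<in> paths"
    show "(D o\<^sub>L E) (\<xi> v) = id_blinfun (\<xi> v)"
      by (rule vector_eqI) (simp add: D_inner E v defect_basis_orthonormal cinner_basis)
  qed (simp_all add: bounded_operators_compose DB E)
  then have DE: "D (E h) = h" for h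
    by (metis blinfun_apply_blinfun_compose id_blinfun.rep_eq id_apply)
  have ED: "E (D h) = h" for h
  proof -
    define k where "k = h - E (D h)"
    have Dk: "D k = 0"
      by (simp add: k_def blinfun.diff_right DE)
    have form0: "defect_form k (right_path q (vacuum_solution (path_range G (z, q)))) = 0" if zq: "(z, q) \<in> paths" for z q
    proof -
      let ?c = "vacuum_norm (path_range G (z, q))"
      have c: "?c > 0"
        using vacuum_norm(1) range_in_verts[OF zq] by simp
      have "defect_form k (defect_basis (z, q)) = 0"
        using D_inner[of k "\<xi> (z, q)"] zq by (simp add: Dk E)
      then have "defect_form (1 *\<^sub>R k) ((1 / ?c) *\<^sub>R right_path q (vacuum_solution (path_range G (z, q)))) = 0"
        by (simp add: defect_basis_def)
      then show ?thesis
        using c by (simp only: form_scaleR) simp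
    qed
    have "k = 0"
    proof (rule vector_eqI)
      fix w assume w: "w \<in> paths"
      obtain x p where xp: "w = (x, p)" by fastforce
      have "cinner k (\<xi> (x, p)) = 0"
        by (rule defect_form_right_path_complete[OF _ form0]) (use w xp in simp_all)
      then show "cinner k (\<xi> w) = cinner 0 (\<xi> w)"
        by (simp add: xp)
    qed
    then show ?thesis
      by (simp add: k_def)
  qed
  show ?thesis
  proof (intro bexI allI)
    fix h
    have "complex_of_real ((norm (D h))\<^sup>2) = defect_form h h"
      by (simp only: cinner_self[symmetric] D_inner ED)
    then show "(norm (D h))\<^sup>2 = (norm h)\<^sup>2 - (norm (A h))\<^sup>2"
      unfolding defect_form_self of_real_eq_iff .
  next
    show "D \<in> right_commutant"
    proof (rule right_commutantI[OF DB])
      fix e h assume e: "e \<in> arcs G"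
      have "D (right_op e (E (D h))) = right_op e (D h)"
        using right_commutant_right[OF EC e, of "D h"] by (metis DE)
      then show "D (right_op e h) = right_op e (D h)"
        by (simp add: ED)
    next
      fix x h assume x: "x \<in> verts G"
      have "D (source_proj x (E (D h))) = source_proj x (D h)"
        using right_commutant_source[OF EC x, of "D h"] by (metis DE)
      then show "D (source_proj x h) = source_proj x (D h)"
        by (simp add: ED)
    qed
  qed
qed

end

end

section \<open>Isometries with orthogonal ranges\<close>

text \<open>A greedy choice of distinct representatives.\<close>

lemma injective_choice:
  fixes R :: "nat \<Rightarrow> 'a set"
  shows "\<exists>g. \<forall>n. infinite (R n) \<longrightarrow> g n \<in> R n \<and> g n \<notin> g ` {..<n}"
proof (rule dependent_wellorder_choice)
  fix r :: 'a and f g :: "nat \<Rightarrow> 'a" and n :: nat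
  assume "\<And>y. y < n \<Longrightarrow> f y = g y"
  then have "f ` {..<n} = g ` {..<n}" by (intro image_cong) auto
  then show "(infinite (R n) \<longrightarrow> r \<in> R n \<and> r \<notin> f ` {..<n}) = (infinite (R n) \<longrightarrow> r \<in> R n \<and> r \<notin> g ` {..<n})"
    by simp
next
  fix n :: nat and f :: "nat \<Rightarrow> 'a"
  show "\<exists>r. infinite (R n) \<longrightarrow> r \<in> R n \<and> r \<notin> f ` {..<n}"
  proof (cases "infinite (R n)")
    case True
    then have "infinite (R n - f ` {..<n})" by simp
    then have "R n - f ` {..<n} \<noteq> {}" by (metis finite.emptyI)
    then show ?thesis by blast
  qed simp
qed

lemma append_ends_eq: "x @ a = y @ b \<Longrightarrow> length a = length b \<Longrightarrow> a = b"
  by simp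

text \<open>Compare the two words from their right ends: the first block \<open>a\<close> of one would face a block \<open>b\<close> of
  the other if the numbers of blocks \<open>b\<close> differed.\<close>

lemma block_code:
  assumes "length a = length b" "a \<noteq> b"
  shows "s @ a @ concat (replicate j b) = s' @ a @ concat (replicate k b) \<Longrightarrow> j = k"
proof (induction j arbitrary: k)
  case 0
  show ?case
  proof (cases k)
    case (Suc k')
    then have "s @ a = (s' @ a @ concat (replicate k' b)) @ b"
      using 0 by (simp flip: replicate_append_same)
    then have "a = b"
      using assms(1) by (rule append_ends_eq)
    then show ?thesis
      using assms(2) by simp
  qed simp
next
  case (Suc j)
  show ?case
  proof (cases k)
    case 0
    then have "(s @ a @ concat (replicate j b)) @ b = s' @ a"
      using Suc.prems by (simp flip: replicate_append_same)
    then have "b = a"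
      using assms(1)[symmetric] by (rule append_ends_eq)
    then show ?thesis
      using assms(2) by simp
  next
    case k: (Suc k')
    then have "(s @ a @ concat (replicate j b)) @ b = (s' @ a @ concat (replicate k' b)) @ b"
      using Suc.prems by (simp flip: replicate_append_same)
    then show ?thesis
      using Suc.IH[of k'] k by simp
  qed
qed

context wf_digraph begin

lemma saturation_sel [simp]: "tail (saturation G x) = tail G" "head (saturation G x) = head G"
  by (simp_all add: saturation_def)

lemma cas_saturation: "pre_digraph.cas (saturation G x) u p v = cas u p v"
  by (induction p arbitrary: u) (simp_all add: pre_digraph.cas.simps)

lemma saturation_arc:
  assumes "e \<in> arcs (saturation G x)"
  shows "e \<in> arcs G" "\<exists>p. awalk x p (tail G e)"
proof -
  obtain p y where p: "awalk x p y" "e \<in> set p"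
    using assms by (auto simp: saturation_def free_semigroupoid_def)
  then obtain p1 p2 where "p = p1 @ e # p2"
    by (auto dest: split_list)
  then have "e \<in> arcs G" "awalk x p1 (tail G e)"
    using p by (auto simp: awalk_Cons_iff)
  then show "e \<in> arcs G" "\<exists>p. awalk x p (tail G e)" by auto
qed

lemma saturation_loop:
  assumes "loop_at (saturation G x) y p"
  shows "awalk y p y" "\<exists>t. awalk x t y"
proof -
  have p: "p \<noteq> []" "set p \<subseteq> arcs (saturation G x)" "cas y p y"
    using assms by (auto simp: loop_at_def pre_digraph.awalk_def cas_saturation)
  then obtain e q where e: "p = e # q" "tail G e = y"
    by (cases p) auto
  have arcs: "set p \<subseteq> arcs G"
    using p saturation_arc(1) by blast
  then have "y \<in> verts G"
    using e by auto
  then show "awalk y p y"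
    using p arcs by (simp add: awalk_def)
  show "\<exists>t. awalk x t y"
    using saturation_arc(2)[of e x] p e by auto
qed

text \<open>If the loops \<open>u\<close>, \<open>v\<close> do not commute as words, take \<open>u v\<close> and \<open>v u\<close>; if they commute, they are
  powers of a common word, which is again a loop.\<close>

lemma distinct_loops_of_equal_length:
  assumes "has_two_distinct_loops (saturation G x)"
  shows "\<exists>z t a b. awalk x t z \<and> awalk z a z \<and> awalk z b z \<and> length a = length b \<and> a \<noteq> b"
proof -
  obtain y u v where u: "loop_at (saturation G x) y u" and v: "loop_at (saturation G x) y v"
    and not: "\<not> (\<exists>z c m n. loop_at (saturation G x) z c \<and>
      u = concat (replicate m c) \<and> v = concat (replicate n c))"
    using assms unfolding has_two_distinct_loops_def by blast
  have "u @ v \<noteq> v @ u"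
  proof
    assume "u @ v = v @ u"
    then obtain m n c where c: "concat (replicate m c) = u" "concat (replicate n c) = v"
      using comm_append_are_replicate by blast
    have u': "u \<noteq> []" "y \<in> verts (saturation G x)" "set u \<subseteq> arcs (saturation G x)" "cas y u y"
      using u by (auto simp: loop_at_def pre_digraph.awalk_def cas_saturation)
    have cne: "c \<noteq> []"
      using u'(1) c(1) by auto
    obtain m' where m': "m = Suc m'"
      using u'(1) c(1) by (cases m) auto
    then have uc: "u = c @ concat (replicate m' c)"
      using c(1) by simp
    have cas: "cas y c (awlast y c)" "cas (awlast y c) (concat (replicate m' c)) y"
      using u'(4) unfolding uc by simp_all
    have "awlast y c = y"
    proof (cases m')
      case 0
      then show ?thesis using cas by simp
    next
      case (Suc m'')
      then show ?thesis using cas cne by (cases c) auto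
    qed
    then have "loop_at (saturation G x) y c"
      using cas u' uc cne by (simp add: loop_at_def pre_digraph.awalk_def cas_saturation)
    then show False
      using not c by metis
  qed
  moreover have "awalk y (u @ v) y" "awalk y (v @ u) y"
    using saturation_loop(1)[OF u] saturation_loop(1)[OF v] awalk_appendI by blast+
  moreover obtain t where "awalk x t y"
    using saturation_loop(2)[OF u] by blast
  moreover have "length (u @ v) = length (v @ u)" by simp
  ultimately show ?thesis by blast
qed

lemma infinite_reach:
  assumes "has_infinite_proper_path (saturation G x)"
  shows "infinite {z. \<exists>p. awalk x p z}"
proof -
  obtain e :: "nat \<Rightarrow> 'b" where e: "\<And>i. e i \<in> arcs (saturation G x)" "inj (\<lambda>i. tail G (e i))"
    using assms unfolding has_infinite_proper_path_def by auto
  have "range (\<lambda>i. tail G (e i)) \<subseteq> {z. \<exists>p. awalk x p z}"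
    using saturation_arc(2)[OF e(1)] by auto
  then show ?thesis
    using range_inj_infinite[OF e(2)] finite_subset by blast
qed

text \<open>Every vertex starts two paths such that no path of the whole family is a right end of another one
  with the same range. Where two distinct loops \<open>a\<close>, \<open>b\<close> of equal length can be reached, the paths
  traverse \<open>a\<close> and then \<open>b\<close>, with a different number of repetitions of \<open>b\<close> for each of them. Elsewhere
  infinitely many vertices can be reached, and the paths are distinguished by their ranges.\<close>

lemma suffix_code:
  assumes count: "countable (verts G)" and uapp: "uniform_aperiodic_path_property G"
  obtains u r where "\<And>x i. x \<in> verts G \<Longrightarrow> awalk x (u x i) (r x i)"
    "\<And>x y i j q. x \<in> verts G \<Longrightarrow> y \<in> verts G \<Longrightarrow> u x i = q @ u y j \<Longrightarrow> r x i = r y j \<Longrightarrow>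
      x = y \<and> i = (j::bool)"
proof -
  obtain f :: "'a \<Rightarrow> nat" where f: "inj_on f (verts G)"
    using count by (auto simp: countable_def)
  \<comment> \<open>A number for each path that has to be chosen.\<close>
  define N where "N = (\<lambda>x (i::bool). 2 * f x + (if i then 1 else 0))"
  have N: "x = y \<and> i = j" if "x \<in> verts G" "y \<in> verts G" "N x i = N y j" for x y i j
  proof -
    have "even (N x i) \<longleftrightarrow> \<not> i" "even (N y j) \<longleftrightarrow> \<not> j"
      by (auto simp: N_def)
    then have "i = j" using that by auto
    then have "f x = f y" using that by (auto simp: N_def)
    then show ?thesis
      using \<open>i = j\<close> f that by (auto dest: inj_onD)
  qed
  define R where "R = (\<lambda>x. {z. \<exists>p. awalk x p z})"
  define double where "double = (\<lambda>z. \<exists>a b. awalk z a z \<and> awalk z b z \<and> length a = length b \<and> a \<noteq> b)"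
  define D where "D = {x. \<exists>z\<in>R x. double z}"
  have inf: "infinite (R x)" if "x \<in> verts G" "x \<notin> D" for x
    using uapp that distinct_loops_of_equal_length[of x] infinite_reach[of x]
    unfolding uniform_aperiodic_path_property_def D_def R_def double_def by blast
  have "\<forall>z. \<exists>a b. double z \<longrightarrow> awalk z a z \<and> awalk z b z \<and> length a = length b \<and> a \<noteq> b"
    unfolding double_def by blast
  then obtain a b where ab: "\<And>z. double z \<Longrightarrow>
      awalk z (a z) z \<and> awalk z (b z) z \<and> length (a z) = length (b z) \<and> a z \<noteq> b z"
    by metis
  have "\<forall>x. \<exists>z t. x \<in> D \<longrightarrow> awalk x t z \<and> double z"
    unfolding D_def R_def by blast
  then obtain z t where zt: "\<And>x. x \<in> D \<Longrightarrow> awalk x (t x) (z x) \<and> double (z x)"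
    by metis
  obtain g where g: "\<And>n. infinite (\<Union>x\<in>{x \<in> verts G. \<exists>i. N x i = n}. R x) \<Longrightarrow>
      g n \<in> (\<Union>x\<in>{x \<in> verts G. \<exists>i. N x i = n}. R x) \<and> g n \<notin> g ` {..<n}"
    using injective_choice[of "\<lambda>n. \<Union>x\<in>{x \<in> verts G. \<exists>i. N x i = n}. R x"] by blast
  have UN: "(\<Union>y\<in>{y \<in> verts G. \<exists>j. N y j = N x i}. R y) = R x" if "x \<in> verts G" for x i
  proof -
    have "{y \<in> verts G. \<exists>j. N y j = N x i} = {x}"
      using that N by blast
    then show ?thesis by simp
  qed
  have g1: "g (N x i) \<in> R x \<and> g (N x i) \<notin> g ` {..<N x i}" if "x \<in> verts G" "x \<notin> D" for x i
    using g[of "N x i"] inf[OF that] unfolding UN[OF that(1)] by blast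
  have "\<forall>x i. \<exists>p. x \<in> verts G \<longrightarrow> x \<notin> D \<longrightarrow> awalk x p (g (N x i))"
    using g1 unfolding R_def by blast
  then obtain p where p: "\<And>x i. x \<in> verts G \<Longrightarrow> x \<notin> D \<Longrightarrow> awalk x (p x i) (g (N x i))"
    by metis
  define u where "u = (\<lambda>x i. if x \<in> D then t x @ a (z x) @ concat (replicate (N x i) (b (z x))) else p x i)"
  define r where "r = (\<lambda>x i. if x \<in> D then z x else g (N x i))"
  have rep: "awalk y (concat (replicate n (b y))) y" if "double y" for y n
  proof (induction n)
    case 0
    have "y \<in> verts G"
      using ab[OF that] by blast
    then show ?case by (simp add: awalk_Nil_iff)
  next
    case (Suc n)
    then show ?case
      using ab[OF that] awalk_appendI[of y "b y" y "concat (replicate n (b y))" y] by simp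
  qed
  show ?thesis
  proof
    fix x i assume x: "x \<in> verts G"
    show "awalk x (u x i) (r x i)"
    proof (cases "x \<in> D")
      case True
      have "awalk x (t x @ a (z x) @ concat (replicate (N x i) (b (z x)))) (z x)"
        using zt[OF True] ab[of "z x"] rep[of "z x" "N x i"] by (intro awalk_appendI) auto
      then show ?thesis
        using True by (simp add: u_def r_def)
    next
      case False
      then show ?thesis
        using p[OF x] by (simp add: u_def r_def)
    qed
  next
    fix x y i j q
    assume x: "x \<in> verts G" and y: "y \<in> verts G" and uq: "u x i = q @ u y j" and rr: "r x i = r y j"
    have nd: "\<not> double (g (N w l))" if "w \<in> verts G" "w \<notin> D" for w l
      using g1[OF that] that(2) unfolding D_def by blast
    have "N x i = N y j"
    proof (cases "x \<in> D"; cases "y \<in> D")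
      assume xD: "x \<in> D" and yD: "y \<in> D"
      then have zz: "z x = z y"
        using rr by (simp add: r_def)
      have "t x @ a (z y) @ concat (replicate (N x i) (b (z y))) =
          (q @ t y) @ a (z y) @ concat (replicate (N y j) (b (z y)))"
        using uq xD yD by (simp add: u_def zz)
      then show ?thesis
        using block_code ab zt[OF yD] by metis
    next
      assume xD: "x \<in> D" and yD: "y \<notin> D"
      then have "double (g (N y j))"
        using rr zt[OF xD] by (simp add: r_def)
      then show ?thesis
        using nd[OF y yD] by blast
    next
      assume xD: "x \<notin> D" and yD: "y \<in> D"
      then have "double (g (N x i))"
        using rr zt[OF yD] by (simp add: r_def)
      then show ?thesis
        using nd[OF x xD] by blast
    next
      assume xD: "x \<notin> D" and yD: "y \<notin> D"
      then have "g (N x i) = g (N y j)"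
        using rr by (simp add: r_def)
      then show ?thesis
        using g1[OF x xD, of i] g1[OF y yD, of j] by (metis image_eqI lessThan_iff linorder_neqE_nat)
    qed
    then show "x = y \<and> i = j"
      using N x y by blast
  qed
qed

end

context fock begin

text \<open>Appending at each range the path from the suffix code is injective on pairs of an index and a path.\<close>

lemma orthogonal_isometries_exist:
  assumes count: "countable (verts G)" and uapp: "uniform_aperiodic_path_property G"
  obtains X0 X1 where "X0 \<in> right_commutant" "is_isometry X0" "X1 \<in> right_commutant" "is_isometry X1"
    "\<And>h k. cinner (blinfun_apply X0 h) (blinfun_apply X1 k) = 0"
proof -
  obtain u r where u: "\<And>x i. x \<in> verts G \<Longrightarrow> awalk x (u x i) (r x i)"
    and code: "\<And>x y i j q. x \<in> verts G \<Longrightarrow> y \<in> verts G \<Longrightarrow> u x i = q @ u y j \<Longrightarrow> r x i = r y j \<Longrightarrow>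
      x = y \<and> i = (j::bool)"
    by (rule suffix_code[OF count uapp]) blast
  define f where "f = (\<lambda>i w. (fst w, snd w @ u (path_range G w) i))"
  have f_path: "(y, p @ u (path_range G (y, p)) i) \<in> paths"
    "path_range G (y, p @ u (path_range G (y, p)) i) = r (path_range G (y, p)) i"
    if "(y, p) \<in> paths" for y p i
    using awalk_path[OF awalk_appendI[OF path_awalk[OF that] u[OF range_in_verts[OF that]]]] by simp_all
  have inj: "i = j \<and> v = w" if v: "v \<in> paths" and w: "w \<in> paths" and eq: "f i v = f j w" for i j v w
  proof -
    obtain y p z q where *: "v = (y, p)" "w = (z, q)" by fastforce
    let ?x = "path_range G (y, p)" and ?x' = "path_range G (z, q)"
    have zy: "z = y" and pq: "p @ u ?x i = q @ u ?x' j"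
      using eq by (auto simp: f_def *)
    have X: "?x \<in> verts G" "?x' \<in> verts G"
      using v w range_in_verts by (auto simp: *)
    have r: "r ?x i = r ?x' j"
      using f_path(2)[of y p i] f_path(2)[of z q j] v w pq zy by (simp add: *)
    have "?x = ?x' \<and> i = j"
      using pq unfolding append_eq_append_conv2
      using code[OF X _ r] code[OF X(2,1) _ r[symmetric]] by metis
    then show ?thesis
      using pq zy by (simp add: *)
  qed
  have pinj: "partial_injection (\<lambda>w. Some (f i w))" for i
    unfolding partial_injection_def
  proof (intro conjI ballI allI impI)
    fix w v assume "w \<in> paths" "Some (f i w) = Some v"
    then show "v \<in> paths"
      using f_path(1) by (cases w) (auto simp: f_def)
  next
    fix v w z assume "v \<in> paths" "w \<in> paths" "Some (f i v) = Some z" "Some (f i w) = Some z"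
    then show "v = w"
      using inj[of v w i i] by simp
  qed
  define X where "X = (\<lambda>i. basis_map (\<lambda>w. Some (f i w)))"
  have X_basis: "X i (\<xi> w) = \<xi> (f i w)" if "w \<in> paths" for i w
    using that by (simp add: X_def basis_map_apply[OF pinj])
  have XB: "X i \<in> bounded_operators" for i
    unfolding X_def by (rule basis_map_bounded[OF pinj])
  have f_in: "f i w \<in> paths" if "w \<in> paths" for i w
    using that f_path(1) by (cases w) (simp add: f_def)
  have X_iso: "is_isometry (X i)" for i
    unfolding X_def by (rule basis_map_isometry[OF pinj]) simp
  have X_comm: "X i \<in> right_commutant" for i
    by (rule right_commutantI_basis[OF XB])
       (use f_path(1) in \<open>auto simp: right_op_basis source_proj_basis X_basis f_def range_Cons\<close>)
  show ?thesis
  proof (rule that[OF X_comm X_iso X_comm X_iso])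
    show "cinner (X True h) (X False k) = 0" for h k
    proof (rule orthogonal_operatorsI[OF XB XB])
      fix v w assume "v \<in> paths" "w \<in> paths"
      then show "cinner (X True (\<xi> v)) (X False (\<xi> w)) = 0"
        using inj[of v w True False] by (auto simp: X_basis cinner_basis f_in)
    qed
  qed
qed

end

section \<open>Averages of isometries\<close>

inductive sum_of :: "'a::comm_monoid_add set \<Rightarrow> nat \<Rightarrow> 'a \<Rightarrow> bool" for S where
  Nil: "sum_of S 0 0"
| Cons: "a \<in> S \<Longrightarrow> sum_of S n t \<Longrightarrow> sum_of S (Suc n) (a + t)"

lemma sum_of_add: "sum_of S m a \<Longrightarrow> sum_of S n b \<Longrightarrow> sum_of S (m + n) (a + b)"
  by (induction rule: sum_of.induct) (auto simp: add.assoc intro: sum_of.Cons)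

lemma sum_of_single: "a \<in> S \<Longrightarrow> sum_of S 1 a"
  using sum_of.Cons[OF _ sum_of.Nil, of a S] by simp

lemma sum_of_family: "sum_of S n t \<Longrightarrow> \<exists>V. (\<forall>i\<in>{1..n}. V i \<in> S) \<and> t = (\<Sum>i = 1..n. V i)"
proof (induction rule: sum_of.induct)
  case (Cons a n t)
  then obtain V where V: "\<forall>i\<in>{1..n}. V i \<in> S" "t = (\<Sum>i = 1..n. V i)" by auto
  show ?case
  proof (intro exI conjI)
    show "\<forall>i\<in>{1..Suc n}. (V(Suc n := a)) i \<in> S"
      using V Cons by auto
    have "(\<Sum>i = 1..n. (V(Suc n := a)) i) = (\<Sum>i = 1..n. V i)"
      by (intro sum.cong) auto
    then show "a + t = (\<Sum>i = 1..Suc n. (V(Suc n := a)) i)"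
      by (simp add: V add.commute)
  qed
qed simp

context fock begin

lemma right_commutant_id: "id_blinfun \<in> right_commutant"
  by (rule right_commutantI) simp_all

lemma right_commutant_add: "S \<in> right_commutant \<Longrightarrow> T \<in> right_commutant \<Longrightarrow> S + T \<in> right_commutant"
  using right_commutant_operator_algebra by (simp add: operator_algebra_def)

lemma right_commutant_compose: "S \<in> right_commutant \<Longrightarrow> T \<in> right_commutant \<Longrightarrow> S o\<^sub>L T \<in> right_commutant"
  using right_commutant_operator_algebra by (simp add: operator_algebra_def)

lemma right_commutant_scaleR: "T \<in> right_commutant \<Longrightarrow> r *\<^sub>R T \<in> right_commutant"
  using right_commutant_operator_algebra unfolding operator_algebra_def
  by (metis scaleC_blinfun_of_real)

lemma right_commutant_diff: "S \<in> right_commutant \<Longrightarrow> T \<in> right_commutant \<Longrightarrow> S - T \<in> right_commutant"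
  using right_commutant_add[of S "(-1) *\<^sub>R T"] right_commutant_scaleR[of T "-1"] by simp

lemma right_commutant_closed: "closed right_commutant"
  unfolding closed_sequential_limits
proof (intro allI impI, elim conjE)
  fix T and T0 :: "'h \<Rightarrow>\<^sub>L 'h"
  assume "\<forall>n. T n \<in> right_commutant" "T \<longlonglongrightarrow> T0"
  then show "T0 \<in> right_commutant"
    using wot_closed_norm_limit[OF right_commutant_wot_closed trivial_limit_sequentially, of T] by simp
qed

definition isometries :: "('h \<Rightarrow>\<^sub>L 'h) set" where
  "isometries = {V \<in> right_commutant. is_isometry V}"

definition proper_isometries :: "('h \<Rightarrow>\<^sub>L 'h) set" where
  "proper_isometries = {U \<in> isometries.
     \<exists>Y\<in>isometries. \<forall>h k. cinner (blinfun_apply U h) (blinfun_apply Y k) = 0}"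

lemma isometriesD:
  assumes "V \<in> isometries"
  shows "V \<in> right_commutant" "is_isometry V" "norm (blinfun_apply V h) = norm h"
    "cinner (blinfun_apply V h) (blinfun_apply V k) = cinner h k"
  using assms isometry_cinner by (auto simp: isometries_def is_isometry_def)

lemma isometriesI:
  "V \<in> right_commutant \<Longrightarrow> (\<And>h. (norm (blinfun_apply V h))\<^sup>2 = (norm h)\<^sup>2) \<Longrightarrow> V \<in> isometries"
  by (simp add: isometries_def is_isometry_def right_commutant_bounded)

lemma isometries_compose: "U \<in> isometries \<Longrightarrow> V \<in> isometries \<Longrightarrow> U o\<^sub>L V \<in> isometries"
  by (rule isometriesI) (simp_all add: isometriesD right_commutant_compose)

lemma isometries_uminus: "V \<in> isometries \<Longrightarrow> - V \<in> isometries"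
  using right_commutant_scaleR[of V "-1"] by (intro isometriesI) (simp_all add: isometriesD blinfun.minus_left)

lemma norm_add_orthogonal:
  "cinner x (y::'h) = 0 \<Longrightarrow> (norm (x + y))\<^sup>2 = (norm x)\<^sup>2 + (norm y)\<^sup>2"
  by (simp add: norm_add_square)

text \<open>An isometry orthogonal to the range of \<open>U + c\<close>: up to a factor it is
  \<open>(1 + c U)\<^sup>-\<^sup>1 Y\<close>, because \<open>W = Y - c U W\<close> gives \<open>U\<^sup>* W = - c W\<close>.\<close>

lemma room_for_translate:
  assumes U: "U \<in> isometries" and Y: "Y \<in> isometries"
    and orth: "\<And>h k. cinner (blinfun_apply U h) (blinfun_apply Y k) = 0"
    and c: "0 \<le> c" "c < 1"
  obtains W where "W \<in> isometries"
    "\<And>h k. cinner (blinfun_apply U h + c *\<^sub>R h) (blinfun_apply W k) = 0"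
proof -
  have "\<exists>!W\<in>right_commutant. Y - c *\<^sub>R (U o\<^sub>L W) = W"
  proof (rule Banach_fix)
    show "complete right_commutant"
      using right_commutant_closed by (simp add: complete_eq_closed)
    show "(\<lambda>W. Y - c *\<^sub>R (U o\<^sub>L W)) ` right_commutant \<subseteq> right_commutant"
      using isometriesD(1)[OF U] isometriesD(1)[OF Y] by (auto intro: right_commutant_diff right_commutant_scaleR right_commutant_compose)
    show "dist (Y - c *\<^sub>R (U o\<^sub>L V)) (Y - c *\<^sub>R (U o\<^sub>L W)) \<le> c * dist V W" for V W
    proof -
      have "norm (U o\<^sub>L (W - V)) \<le> norm (W - V)"
      proof (rule norm_blinfun_bound)
        fix h
        show "norm ((U o\<^sub>L (W - V)) h) \<le> norm (W - V) * norm h"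
          by (simp add: isometriesD(3)[OF U] norm_blinfun)
      qed simp
      moreover have "(Y - c *\<^sub>R (U o\<^sub>L V)) - (Y - c *\<^sub>R (U o\<^sub>L W)) = c *\<^sub>R (U o\<^sub>L (W - V))"
        by (rule blinfun_eqI)
           (simp add: blinfun.diff_left blinfun.diff_right blinfun.scaleR_left algebra_simps)
      ultimately show ?thesis
        using c by (simp add: dist_norm norm_minus_commute[of V W] mult_left_mono)
    qed
  qed (use right_commutant_id c in auto)
  then obtain W where W: "W \<in> right_commutant" "Y - c *\<^sub>R (U o\<^sub>L W) = W" by auto
  have W_apply: "W k = Y k - c *\<^sub>R U (W k)" for k
    by (metis W(2) blinfun.diff_left blinfun.scaleR_left blinfun_apply_blinfun_compose)
  have UW: "cinner (U h) (W k) = - complex_of_real c * cinner h (W k)" for h k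
    by (subst W_apply) (simp add: cinner_simps orth isometriesD(4)[OF U])
  have norm_W: "(norm (W k))\<^sup>2 * (1 - c\<^sup>2) = (norm k)\<^sup>2" for k
  proof -
    have "Y k = W k + c *\<^sub>R U (W k)"
      using W_apply[of k] by (simp add: algebra_simps)
    then have "(norm k)\<^sup>2 = (norm (W k + c *\<^sub>R U (W k)))\<^sup>2"
      using isometriesD(3)[OF Y, of k] by simp
    also have "\<dots> = (norm (W k))\<^sup>2 + c\<^sup>2 * (norm (W k))\<^sup>2 + 2 * Re (cinner (c *\<^sub>R U (W k)) (W k))"
      unfolding norm_add_square
      by (subst (2) cinner_commute) (simp add: isometriesD(3)[OF U] power_mult_distrib)
    also have "Re (cinner (c *\<^sub>R U (W k)) (W k)) = - c\<^sup>2 * (norm (W k))\<^sup>2"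
      by (simp add: cinner_simps UW cinner_self power2_eq_square)
    finally show ?thesis
      by (simp add: algebra_simps)
  qed
  have c2: "0 < 1 - c\<^sup>2"
    using c by (simp add: power_less_one_iff abs_square_less_1)
  show ?thesis
  proof
    show "sqrt (1 - c\<^sup>2) *\<^sub>R W \<in> isometries"
    proof (rule isometriesI[OF right_commutant_scaleR[OF W(1)]])
      fix h
      show "(norm ((sqrt (1 - c\<^sup>2) *\<^sub>R W) h))\<^sup>2 = (norm h)\<^sup>2"
        using norm_W[of h] c2 by (simp add: blinfun.scaleR_left power_mult_distrib mult.commute)
    qed
    show "cinner (U h + c *\<^sub>R h) ((sqrt (1 - c\<^sup>2) *\<^sub>R W) k) = 0" for h k
      by (simp add: blinfun.scaleR_left cinner_simps UW)
  qed
qed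

context
  fixes X0 X1 :: "'h \<Rightarrow>\<^sub>L 'h"
  assumes X0: "X0 \<in> isometries" and X1: "X1 \<in> isometries"
    and X01: "\<And>h k. cinner (blinfun_apply X0 h) (blinfun_apply X1 k) = 0"
begin

lemma X0_proper: "X0 \<in> proper_isometries" "- X0 \<in> proper_isometries"
  using X0 X1 X01 isometries_uminus[OF X0]
  by (auto simp: proper_isometries_def blinfun.minus_left cinner_minus_left intro!: bexI[of _ X1])

text \<open>The step of Kadison and Pedersen for the scalar \<open>c\<close>: the two summands are
  \<open>(U + c)/2 \<plusminus> W X\<^sub>0 (\<alpha> - \<beta> U)\<close>, where \<open>|\<alpha> - \<beta> U|\<^sup>2 = 1 - |U + c|\<^sup>2 / 4\<close>
  amounts to \<open>\<alpha>\<^sup>2 + \<beta>\<^sup>2 = (3 - c\<^sup>2)/4\<close> and \<open>\<alpha> \<beta> = c/4\<close>.\<close>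

lemma proper_translate:
  assumes U: "U \<in> proper_isometries" and c: "0 \<le> c" "c < 1"
  obtains U1 U2 where "U1 \<in> proper_isometries" "U2 \<in> proper_isometries" "U + c *\<^sub>R id_blinfun = U1 + U2"
proof -
  obtain Y where UI: "U \<in> isometries" and Y: "Y \<in> isometries"
    and orth: "\<And>h k. cinner (U h) (Y k) = 0"
    using U by (auto simp: proper_isometries_def)
  obtain W where W: "W \<in> isometries" and W_orth: "\<And>h k. cinner (U h + c *\<^sub>R h) (W k) = 0"
    using room_for_translate[OF UI Y orth c] by blast
  define s where "s = sqrt ((3 - c) * (1 + c)) / 2"
  define t where "t = sqrt ((3 + c) * (1 - c)) / 2"
  define \<alpha> where "\<alpha> = (s + t) / 2"
  define \<beta> where "\<beta> = (s - t) / 2"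
  have s2: "s\<^sup>2 = (3 - c) * (1 + c) / 4" and t2: "t\<^sup>2 = (3 + c) * (1 - c) / 4"
    using c by (simp_all add: s_def t_def power_divide)
  have ab: "\<alpha>\<^sup>2 + \<beta>\<^sup>2 = (3 - c\<^sup>2) / 4" "\<alpha> * \<beta> = c / 4"
  proof -
    have "\<alpha>\<^sup>2 + \<beta>\<^sup>2 = (s\<^sup>2 + t\<^sup>2) / 2" "\<alpha> * \<beta> = (s\<^sup>2 - t\<^sup>2) / 4"
      by (simp_all add: \<alpha>_def \<beta>_def power2_eq_square field_simps)
    moreover have "((3 - c) * (1 + c) / 4 + (3 + c) * (1 - c) / 4) / 2 = (3 - c\<^sup>2) / 4"
      "((3 - c) * (1 + c) / 4 - (3 + c) * (1 - c) / 4) / 4 = c / 4"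
      by (simp_all add: power2_eq_square field_simps)
    ultimately show "\<alpha>\<^sup>2 + \<beta>\<^sup>2 = (3 - c\<^sup>2) / 4" "\<alpha> * \<beta> = c / 4"
      by (simp_all only: s2 t2)
  qed
  define B where "B = (1/2) *\<^sub>R (U + c *\<^sub>R id_blinfun)"
  define C where "C = \<alpha> *\<^sub>R id_blinfun - \<beta> *\<^sub>R U"
  define V where "V = (\<lambda>\<sigma>. B + \<sigma> *\<^sub>R (W o\<^sub>L X0 o\<^sub>L C))"
  have BC: "B \<in> right_commutant" "C \<in> right_commutant"
    unfolding B_def C_def by (intro right_commutant_scaleR right_commutant_add right_commutant_diff right_commutant_id isometriesD(1)[OF UI])+
  have B_apply: "B h = (1/2) *\<^sub>R (U h + c *\<^sub>R h)" and C_apply: "C h = \<alpha> *\<^sub>R h - \<beta> *\<^sub>R U h" for h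
    by (simp_all add: B_def C_def blinfun.add_left blinfun.diff_left blinfun.scaleR_left)
  have B_orth: "cinner (B h) (W k) = 0" for h k
    using W_orth[of h k] by (simp add: B_apply cinner_scaleR_left)
  have norms: "(norm (B h))\<^sup>2 + (norm (C h))\<^sup>2 = (norm h)\<^sup>2" for h
  proof -
    define n where "n = (norm h)\<^sup>2"
    define \<rho> where "\<rho> = Re (cinner (U h) h)"
    have "(norm (U h + c *\<^sub>R h))\<^sup>2 = n + c\<^sup>2 * n + 2 * c * \<rho>"
      unfolding norm_add_square
      by (simp add: isometriesD(3)[OF UI] n_def \<rho>_def power_mult_distrib cinner_simps)
    moreover have "(norm (\<alpha> *\<^sub>R h + (- \<beta>) *\<^sub>R U h))\<^sup>2 = \<alpha>\<^sup>2 * n + \<beta>\<^sup>2 * n - 2 * (\<alpha> * \<beta>) * \<rho>"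
    proof -
      have "Re (cinner h (U h)) = \<rho>"
        unfolding \<rho>_def by (subst cinner_commute) simp
      then show ?thesis
        unfolding norm_add_square
        by (simp add: isometriesD(3)[OF UI] n_def power_mult_distrib cinner_simps cinner_minus_right)
    qed
    moreover have "(norm (B h))\<^sup>2 = (norm (U h + c *\<^sub>R h))\<^sup>2 / 4"
      by (simp add: B_apply power_divide)
    moreover have "C h = \<alpha> *\<^sub>R h + (- \<beta>) *\<^sub>R U h"
      by (simp add: C_apply)
    ultimately have "(norm (B h))\<^sup>2 + (norm (C h))\<^sup>2
        = (n + c\<^sup>2 * n + 2 * c * \<rho>) / 4 + ((\<alpha>\<^sup>2 + \<beta>\<^sup>2) * n - 2 * (\<alpha> * \<beta>) * \<rho>)"
      by (simp only:) (simp add: algebra_simps)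
    also have "\<dots> = n"
      unfolding ab by (simp add: field_simps)
    finally show ?thesis
      by (simp add: n_def)
  qed
  have V_apply: "V \<sigma> h = B h + \<sigma> *\<^sub>R W (X0 (C h))" for \<sigma> h
    by (simp add: V_def blinfun.add_left blinfun.scaleR_left)
  have V_proper: "V \<sigma> \<in> proper_isometries" if \<sigma>: "\<sigma>\<^sup>2 = 1" for \<sigma>
  proof -
    have "V \<sigma> \<in> right_commutant"
      unfolding V_def by (intro right_commutant_add right_commutant_scaleR right_commutant_compose BC isometriesD(1)[OF W] isometriesD(1)[OF X0])
    moreover have "(norm (V \<sigma> h))\<^sup>2 = (norm h)\<^sup>2" for h
    proof -
      have "(norm (V \<sigma> h))\<^sup>2 = (norm (B h))\<^sup>2 + (norm (\<sigma> *\<^sub>R W (X0 (C h))))\<^sup>2"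
        unfolding V_apply by (rule norm_add_orthogonal) (simp add: cinner_scaleR_right B_orth)
      also have "(norm (\<sigma> *\<^sub>R W (X0 (C h))))\<^sup>2 = (norm (C h))\<^sup>2"
        by (simp add: isometriesD(3)[OF W] isometriesD(3)[OF X0] power_mult_distrib \<sigma>)
      finally show ?thesis
        by (simp add: norms)
    qed
    ultimately have "V \<sigma> \<in> isometries"
      by (rule isometriesI)
    moreover have "W o\<^sub>L X1 \<in> isometries"
      by (rule isometries_compose[OF W X1])
    moreover have "cinner (V \<sigma> h) ((W o\<^sub>L X1) k) = 0" for h k
      by (simp add: V_apply cinner_simps B_orth isometriesD(4)[OF W] X01)
    ultimately show ?thesis
      unfolding proper_isometries_def by blast
  qed
  show ?thesis
  proof
    show "V 1 \<in> proper_isometries" "V (-1) \<in> proper_isometries"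
      by (rule V_proper, simp)+
    have "V 1 + V (-1) = 2 *\<^sub>R B"
      by (simp add: V_def scaleR_2)
    then show "U + c *\<^sub>R id_blinfun = V 1 + V (-1)"
      by (simp add: B_def)
  qed
qed

lemma proper_translate_sum:
  assumes c: "0 \<le> c" "c < 1"
  shows "U \<in> proper_isometries \<Longrightarrow>
    sum_of proper_isometries (Suc j) (U + (real j * c) *\<^sub>R id_blinfun)"
proof (induction j arbitrary: U)
  case 0
  then show ?case
    using sum_of_single[of U] by simp
next
  case (Suc j)
  obtain U1 U2 where U12: "U1 \<in> proper_isometries" "U2 \<in> proper_isometries" "U + c *\<^sub>R id_blinfun = U1 + U2"
    using proper_translate[OF Suc.prems c] by blast
  have "sum_of proper_isometries (Suc (Suc j)) (U1 + (U2 + (real j * c) *\<^sub>R id_blinfun))"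
    by (rule sum_of.Cons[OF U12(1) Suc.IH[OF U12(2)]])
  also have "U1 + (U2 + (real j * c) *\<^sub>R id_blinfun) = (U + c *\<^sub>R id_blinfun) + (real j * c) *\<^sub>R id_blinfun"
    by (simp add: U12 add.assoc)
  also have "\<dots> = U + (real (Suc j) * c) *\<^sub>R id_blinfun"
    by (simp add: algebra_simps)
  finally show ?case .
qed

text \<open>Adding the decompositions that start from \<open>X\<^sub>0\<close> and from \<open>- X\<^sub>0\<close>, the two isometries cancel.\<close>

lemma scalar_sum_of_proper:
  assumes c: "0 \<le> c" "c < 1"
  shows "sum_of proper_isometries (2 * Suc j) ((2 * (real j * c)) *\<^sub>R id_blinfun)"
proof -
  have "sum_of proper_isometries (Suc j + Suc j)
      ((X0 + (real j * c) *\<^sub>R id_blinfun) + (- X0 + (real j * c) *\<^sub>R id_blinfun))"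
    by (intro sum_of_add proper_translate_sum[OF c] X0_proper)
  also have "(X0 + (real j * c) *\<^sub>R id_blinfun) + (- X0 + (real j * c) *\<^sub>R id_blinfun)
      = (2 * (real j * c)) *\<^sub>R id_blinfun"
    by (simp flip: scaleR_add_left)
  finally show ?thesis
    by (simp only: mult_2[of "Suc j"])
qed

text \<open>With \<open>A\<^sup>* A + D\<^sup>* D = 1\<close> and an isometry \<open>Q\<close> whose range is orthogonal to that of \<open>P\<close>,
  each \<open>P A + Q (a X\<^sub>0 + b X\<^sub>1) D\<close> with \<open>a\<^sup>2 + b\<^sup>2 = 1\<close> is an isometry; three
  unit vectors \<open>(a, b)\<close> with sum zero make the second terms cancel.\<close>

lemma proper_multiple_sum:
  assumes P: "P \<in> proper_isometries" and A: "A \<in> right_commutant" "norm A < 1"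
  shows "sum_of isometries 3 (3 *\<^sub>R (P o\<^sub>L A))"
proof -
  obtain Q where PI: "P \<in> isometries" and Q: "Q \<in> isometries"
    and orth: "\<And>h k. cinner (P h) (Q k) = 0"
    using P by (auto simp: proper_isometries_def)
  obtain D where D: "D \<in> right_commutant" "\<And>h. (norm (D h))\<^sup>2 = (norm h)\<^sup>2 - (norm (A h))\<^sup>2"
    using outer_factor_exists[OF A] by auto
  define V where "V = (\<lambda>a b. (P o\<^sub>L A) + a *\<^sub>R (Q o\<^sub>L X0 o\<^sub>L D) + b *\<^sub>R (Q o\<^sub>L X1 o\<^sub>L D))"
  have V: "V a b \<in> isometries" if ab: "a\<^sup>2 + b\<^sup>2 = 1" for a b
  proof (rule isometriesI)
    show "V a b \<in> right_commutant"
      unfolding V_def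
      by (intro right_commutant_add right_commutant_scaleR right_commutant_compose A D isometriesD(1)[OF PI] isometriesD(1)[OF Q]
          isometriesD(1)[OF X0] isometriesD(1)[OF X1])
    fix h
    let ?y = "a *\<^sub>R X0 (D h) + b *\<^sub>R X1 (D h)"
    have "(norm ?y)\<^sup>2 = (norm (a *\<^sub>R X0 (D h)))\<^sup>2 + (norm (b *\<^sub>R X1 (D h)))\<^sup>2"
      by (rule norm_add_orthogonal) (simp add: cinner_simps X01)
    also have "\<dots> = (a\<^sup>2 + b\<^sup>2) * (norm (D h))\<^sup>2"
      by (simp add: power_mult_distrib isometriesD(3)[OF X0] isometriesD(3)[OF X1] algebra_simps)
    finally have y: "(norm ?y)\<^sup>2 = (norm (D h))\<^sup>2"
      by (simp add: ab)
    have "V a b h = P (A h) + Q ?y"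
      by (simp add: V_def blinfun.add_left blinfun.scaleR_left blinfun.add_right blinfun.scaleR_right)
    then have "(norm (V a b h))\<^sup>2 = (norm (P (A h)))\<^sup>2 + (norm (Q ?y))\<^sup>2"
      using norm_add_orthogonal[OF orth, of "A h" ?y] by simp
    then show "(norm (V a b h))\<^sup>2 = (norm h)\<^sup>2"
      by (simp add: isometriesD(3)[OF PI] isometriesD(3)[OF Q] y D(2))
  qed
  have "sum_of isometries (1 + (1 + 1)) (V 1 0 + (V (-1/2) (sqrt 3 / 2) + V (-1/2) (- sqrt 3 / 2)))"
    by (intro sum_of_add sum_of_single V) (simp_all add: power_divide)
  also have "V 1 0 + (V (-1/2) (sqrt 3 / 2) + V (-1/2) (- sqrt 3 / 2)) = 3 *\<^sub>R (P o\<^sub>L A)"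
  proof (rule blinfun_eqI)
    fix h
    define x y z where "x = P (A h)" and "y = Q (X0 (D h))" and "z = Q (X1 (D h))"
    have V_apply: "V a b h = x + a *\<^sub>R y + b *\<^sub>R z" for a b
      by (simp add: V_def blinfun.add_left blinfun.scaleR_left x_def y_def z_def)
    have x3: "3 *\<^sub>R x = x + (x + x)"
      using scaleR_add_left[of 1 2 x] by (simp add: scaleR_2)
    have y0: "1 *\<^sub>R y + ((-1/2) *\<^sub>R y + (-1/2) *\<^sub>R y) = 0"
      by (simp only: scaleR_add_left[symmetric]) simp
    have z0: "0 *\<^sub>R z + ((sqrt 3 / 2) *\<^sub>R z + (- sqrt 3 / 2) *\<^sub>R z) = 0"
      by (simp flip: scaleR_add_left)
    have regroup: "(x1 + y1 + z1) + ((x2 + y2 + z2) + (x3 + y3 + z3)) =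
        (x1 + (x2 + x3)) + (y1 + (y2 + y3)) + (z1 + (z2 + z3))" for x1 x2 x3 y1 y2 y3 z1 z2 z3 :: 'h
      by (simp add: add_ac)
    show "(V 1 0 + (V (-1/2) (sqrt 3 / 2) + V (-1/2) (- sqrt 3 / 2))) h = (3 *\<^sub>R (P o\<^sub>L A)) h"
      unfolding blinfun.add_left V_apply regroup y0 z0 by (simp add: x3 blinfun.scaleR_left flip: x_def)
  qed
  finally show ?thesis
    by (simp add: numeral_3_eq_3)
qed

lemma sum_of_proper_multiple:
  assumes A: "A \<in> right_commutant" "norm A < 1"
  shows "sum_of proper_isometries n T \<Longrightarrow> sum_of isometries (3 * n) (3 *\<^sub>R (T o\<^sub>L A))"
proof (induction rule: sum_of.induct)
  case Nil
  then show ?case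
    by (simp add: sum_of.Nil)
next
  case (Cons P n T)
  have "sum_of isometries (3 + 3 * n) (3 *\<^sub>R (P o\<^sub>L A) + 3 *\<^sub>R (T o\<^sub>L A))"
    by (intro sum_of_add proper_multiple_sum Cons A)
  also have "3 *\<^sub>R (P o\<^sub>L A) + 3 *\<^sub>R (T o\<^sub>L A) = 3 *\<^sub>R ((P + T) o\<^sub>L A)"
    by (rule blinfun_eqI) (simp add: blinfun.add_left blinfun.scaleR_left scaleR_add_right)
  finally show ?case by simp
qed

text \<open>Since \<open>k (1 - 1/k) = k - 1\<close>, the scalar that has to be written as a sum of \<open>2 k\<close> proper isometries is
  the one that \<open>k - 1\<close> steps from each of \<open>X\<^sub>0\<close> and \<open>- X\<^sub>0\<close> produce, up to a factor less than \<open>1\<close>.\<close>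

lemma average_of_isometries:
  assumes A: "A \<in> right_commutant" and k: "k \<ge> 1" "norm A < 1 - 1 / real k"
  shows "sum_of isometries (6 * k) (real (6 * k) *\<^sub>R A)"
proof -
  define m where "m = 1 - 1 / real k"
  have m: "norm A < m" "0 < m"
    using k(2) order_le_less_trans[OF norm_ge_zero k(2)] by (simp_all only: m_def)
  \<comment> \<open>With \<open>c\<close> halfway between \<open>\<parallel>A\<parallel> / m\<close> and \<open>1\<close>, both \<open>c\<close> and \<open>\<parallel>A\<parallel> / (m c)\<close> are less than \<open>1\<close>.\<close>
  define q where "q = norm A / m"
  have q: "0 \<le> q" "q < 1" "norm A = m * q"
    using m by (simp_all add: q_def divide_less_eq_1_pos)
  define c where "c = (q + 1) / 2"
  have c: "0 < c" "c < 1" "norm A < m * c"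
    using q m(2) by (simp_all add: c_def)
  define B where "B = (1 / (m * c)) *\<^sub>R A"
  have B: "B \<in> right_commutant" "norm B < 1"
    using A c m by (auto simp: B_def right_commutant_scaleR divide_simps)
  obtain j where j: "k = Suc j"
    using k by (cases k) auto
  have "sum_of isometries (3 * (2 * Suc j)) (3 *\<^sub>R ((2 * (real j * c)) *\<^sub>R id_blinfun o\<^sub>L B))"
    using c by (intro sum_of_proper_multiple[OF B] scalar_sum_of_proper) auto
  also have "3 *\<^sub>R ((2 * (real j * c)) *\<^sub>R id_blinfun o\<^sub>L B) = (6 * real j * c) *\<^sub>R B"
    by (rule blinfun_eqI) (simp add: blinfun.scaleR_left)
  also have "\<dots> = real (6 * k) *\<^sub>R A"
  proof -
    have "real j = real k * m"
      using k by (simp add: m_def j field_simps)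
    then show ?thesis
      using m c by (simp add: B_def)
  qed
  finally show ?thesis
    by (simp add: j)
qed

end

end

theorem theorem4p6:
  fixes G :: "('v, 'e) pre_digraph"
    and \<xi> :: "('v, 'e) path \<Rightarrow> 'h::chilbert_space"
    and A :: "'h \<Rightarrow>\<^sub>L 'h"
    and k :: nat
  assumes "wf_digraph G"
    and "countable (verts G)"
    and "countable (arcs G)"
    and "orthonormal_basis \<xi> (free_semigroupoid G)"
    and "uniform_aperiodic_path_property G"
    and "A \<in> free_semigroupoid_algebra G \<xi>"
    and "k \<ge> 1"
    and "norm A < 1 - 1 / real k"
  shows "\<exists>V :: nat \<Rightarrow> 'h \<Rightarrow>\<^sub>L 'h.
           (\<forall>i\<in>{1..6 * k}. V i \<in> free_semigroupoid_algebra G \<xi> \<and> is_isometry (V i)) \<and>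
           A = (1 / real (6 * k)) *\<^sub>R (\<Sum>i = 1..6 * k. V i)"
proof -
  interpret fock G \<xi>
    using assms(1,4) by (intro fock.intro orthonormal.intro)
  obtain X0 X1 where X: "X0 \<in> right_commutant" "is_isometry X0" "X1 \<in> right_commutant" "is_isometry X1"
    "\<And>h k. cinner (X0 h) (X1 k) = 0"
    using orthogonal_isometries_exist[OF assms(2,5)] by blast
  have "sum_of isometries (6 * k) (real (6 * k) *\<^sub>R A)"
    using X assms(6-8)
    by (intro average_of_isometries[of X0 X1]) (auto simp: isometries_def algebra_eq_commutant)
  then obtain V where V: "\<forall>i\<in>{1..6 * k}. V i \<in> isometries" "real (6 * k) *\<^sub>R A = (\<Sum>i = 1..6 * k. V i)"
    using sum_of_family by blast
  have "A = (1 / real (6 * k)) *\<^sub>R (\<Sum>i = 1..6 * k. V i)"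
    unfolding V(2)[symmetric] using assms(7) by simp
  then show ?thesis
    using V(1) by (intro exI[of _ V]) (auto simp: isometries_def algebra_eq_commutant)
qed

end
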